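(* Let $K$ be a field and let $H \in K[x]^m$ be a quadratic homogeneous polynomial map in the variables $x=(x_1,\ldots,x_n)$ with $\operatorname{rk}\mathcal{J}H = 3$. Then there are $S \in \operatorname{GL}_m(K)$ and $T \in \operatorname{GL}_n(K)$ such that for $\tilde{H} := S H(Tx)$, one of the following statements holds: (1) only the first $3$ rows of $\mathcal{J}\tilde{H}$ may be nonzero; (2) only the first $4$ rows of $\mathcal{J}\tilde{H}$ may be nonzero, and $(\tilde{H}_1,\tilde{H}_2,\tilde{H}_3,\tilde{H}_4) = (\tilde{H}_1, \frac12 x_1^2, x_1x_2, \frac12 x_2^2)$ (in particular, $\operatorname{char} K\neq 2$); (3) only the first $4$ rows of $\mathcal{J}\tilde{H}$ may be nonzero, $\mathcal{J}(\tilde{H}_1,\tilde{H}_2,\tilde{H}_3,\tilde{H}_4) = \mathcal{J}(\tilde{H}_1, x_1x_2, x_1x_3, x_2x_3)$, and $\operatorname{char} K = 2$; (4) only the first $4$ rows of $\mathcal{J}\tilde{H}$ may be nonzero, and $$(\tilde{H}_1,\tilde{H}_2,\tilde{H}_3,\tilde{H}_4) = \left(x_1x_3 + c x_2x_4,\; x_2x_3 - x_1x_4,\; \tfrac12 x_3^2 + \tfrac{c}{2}x_4^2,\; \tfrac12 x_1^2 + \tfrac{c}{2}x_2^2\right)$$ for some nonzero $c\in K$ (in particular, $\operatorname{char} K\neq 2$); (5) $\operatorname{char} K \neq 2$ and only the first $3$ columns of $\mathcal{J}\tilde{H}$ are nonzero; (6) $\operatorname{char} K = 2$ and only the first $4$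 columns of $\mathcal{J}\tilde{H}$ are nonzero. Conversely, for any quadratic homogeneous polynomial map $\tilde{H}\in K[x]^m$, one has $\operatorname{rk}\mathcal{J}\tilde{H} \le 3$ in each of the six cases (1)–(6).
   Context: $K$ is a field of arbitrary characteristic and $K[x]=K[x_1,\ldots,x_n]$. A polynomial map $H=(H_1,\ldots,H_m)\in K[x]^m$ is quadratic homogeneous if each $H_i$ is zero or homogeneous of degree $2$. $\mathcal{J}H=(\partial H_i/\partial x_j)$ is the $m\times n$ Jacobian matrix, and its rank is taken over $K(x)$. $SH(Tx)$ denotes the map obtained by substituting $Tx$ for $x$ in $H$ and then applying $S$. "Only the first $k$ rows may be nonzero" (resp. "only the first $k$ columns are nonzero") means that every row (resp. column) with index $>k$ is zero. *)

theory Defs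
  imports
    "HOL-Library.Poly_Mapping"
    "HOL-Computational_Algebra.Polynomial_Factorial"
    "Jordan_Normal_Form.DL_Rank"
begin

text \<open>
  Polynomials are finitely supported functions from exponent vectors to coefficients, in
  countably many variables \<open>X 0, X 1, \<dots>\<close>; \<open>K[x\<^sub>1,\<dots>,x\<^sub>n]\<close> consists of those in which only
  \<open>X 0, \<dots>, X (n - 1)\<close> occur. All indices start at 0, so \<open>X i\<close> is \<open>x\<^bsub>i+1\<^esub>\<close> and
  \<open>H $ i\<close> is \<open>H\<^bsub>i+1\<^esub>\<close>.
\<close>

type_synonym 'a mpoly = "(nat \<Rightarrow>\<^sub>0 nat) \<Rightarrow>\<^sub>0 'a"

definition X :: "nat \<Rightarrow> 'a::comm_ring_1 mpoly"
  where "X i = Poly_Mapping.single (Poly_Mapping.single i 1) 1"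

definition Const :: "'a::zero \<Rightarrow> 'a mpoly"
  where "Const c = Poly_Mapping.single 0 c"

definition mpolys :: "nat \<Rightarrow> 'a::zero mpoly set"
  where "mpolys n = {p. \<forall>e\<in>Poly_Mapping.keys p. Poly_Mapping.keys e \<subseteq> {..<n}}"

definition total_deg :: "(nat \<Rightarrow>\<^sub>0 nat) \<Rightarrow> nat"
  where "total_deg e = (\<Sum>i\<in>Poly_Mapping.keys e. Poly_Mapping.lookup e i)"

text \<open>The zero polynomial is homogeneous of every degree.\<close>

definition homogeneous :: "nat \<Rightarrow> 'a::zero mpoly \<Rightarrow> bool"
  where "homogeneous d p \<longleftrightarrow> (\<forall>e\<in>Poly_Mapping.keys p. total_deg e = d)"

definition quadratic_homogeneous_map :: "nat \<Rightarrow> nat \<Rightarrow> 'a::zero mpoly vec \<Rightarrow> bool"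
  where "quadratic_homogeneous_map m n H \<longleftrightarrow>
    H \<in> carrier_vec m \<and> (\<forall>i<m. H $ i \<in> mpolys n \<and> homogeneous 2 (H $ i))"

text \<open>
  The subtraction of exponents truncates only where the exponent of \<open>X i\<close> is 0, and there
  the coefficient vanishes.
\<close>

definition pderiv_mpoly :: "nat \<Rightarrow> 'a::comm_ring_1 mpoly \<Rightarrow> 'a mpoly"
  where "pderiv_mpoly i p =
    (\<Sum>e\<in>Poly_Mapping.keys p. Poly_Mapping.single (e - Poly_Mapping.single i 1)
                      (of_nat (Poly_Mapping.lookup e i) * Poly_Mapping.lookup p e))"

definition subst_mpoly :: "(nat \<Rightarrow> 'a::comm_ring_1 mpoly) \<Rightarrow> 'a mpoly \<Rightarrow> 'a mpoly"
  where "subst_mpoly \<sigma> p =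
    (\<Sum>e\<in>Poly_Mapping.keys p. Const (Poly_Mapping.lookup p e) * (\<Prod>i\<in>Poly_Mapping.keys e. \<sigma> i ^ Poly_Mapping.lookup e i))"

definition jacobian :: "nat \<Rightarrow> 'a::comm_ring_1 mpoly vec \<Rightarrow> 'a mpoly mat"
  where "jacobian n H = mat (dim_vec H) n (\<lambda>(i, j). pderiv_mpoly j (H $ i))"

text \<open>
  The rank is computed over the fraction field of the polynomial ring in all the variables.
  This field contains \<open>K(x\<^sub>1,\<dots>,x\<^sub>n)\<close>, and the rank of a matrix does not change under a
  field extension.
\<close>

definition jacobian_rank :: "nat \<Rightarrow> 'a::field mpoly vec \<Rightarrow> nat"
  where "jacobian_rank n H = vec_space.rank (dim_vec H) (map_mat to_fract (jacobian n H))"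

definition GL :: "nat \<Rightarrow> 'a::field mat set"
  where "GL n = {A \<in> carrier_mat n n. invertible_mat A}"

text \<open>The polynomial map \<open>S H(T x)\<close>.\<close>

definition linear_transform ::
    "nat \<Rightarrow> 'a::comm_ring_1 mat \<Rightarrow> 'a mat \<Rightarrow> 'a mpoly vec \<Rightarrow> 'a mpoly vec"
  where "linear_transform n S T H =
    map_mat Const S *\<^sub>v map_vec (subst_mpoly (\<lambda>j. (map_mat Const T *\<^sub>v vec n X) $ j)) H"

definition only_first_rows :: "nat \<Rightarrow> 'a::zero mat \<Rightarrow> bool"
  where "only_first_rows k A \<longleftrightarrow> (\<forall>i<dim_row A. k \<le> i \<longrightarrow> row A i = 0\<^sub>v (dim_col A))"

definition only_first_cols :: "nat \<Rightarrow> 'a::zero mat \<Rightarrow> bool"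
  where "only_first_cols k A \<longleftrightarrow> (\<forall>j<dim_col A. k \<le> j \<longrightarrow> col A j = 0\<^sub>v (dim_row A))"

text \<open>
  A case that mentions \<open>H\<^sub>4\<close> or \<open>x\<^sub>k\<close> presupposes \<open>m \<ge> 4\<close> or \<open>n \<ge> k\<close>. Since division by 0
  yields 0, the hypothesis \<open>char K \<noteq> 2\<close> implicit in the fractions is stated explicitly.
\<close>

definition case1 :: "nat \<Rightarrow> 'a::field mpoly vec \<Rightarrow> bool"
  where "case1 n H \<longleftrightarrow> only_first_rows 3 (jacobian n H)"

definition case2 :: "nat \<Rightarrow> 'a::field mpoly vec \<Rightarrow> bool"
  where "case2 n H \<longleftrightarrow> 4 \<le> dim_vec H \<and> 2 \<le> n \<and> CHAR('a) \<noteq> 2 \<and>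
    only_first_rows 4 (jacobian n H) \<and>
    vec_of_list [H $ 0, H $ 1, H $ 2, H $ 3] =
    vec_of_list [H $ 0, Const (1/2) * X 0 ^ 2, X 0 * X 1, Const (1/2) * X 1 ^ 2]"

definition case3 :: "nat \<Rightarrow> 'a::field mpoly vec \<Rightarrow> bool"
  where "case3 n H \<longleftrightarrow> 4 \<le> dim_vec H \<and> 3 \<le> n \<and> CHAR('a) = 2 \<and>
    only_first_rows 4 (jacobian n H) \<and>
    jacobian n (vec_of_list [H $ 0, H $ 1, H $ 2, H $ 3]) =
    jacobian n (vec_of_list [H $ 0, X 0 * X 1, X 0 * X 2, X 1 * X 2])"

definition case4 :: "nat \<Rightarrow> 'a::field mpoly vec \<Rightarrow> bool"
  where "case4 n H \<longleftrightarrow> 4 \<le> dim_vec H \<and> 4 \<le> n \<and> CHAR('a) \<noteq> 2 \<and>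
    only_first_rows 4 (jacobian n H) \<and>
    (\<exists>c. c \<noteq> 0 \<and>
      vec_of_list [H $ 0, H $ 1, H $ 2, H $ 3] =
      vec_of_list [X 0 * X 2 + Const c * X 1 * X 3,
                   X 1 * X 2 - X 0 * X 3,
                   Const (1/2) * X 2 ^ 2 + Const (c/2) * X 3 ^ 2,
                   Const (1/2) * X 0 ^ 2 + Const (c/2) * X 1 ^ 2])"

definition case5 :: "nat \<Rightarrow> 'a::field mpoly vec \<Rightarrow> bool"
  where "case5 n H \<longleftrightarrow> CHAR('a) \<noteq> 2 \<and> only_first_cols 3 (jacobian n H)"

definition case6 :: "nat \<Rightarrow> 'a::field mpoly vec \<Rightarrow> bool"
  where "case6 n H \<longleftrightarrow> CHAR('a) = 2 \<and> only_first_cols 4 (jacobian n H)"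

end

theory Submission
  imports Defs "HOL-Library.Function_Algebras"
begin

text \<open>
  Polarization turns \<open>H\<close> into a tensor \<open>\<beta> w x y = \<Sum>\<^sub>i w\<^sub>i D\<^sub>x D\<^sub>y H\<^sub>i\<close>, which is symmetric in \<open>x\<close> and \<open>y\<close>, and
  alternating if \<open>char K = 2\<close>; \<open>\<beta> - x -\<close> is the Jacobian matrix at the point \<open>x\<close>. At a point \<open>p\<close> of
  rank 3 choose \<open>q\<^sub>i\<close> and \<open>e\<^sub>j\<close> with \<open>\<beta> q\<^sub>i p e\<^sub>j = \<delta>\<^sub>i\<^sub>j\<close>. The 4 by 4 minors vanish along the line \<open>p + t x\<close>, and
  their coefficients in \<open>t\<close> (the expansion of a Schur complement) show, for \<open>w\<close> in the cokernel and \<open>y\<close>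
  in the kernel of \<open>\<beta> - p -\<close>, that \<open>\<beta> w x y = 0\<close> and that two further contractions of \<open>\<beta> w x\<close> with
  the \<open>\<beta> q\<^sub>i x y\<close> vanish. Thus the cokernel consists of quadratic forms in the three forms \<open>\<beta> q\<^sub>i p\<close>.
  If it is zero, case 1 holds; if it has dimension at least 2, the contractions leave no room for the
  kernel, which gives case 5 or 6. If it is spanned by one form, the rank of that form decides between
  the remaining cases.

  Over an infinite field, \<open>p\<close> is any general point. If \<open>char K \<noteq> 2\<close>, a cubic minor that vanishes
  at all points is zero, so that \<open>p\<close> exists over small fields too. If \<open>char K = 2\<close>, the generic point over
  \<open>K(x)\<close> serves instead, and the resulting rank bounds descend to \<open>K\<close>.

  Conversely, each of the cases 2, 3, 4 and 6 exhibits a nontrivial relation between the rows or the columns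
  of the Jacobian matrix; in case 6 it is Euler's relation \<open>\<Sum>\<^sub>j x\<^sub>j \<partial>H\<^sub>i/\<partial>x\<^sub>j = 2 H\<^sub>i = 0\<close>.
\<close>

section \<open>Determinant identities\<close>

text \<open>In the chosen frame the matrix on the line p + t x has blocks I + tA, tb, tc and d0 +
  td, so the two contractions are cb = 0 and cAb = 0. Where they leave a coefficient free, one more
  4 by 4 minor is evaluated directly. The characteristics part ways at p itself. If 2 is nonzero, p
  in its own kernel would turn cb = 0 with y = p into the vanishing of every cokernel form. Hence p
  can be a frame vector, and since cokernel forms vanish at p, they are binary quadratic forms. In
  characteristic 2 the form is alternating, so p always lies in its own kernel: this is the
  additional direction that makes case 6 allow four columns where case 5 allows three. Case 4 is
  multiplication in the algebra K[i] with i^2 = -c: its four forms are the components of z times the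
  conjugate of w, and half the norms of w and z. A minor may vanish at all points without being zero
  if K has two elements, as x^2 y + x y^2 does; a point over K is therefore not always available in
  characteristic 2.\<close>

lemma mat_delete_0_mat:
  "mat_delete (mat (Suc n) (Suc n) (\<lambda>(i,j). b i j)) 0 k =
     mat n n (\<lambda>(i,j). b (Suc i) (if j < k then j else Suc j))"
  by (auto simp: mat_delete_def)

lemma det_mat_Suc:
  "det (mat (Suc n) (Suc n) (\<lambda>(i,j). a i j)) =
     (\<Sum>k<Suc n. a 0 k * ((-1) ^ k * det (mat n n (\<lambda>(i,j). a (Suc i) (if j < k then j else Suc j)))))"
  by (subst laplace_expansion_row[where n="Suc n" and i=0])
     (auto simp: cofactor_def mat_delete_0_mat intro!: sum.cong)

lemma det3_explicit:
  "det (mat 3 3 (\<lambda>(i,j). a i j)) =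
     a 0 0 * (a 1 1 * a 2 2 - a 1 2 * a 2 1) - a 0 1 * (a 1 0 * a 2 2 - a 1 2 * a 2 0)
     + a 0 2 * (a 1 0 * a 2 1 - a 1 1 * a (2::nat) (0::nat) :: 'a::comm_ring_1)"
  unfolding numeral_3_eq_3 det_mat_Suc
  by (simp add: det_mat_Suc numeral_2_eq_2 algebra_simps)

lemma det4_explicit:
  "det (mat 4 4 (\<lambda>(i,j). a i j :: 'a::comm_ring_1)) =
     (\<Sum>k<4. a 0 k * ((-1) ^ k * det (mat 3 3 (\<lambda>(i,j). a (Suc i) (if j < k then j else Suc j)))))"
  using det_mat_Suc[of 3 a] by simp

text \<open>The expansion is along the last row, which belongs to the cokernel element in every
  application. The entries are literal lists so that concrete rows and columns can be
  substituted.\<close>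

lemma det4_expand:
  "det (mat 4 4 (\<lambda>(i,j). [[a00,a01,a02,a03],[a10,a11,a12,a13],[a20,a21,a22,a23],[a30,a31,a32,a33::'a::comm_ring_1]] ! i ! j)) =
     a30 * -(a01*(a12*a23-a13*a22) - a02*(a11*a23-a13*a21) + a03*(a11*a22-a12*a21))
   + a31 * (a00*(a12*a23-a13*a22) - a02*(a10*a23-a13*a20) + a03*(a10*a22-a12*a20))
   - a32 * (a00*(a11*a23-a13*a21) - a01*(a10*a23-a13*a20) + a03*(a10*a21-a11*a20))
   + a33 * (a00*(a11*a22-a12*a21) - a01*(a10*a22-a12*a20) + a02*(a10*a21-a11*a20))"
proof -
  have s: "(\<Sum>k<4. f k) = f 0 + f 1 + f 2 + f (3::nat)" for f :: "nat \<Rightarrow> 'a"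
    by (simp add: eval_nat_numeral)
  show ?thesis
    unfolding det4_explicit det3_explicit s
    by (simp add: numeral_2_eq_2 numeral_3_eq_3) (simp only: algebra_simps)
qed

text \<open>With M = I + tA in the corner, the determinant is det M times d0 + td - t^2 c M^(-1) b.
  Its successive coefficients yield d0, d, -cb and cAb - tr(A) cb, each after the earlier ones are
  known to vanish.\<close>

lemma bordered_identity:
  fixes c1 :: "'e::idom"
  assumes "det (mat 4 4 (\<lambda>(i,j). [[[:1,a11:],[:0,a12:],[:0,a13:],[:0,b1:]],
      [[:0,a21:],[:1,a22:],[:0,a23:],[:0,b2:]], [[:0,a31:],[:0,a32:],[:1,a33:],[:0,b3:]],
      [[:0,c1:],[:0,c2:],[:0,c3:],[:d0,d:]]] ! i ! j)) = 0"
  shows "d0 = 0" and "d = 0" and "c1*b1+c2*b2+c3*b3 = 0"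
    and "c1*(a11*b1+a12*b2+a13*b3) + c2*(a21*b1+a22*b2+a23*b3) + c3*(a31*b1+a32*b2+a33*b3) = 0"
proof -
  note E = assms[unfolded det4_expand]
  show d0: "d0 = 0" using E by simp
  show d: "d = 0" using E unfolding d0 by simp
  have E2: "- (b1 * c1) + - (b2 * c2) = b3 * c3"
    "(b3 * a13 + b2 * a12 + - ((a22 + a33) * b1)) * c1 +
      (b3 * a23 + - (a33 * b2) + - (b2 * a11) + a21 * b1) * c2 =
      (b3 * a11 + (b3 * a22 + - (a32 * b2)) + - (a31 * b1)) * c3"
    using E unfolding d0 d by simp_all
  show "c1*b1+c2*b2+c3*b3 = 0" using E2(1) by Groebner_Basis.algebra
  show "c1*(a11*b1+a12*b2+a13*b3) + c2*(a21*b1+a22*b2+a23*b3) + c3*(a31*b1+a32*b2+a33*b3) = 0"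
    using E2 by Groebner_Basis.algebra
qed

text \<open>A group is not the union of two proper subgroups, here the kernels of \<open>f\<close>
  and \<open>g\<close>; so the argument covers finite fields as well.\<close>

lemma linear_forms_product_zero:
  fixes f g :: "'v::ab_group_add \<Rightarrow> 'e::idom"
  assumes "\<And>x y. f (x + y) = f x + f y" "\<And>x y. g (x + y) = g x + g y"
    and "\<And>x. f x * g x = 0"
  shows "(\<forall>x. f x = 0) \<or> (\<forall>x. g x = 0)"
proof (rule ccontr)
  assume "\<not> ?thesis"
  then obtain x y where "f x \<noteq> 0" "g y \<noteq> 0" by auto
  then show False using assms(3)[of x] assms(3)[of y] assms(3)[of "x + y"]
    by (auto simp: assms(1,2))
qed

text \<open>The hypothesis on \<open>q\<close> is the parallelogram law. If \<open>q x\<close> and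
  \<open>l z\<close> are nonzero, then \<open>l x = 0\<close>, so \<open>z + x\<close> and
  \<open>z - x\<close> lie off the kernel of \<open>l\<close>; thus \<open>q\<close> vanishes there
  and at \<open>z\<close>, and the law leaves \<open>2 * q x = 0\<close>.\<close>

lemma quadratic_linear_form_product_zero:
  fixes q l :: "'v::ab_group_add \<Rightarrow> 'e::idom"
  assumes "(2::'e) \<noteq> 0"
    and q: "\<And>x y. q (x + y) + q (x - y) = 2 * q x + 2 * q y"
    and l: "\<And>x y. l (x + y) = l x + l y" "\<And>x y. l (x - y) = l x - l y"
    and ql: "\<And>x. q x * l x = 0"
  shows "(\<forall>x. q x = 0) \<or> (\<forall>x. l x = 0)"
proof (rule ccontr)
  assume "\<not> ?thesis"
  then obtain x z where x: "q x \<noteq> 0" and z: "l z \<noteq> 0" by auto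
  have lx: "l x = 0" and qz: "q z = 0" using ql[of x] ql[of z] x z by auto
  have "q (z + x) = 0" "q (z - x) = 0"
    using ql[of "z + x"] ql[of "z - x"] z lx by (auto simp: l)
  with q[of z x] qz x assms(1) show False by simp
qed

section \<open>Symmetric tensors of generic rank three\<close>

locale tensor =
  fixes vs :: "'e::field \<Rightarrow> 'v::ab_group_add \<Rightarrow> 'v"
    and ws :: "'e \<Rightarrow> 'w::ab_group_add \<Rightarrow> 'w"
    and \<beta> :: "'w \<Rightarrow> 'v \<Rightarrow> 'v \<Rightarrow> 'e"
  assumes add_w: "\<beta> (w + w') x y = \<beta> w x y + \<beta> w' x y"
    and scale_w: "\<beta> (ws a w) x y = a * \<beta> w x y"
    and add_v: "\<beta> w (x + x') y = \<beta> w x y + \<beta> w x' y"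
    and scale_v: "\<beta> w (vs a x) y = a * \<beta> w x y"
    and sym: "\<beta> w x y = \<beta> w y x"
begin

lemma add_v2: "\<beta> w x (y + y') = \<beta> w x y + \<beta> w x y'"
  using add_v sym by metis

lemma scale_v2: "\<beta> w x (vs a y) = a * \<beta> w x y"
  using scale_v sym by metis

lemma diff_w: "\<beta> (w - w') x y = \<beta> w x y - \<beta> w' x y"
  using add_w[of "w - w'" w' x y] by simp

lemma diff_v: "\<beta> w (x - x') y = \<beta> w x y - \<beta> w x' y"
  using add_v[of w "x - x'" x' y] by simp

lemma diff_v2: "\<beta> w x (y - y') = \<beta> w x y - \<beta> w x y'"
  using diff_v sym by metis

lemma zero_v: "\<beta> w 0 y = 0" "\<beta> w y 0 = 0"
  using diff_v[of w 0 0 y] diff_v2[of w y 0 0] by simp_all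

lemmas lin = add_w scale_w add_v scale_v add_v2 scale_v2 diff_w diff_v diff_v2 zero_v

definition rad :: "'v \<Rightarrow> bool" where "rad v \<longleftrightarrow> (\<forall>w x. \<beta> w x v = 0)"

text \<open>Vectors will later be functions on all of \<open>nat\<close> of which only the first n
  coordinates matter. Vanishing on the radical makes a linear form depend on these coordinates
  alone.\<close>

definition linform :: "('v \<Rightarrow> 'e) \<Rightarrow> bool" where
  "linform f \<longleftrightarrow> (\<forall>x y. f (x + y) = f x + f y) \<and> (\<forall>a x. f (vs a x) = a * f x) \<and> (\<forall>x. rad x \<longrightarrow> f x = 0)"

definition spanned3 :: bool where
  "spanned3 \<longleftrightarrow> (\<exists>w1 w2 w3. \<forall>w. \<exists>a b c. \<forall>x y.
     \<beta> w x y = a * \<beta> w1 x y + b * \<beta> w2 x y + c * \<beta> w3 x y)"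

definition spanning4 :: "'w \<Rightarrow> 'w \<Rightarrow> 'w \<Rightarrow> 'w \<Rightarrow> bool" where
  "spanning4 w1 w2 w3 w4 \<longleftrightarrow> (\<forall>w. \<exists>a b c d. \<forall>x y.
     \<beta> w x y = a * \<beta> w1 x y + b * \<beta> w2 x y + c * \<beta> w3 x y + d * \<beta> w4 x y)"

definition basis4 :: "'w \<Rightarrow> 'w \<Rightarrow> 'w \<Rightarrow> 'w \<Rightarrow> bool" where
  "basis4 w1 w2 w3 w4 \<longleftrightarrow> spanning4 w1 w2 w3 w4 \<and>
     (\<forall>a b c d. (\<forall>x y. a * \<beta> w1 x y + b * \<beta> w2 x y + c * \<beta> w3 x y + d * \<beta> w4 x y = 0) \<longrightarrow>
        a = 0 \<and> b = 0 \<and> c = 0 \<and> d = 0)"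

definition corank3 :: bool where
  "corank3 \<longleftrightarrow> (\<exists>v1 v2 v3. \<forall>v. \<exists>a b c. \<forall>w x.
     \<beta> w x v = a * \<beta> w x v1 + b * \<beta> w x v2 + c * \<beta> w x v3)"

definition corank4 :: bool where
  "corank4 \<longleftrightarrow> (\<exists>v1 v2 v3 v4. \<forall>v. \<exists>a b c d. \<forall>w x.
     \<beta> w x v = a * \<beta> w x v1 + b * \<beta> w x v2 + c * \<beta> w x v3 + d * \<beta> w x v4)"

text \<open>The tensor of case 2. Since \<beta> is a polarization, \<open>f x * f y\<close> belongs
  to the quadratic form f^2/2. The vectors \<open>u\<close> and \<open>v\<close> certify that
  \<open>f\<close> and \<open>g\<close> can be made coordinates; \<open>w1\<close> is left
  free.\<close>

definition binary_squares :: bool where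
  "binary_squares \<longleftrightarrow> (\<exists>w1 w2 w3 w4 f g u v. basis4 w1 w2 w3 w4 \<and> linform f \<and> linform g \<and>
     f u = 1 \<and> f v = 0 \<and> g u = 0 \<and> g v = 1 \<and>
     (\<forall>x y. \<beta> w2 x y = f x * f y) \<and> (\<forall>x y. \<beta> w3 x y = f x * g y + g x * f y) \<and>
     (\<forall>x y. \<beta> w4 x y = g x * g y))"

definition ternary_alternating :: bool where
  "ternary_alternating \<longleftrightarrow> (\<exists>w1 w2 w3 w4 f g h u v w. basis4 w1 w2 w3 w4 \<and>
     linform f \<and> linform g \<and> linform h \<and>
     f u = 1 \<and> f v = 0 \<and> f w = 0 \<and> g u = 0 \<and> g v = 1 \<and> g w = 0 \<and> h u = 0 \<and> h v = 0 \<and> h w = 1 \<and>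
     (\<forall>x y. \<beta> w2 x y = f x * g y + g x * f y) \<and> (\<forall>x y. \<beta> w3 x y = f x * h y + h x * f y) \<and>
     (\<forall>x y. \<beta> w4 x y = g x * h y + h x * g y))"

text \<open>With i^2 = -c, z = f1 + i f2 and w = f3 + i f4, these are the polarizations of the two
  components of z times conj(w), of N(w)/2 and of N(z)/2.\<close>

definition norm_product :: bool where
  "norm_product \<longleftrightarrow> (\<exists>c w1 w2 w3 w4 f1 f2 f3 f4 u1 u2 u3 u4. c \<noteq> 0 \<and> basis4 w1 w2 w3 w4 \<and>
     linform f1 \<and> linform f2 \<and> linform f3 \<and> linform f4 \<and>
     f1 u1 = 1 \<and> f1 u2 = 0 \<and> f1 u3 = 0 \<and> f1 u4 = 0 \<and> f2 u1 = 0 \<and> f2 u2 = 1 \<and> f2 u3 = 0 \<and> f2 u4 = 0 \<and>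
     f3 u1 = 0 \<and> f3 u2 = 0 \<and> f3 u3 = 1 \<and> f3 u4 = 0 \<and> f4 u1 = 0 \<and> f4 u2 = 0 \<and> f4 u3 = 0 \<and> f4 u4 = 1 \<and>
     (\<forall>x y. \<beta> w1 x y = f1 x * f3 y + f3 x * f1 y + c * (f2 x * f4 y + f4 x * f2 y)) \<and>
     (\<forall>x y. \<beta> w2 x y = f2 x * f3 y + f3 x * f2 y - (f1 x * f4 y + f4 x * f1 y)) \<and>
     (\<forall>x y. \<beta> w3 x y = f3 x * f3 y + c * (f4 x * f4 y)) \<and>
     (\<forall>x y. \<beta> w4 x y = f1 x * f1 y + c * (f2 x * f2 y)))"

end

text \<open>The minors are taken along the line \<open>x + t z\<close>, as polynomials in \<open>t\<close>, so that comparing their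
  coefficients is meaningful over small fields as well.\<close>

locale rank_le_3_tensor = tensor +
  assumes minors: "det (mat 4 4 (\<lambda>(i,j).
    [:\<beta> ([w1,w2,w3,w4] ! i) x ([y1,y2,y3,y4] ! j), \<beta> ([w1,w2,w3,w4] ! i) z ([y1,y2,y3,y4] ! j):])) = 0"
begin

text \<open>The same minors with the entries mapped over lists, a shape that simplifies to the
  literal entries of \<open>det4_expand\<close>.\<close>

lemma minors': "det (mat 4 4 (\<lambda>(i,j). map (\<lambda>w. map (\<lambda>y. [:\<beta> w x y, \<beta> w z y:]) [y1,y2,y3,y4]) [w1,w2,w3,w4] ! i ! j)) = 0"
proof -
  have "mat 4 4 (\<lambda>(i,j). map (\<lambda>w. map (\<lambda>y. [:\<beta> w x y, \<beta> w z y:]) [y1,y2,y3,y4]) [w1,w2,w3,w4] ! i ! j) =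
     mat 4 4 (\<lambda>(i,j). [:\<beta> ([w1,w2,w3,w4] ! i) x ([y1,y2,y3,y4] ! j), \<beta> ([w1,w2,w3,w4] ! i) z ([y1,y2,y3,y4] ! j):])"
    by (intro eq_matI) (simp_all del: list.map)
  then show ?thesis using minors by simp
qed

lemmas det4 = minors'[simplified list.map, unfolded det4_expand]

end

section \<open>Frames at a point of rank 3\<close>

locale framed_tensor = rank_le_3_tensor +
  fixes p e1 e2 e3 :: 'b and q1 q2 q3 :: 'c
  assumes frame: "\<beta> q1 p e1 = 1" "\<beta> q1 p e2 = 0" "\<beta> q1 p e3 = 0"
    "\<beta> q2 p e1 = 0" "\<beta> q2 p e2 = 1" "\<beta> q2 p e3 = 0"
    "\<beta> q3 p e1 = 0" "\<beta> q3 p e2 = 0" "\<beta> q3 p e3 = 1"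

text \<open>The new elements are combinations of the \<open>q\<close> with coefficients from the
  inverse of the 3 by 3 matrix of values, written as adjugate over determinant.\<close>

lemma (in rank_le_3_tensor) frame_exists:
  assumes q: "\<beta> q1 p f1 = a00" "\<beta> q1 p f2 = a01" "\<beta> q1 p f3 = a02"
     "\<beta> q2 p f1 = a10" "\<beta> q2 p f2 = a11" "\<beta> q2 p f3 = a12"
     "\<beta> q3 p f1 = a20" "\<beta> q3 p f2 = a21" "\<beta> q3 p f3 = a22"
    and nz: "a00 * (a11 * a22 - a12 * a21) - a01 * (a10 * a22 - a12 * a20) + a02 * (a10 * a21 - a11 * a20) \<noteq> 0"
  shows "\<exists>r1 r2 r3. framed_tensor vs ws \<beta> p f1 f2 f3 r1 r2 r3"
proof -
  define d where "d = a00 * (a11 * a22 - a12 * a21) - a01 * (a10 * a22 - a12 * a20) + a02 * (a10 * a21 - a11 * a20)"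
  have d: "d \<noteq> 0" using nz by (simp add: d_def)
  define r1 where "r1 = ws ((a11 * a22 - a12 * a21)/d) q1 + ws (-(a01 * a22 - a02 * a21)/d) q2
     + ws ((a01 * a12 - a02 * a11)/d) q3"
  define r2 where "r2 = ws (-(a10 * a22 - a12 * a20)/d) q1 + ws ((a00 * a22 - a02 * a20)/d) q2
     + ws (-(a00 * a12 - a02 * a10)/d) q3"
  define r3 where "r3 = ws ((a10 * a21 - a11 * a20)/d) q1 + ws (-(a00 * a21 - a01 * a20)/d) q2
     + ws ((a00 * a11 - a01 * a10)/d) q3"
  have k: "x / d * a + y / d * b + z / d * c = (x * a + y * b + z * c) / d" for x y z a b c
    by (simp add: add_divide_distrib)
  have "framed_tensor vs ws \<beta> p f1 f2 f3 r1 r2 r3"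
    apply (intro framed_tensor.intro rank_le_3_tensor_axioms framed_tensor_axioms.intro)
            apply (simp_all only: r1_def r2_def r3_def lin q k divide_eq_eq d not_False_eq_True if_True)
            apply (simp_all add: d_def algebra_simps)
    done
  then show ?thesis by blast
qed

context framed_tensor
begin

abbreviation "ker y \<equiv> \<beta> q1 p y = 0 \<and> \<beta> q2 p y = 0 \<and> \<beta> q3 p y = 0"
abbreviation "coker w \<equiv> \<beta> w p e1 = 0 \<and> \<beta> w p e2 = 0 \<and> \<beta> w p e3 = 0"

text \<open>The four conclusions of \<open>bordered_identity\<close> for rows \<open>q1\<close>,
  \<open>q2\<close>, \<open>q3\<close>, \<open>w\<close> and columns \<open>e1\<close>,
  \<open>e2\<close>, \<open>e3\<close>, \<open>y\<close>. In \<open>CB\<close> and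
  \<open>CAB\<close>, c is the row of the values of \<beta> w x at the \<open>e\<close>, A is the
  matrix of the \<beta> q_i x e_j, and b is the column of the \<beta> q_i x y.\<close>

lemma
  assumes "coker w" "ker y"
  shows coker_p_ker: "\<beta> w p y = 0" and coker_ker: "\<beta> w x y = 0"
    and CB: "\<beta> w x e1 * \<beta> q1 x y + \<beta> w x e2 * \<beta> q2 x y + \<beta> w x e3 * \<beta> q3 x y = 0"
    and CAB: "\<beta> w x e1 * (\<beta> q1 x e1 * \<beta> q1 x y + \<beta> q1 x e2 * \<beta> q2 x y + \<beta> q1 x e3 * \<beta> q3 x y) +
       \<beta> w x e2 * (\<beta> q2 x e1 * \<beta> q1 x y + \<beta> q2 x e2 * \<beta> q2 x y + \<beta> q2 x e3 * \<beta> q3 x y) +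
       \<beta> w x e3 * (\<beta> q3 x e1 * \<beta> q1 x y + \<beta> q3 x e2 * \<beta> q2 x y + \<beta> q3 x e3 * \<beta> q3 x y) = 0"
proof -
  note b = bordered_identity[OF minors'[where x=p and z=x and ?w1.0=q1 and ?w2.0=q2 and ?w3.0=q3 and ?w4.0=w
    and ?y1.0=e1 and ?y2.0=e2 and ?y3.0=e3 and ?y4.0=y, simplified list.map assms frame]]
  show "\<beta> w p y = 0" "\<beta> w x y = 0" 
    "\<beta> w x e1 * \<beta> q1 x y + \<beta> w x e2 * \<beta> q2 x y + \<beta> w x e3 * \<beta> q3 x y = 0"
    "\<beta> w x e1 * (\<beta> q1 x e1 * \<beta> q1 x y + \<beta> q1 x e2 * \<beta> q2 x y + \<beta> q1 x e3 * \<beta> q3 x y) +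
       \<beta> w x e2 * (\<beta> q2 x e1 * \<beta> q1 x y + \<beta> q2 x e2 * \<beta> q2 x y + \<beta> q2 x e3 * \<beta> q3 x y) +
       \<beta> w x e3 * (\<beta> q3 x e1 * \<beta> q1 x y + \<beta> q3 x e2 * \<beta> q2 x y + \<beta> q3 x e3 * \<beta> q3 x y) = 0"
    by (fact b)+
qed

text \<open>These are the projections onto cokernel and kernel along the spans of the
  \<open>q\<close> and of the \<open>e\<close>.\<close>

abbreviation "wpart w \<equiv> w - (ws (\<beta> w p e1) q1 + ws (\<beta> w p e2) q2 + ws (\<beta> w p e3) q3)"
abbreviation "npart x \<equiv> x - (vs (\<beta> q1 p x) e1 + vs (\<beta> q2 p x) e2 + vs (\<beta> q3 p x) e3)"

lemma coker_wpart: "coker (wpart w)" and ker_npart: "ker (npart x)"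
  by (simp_all add: lin frame)

lemma expand: "\<beta> w x y = \<beta> q1 p x * \<beta> w e1 y + \<beta> q2 p x * \<beta> w e2 y + \<beta> q3 p x * \<beta> w e3 y + \<beta> w (npart x) y"
  by (simp add: lin)

text \<open>Membership in the cokernel is tested only at \<open>e1\<close>, \<open>e2\<close>,
  \<open>e3\<close>; the constant coefficient of the minor adds the kernel vectors, and together
  these exhaust the space.\<close>

lemma coker_p: assumes "coker w" shows "\<beta> w p x = 0" "\<beta> w x p = 0"
proof -
  show "\<beta> w p x = 0"
    using coker_p_ker[OF assms ker_npart[of x]] assms by (simp add: lin)
  then show "\<beta> w x p = 0" by (simp add: sym)
qed

lemma expand_coker: assumes "coker w"
  shows "\<beta> w x y = \<beta> q1 p x * \<beta> w e1 y + \<beta> q2 p x * \<beta> w e2 y + \<beta> q3 p x * \<beta> w e3 y"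
  using expand[of w x y] coker_ker[OF assms ker_npart[of x], of y] sym[of w "npart x" y] by simp

text \<open>Modulo the \<open>q\<close> every \<open>w\<close> lies in the cokernel, which already
  annihilates kernel vectors; so the three forms of the frame are the only ones left to
  test.\<close>

lemma radI: assumes "ker y" "\<And>x. \<beta> q1 x y = 0" "\<And>x. \<beta> q2 x y = 0" "\<And>x. \<beta> q3 x y = 0"
  shows "rad y"
  unfolding rad_def
proof (intro allI)
  fix w x
  show "\<beta> w x y = 0"
    using coker_ker[OF coker_wpart[of w] assms(1), of x] by (simp add: lin assms)
qed

lemma linform_q: "linform (\<lambda>x. \<beta> q p x)"
  by (auto simp: linform_def lin rad_def)

lemma spanned3I: assumes "\<And>w x y. coker w \<Longrightarrow> \<beta> w x y = 0" shows spanned3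
  unfolding spanned3_def
proof (rule exI[of _ q1], rule exI[of _ q2], rule exI[of _ q3], intro allI)
  fix w
  have "\<beta> w x y = \<beta> w p e1 * \<beta> q1 x y + \<beta> w p e2 * \<beta> q2 x y + \<beta> w p e3 * \<beta> q3 x y" for x y
    using assms[OF coker_wpart[of w], of x y] unfolding lin by (simp only: right_minus_eq)
  then show "\<exists>a b c. \<forall>x y. \<beta> w x y = a * \<beta> q1 x y + b * \<beta> q2 x y + c * \<beta> q3 x y" by blast
qed

lemma corank3I: assumes "\<And>y. ker y \<Longrightarrow> rad y" shows corank3
  unfolding corank3_def
proof (rule exI[of _ e1], rule exI[of _ e2], rule exI[of _ e3], intro allI)
  fix v
  have "\<beta> w x v = \<beta> q1 p v * \<beta> w x e1 + \<beta> q2 p v * \<beta> w x e2 + \<beta> q3 p v * \<beta> w x e3" for w x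
  proof -
    have "\<beta> w x (npart v) = 0" using assms[OF ker_npart] unfolding rad_def by blast
    then show ?thesis unfolding lin by (simp only: right_minus_eq)
  qed
  then show "\<exists>a b c. \<forall>w x. \<beta> w x v = a * \<beta> w x e1 + b * \<beta> w x e2 + c * \<beta> w x e3" by blast
qed

lemma basis4I:
  assumes "coker w4" "\<beta> w4 s t \<noteq> 0" "\<And>w. coker w \<Longrightarrow> \<exists>a. \<forall>x y. \<beta> w x y = a * \<beta> w4 x y"
  shows "basis4 q1 q2 q3 w4"
  unfolding basis4_def spanning4_def
proof (intro conjI allI impI)
  fix w
  obtain a where a: "\<beta> (wpart w) x y = a * \<beta> w4 x y" for x y using assms(3)[OF coker_wpart] by blast
  have "\<beta> w x y = \<beta> w p e1 * \<beta> q1 x y + \<beta> w p e2 * \<beta> q2 x y + \<beta> w p e3 * \<beta> q3 x y + a * \<beta> w4 x y" for x y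
    using a[of x y] unfolding lin by (simp only: diff_eq_eq add.commute)
  then show "\<exists>a b c d. \<forall>x y. \<beta> w x y = a * \<beta> q1 x y + b * \<beta> q2 x y + c * \<beta> q3 x y + d * \<beta> w4 x y"
    by blast
next
  fix a b c d assume *: "\<forall>x y. a * \<beta> q1 x y + b * \<beta> q2 x y + c * \<beta> q3 x y + d * \<beta> w4 x y = 0"
  show a: "a = 0" using *[rule_format, of p e1] assms(1) by (simp add: frame)
  show b: "b = 0" using *[rule_format, of p e2] assms(1) by (simp add: frame)
  show c: "c = 0" using *[rule_format, of p e3] assms(1) by (simp add: frame)
  show "d = 0" using *[rule_format, of s t] assms(2) by (simp add: a b c)
qed

lemmas reframe = frame_exists[where p=p and ?q1.0=q1 and ?q2.0=q2 and ?q3.0=q3]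

end

section \<open>Characteristic different from 2\<close>

text \<open>This 3-cycle fixing the last element and the shift below compose to all the changes of
  basis made in the normal forms.\<close>

lemma (in tensor) basis4_rotate: "basis4 a b c d \<Longrightarrow> basis4 b c a d"
  unfolding basis4_def spanning4_def
proof (intro conjI allI impI; elim conjE)
  fix w assume "\<forall>w. \<exists>r s t u. \<forall>x y. \<beta> w x y = r * \<beta> a x y + s * \<beta> b x y + t * \<beta> c x y + u * \<beta> d x y"
  then obtain r s t u where *: "\<beta> w x y = r * \<beta> a x y + s * \<beta> b x y + t * \<beta> c x y + u * \<beta> d x y" for x y
    by blast
  have "\<beta> w x y = s * \<beta> b x y + t * \<beta> c x y + r * \<beta> a x y + u * \<beta> d x y" for x y
    by (rule trans[OF *]) (simp only: ac_simps)
  then show "\<exists>r s t u. \<forall>x y. \<beta> w x y = r * \<beta> b x y + s * \<beta> c x y + t * \<beta> a x y + u * \<beta> d x y"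
    by blast
next
  fix s t r u
  assume *: "\<forall>r s t u. (\<forall>x y. r * \<beta> a x y + s * \<beta> b x y + t * \<beta> c x y + u * \<beta> d x y = 0) \<longrightarrow>
            r = 0 \<and> s = 0 \<and> t = 0 \<and> u = 0"
    and 0: "\<forall>x y. s * \<beta> b x y + t * \<beta> c x y + r * \<beta> a x y + u * \<beta> d x y = 0"
  have "r * \<beta> a x y + s * \<beta> b x y + t * \<beta> c x y + u * \<beta> d x y = 0" for x y
    by (rule trans[OF _ 0[rule_format, of x y]]) (simp only: ac_simps)
  with * show "s = 0" "t = 0" "r = 0" "u = 0" by blast+
qed

lemma (in tensor) basis4_shift: 
  assumes "basis4 a b c d" shows "basis4 (a - ws k d) b c d"
  unfolding basis4_def spanning4_def
proof (intro conjI allI impI)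
  fix w
  have "spanning4 a b c d" using assms unfolding basis4_def by (rule conjunct1)
  then obtain r s t u where *: "\<forall>x y. \<beta> w x y = r * \<beta> a x y + s * \<beta> b x y + t * \<beta> c x y + u * \<beta> d x y"
    unfolding spanning4_def by blast
  have "\<beta> w x y = r * \<beta> (a - ws k d) x y + s * \<beta> b x y + t * \<beta> c x y + (u + r * k) * \<beta> d x y" for x y
    using *[rule_format, of x y] unfolding lin by Groebner_Basis.algebra
  then show "\<exists>r s t u. \<forall>x y. \<beta> w x y = r * \<beta> (a - ws k d) x y + s * \<beta> b x y + t * \<beta> c x y + u * \<beta> d x y"
    by blast
next
  fix r s t u
  assume *: "\<forall>x y. r * \<beta> (a - ws k d) x y + s * \<beta> b x y + t * \<beta> c x y + u * \<beta> d x y = 0"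
  have eq: "r * \<beta> a x y + s * \<beta> b x y + t * \<beta> c x y + (u - r * k) * \<beta> d x y =
      r * \<beta> (a - ws k d) x y + s * \<beta> b x y + t * \<beta> c x y + u * \<beta> d x y" for x y
    unfolding lin by Groebner_Basis.algebra
  have "\<forall>x y. r * \<beta> a x y + s * \<beta> b x y + t * \<beta> c x y + (u - r * k) * \<beta> d x y = 0"
    unfolding eq using * .
  then have "r = 0 \<and> s = 0 \<and> t = 0 \<and> u - r * k = 0"
    using assms unfolding basis4_def by blast
  then show "r = 0" "s = 0" "t = 0" "u = 0" by auto
qed

text \<open>With \<open>p\<close> as first frame vector a cokernel form depends on two functionals
  only, because it vanishes at \<open>p\<close>. Diagonalized and scaled, its matrix is diag(1, c),
  and \<open>c\<close> separates the cases of rank one and two.\<close>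

locale centered_tensor = framed_tensor vs ws \<beta> p p e2 e3 q1 q2 q3
  for vs :: "'e::field \<Rightarrow> 'v::ab_group_add \<Rightarrow> 'v" and ws :: "'e \<Rightarrow> 'w::ab_group_add \<Rightarrow> 'w"
    and \<beta> p e2 e3 q1 q2 q3 +
  fixes w4 and c :: 'e
  assumes two: "(2::'e) \<noteq> 0" and coker_w4: "coker w4"
    and w4: "\<beta> w4 e2 e2 = 1" "\<beta> w4 e2 e3 = 0" "\<beta> w4 e3 e3 = c"
begin

lemma w4_eq: "\<beta> w4 x y = \<beta> q2 p x * \<beta> q2 p y + c * \<beta> q3 p x * \<beta> q3 p y"
proof -
  have 1: "\<beta> w4 x y = \<beta> q2 p x * \<beta> w4 e2 y + \<beta> q3 p x * \<beta> w4 e3 y" for x y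
    by (subst expand_coker[OF coker_w4]) (simp add: coker_p[OF coker_w4])
  have "\<beta> w4 e2 y = \<beta> q2 p y" "\<beta> w4 e3 y = c * \<beta> q3 p y"
    using 1[of y e2] 1[of y e3] by (simp_all add: w4 sym[of w4 _ y] sym[of w4 e3 e2])
  then show ?thesis by (subst 1) simp
qed

text \<open>The values at \<open>e2\<close>, \<open>e3\<close> and \<open>e2 + e3\<close> determine
  the coefficients, so a nonzero binary form is a nonzero function however small the field.\<close>

lemma binary_form_product_zero:
  assumes "\<And>x y. l (x + y) = l x + l y" "\<And>x y. l (x - y) = l x - l y"
    and *: "\<And>x. (A * \<beta> q2 p x * \<beta> q2 p x + B * \<beta> q2 p x * \<beta> q3 p x + C * \<beta> q3 p x * \<beta> q3 p x) * l x = 0"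
    and "A \<noteq> 0 \<or> B \<noteq> 0 \<or> C \<noteq> 0"
  shows "l x = 0"
proof -
  let ?q = "\<lambda>x. A * \<beta> q2 p x * \<beta> q2 p x + B * \<beta> q2 p x * \<beta> q3 p x + C * \<beta> q3 p x * \<beta> q3 p x"
  have "(\<forall>x. ?q x = 0) \<or> (\<forall>x. l x = 0)"
    by (rule quadratic_linear_form_product_zero[OF two _ assms(1,2) *])
       (simp add: lin algebra_simps)
  moreover have "\<not> (\<forall>x. ?q x = 0)"
  proof
    assume q: "\<forall>x. ?q x = 0"
    have "A = 0" using q[rule_format, of e2] by (simp add: frame)
    moreover have "C = 0" using q[rule_format, of e3] by (simp add: frame)
    moreover have "A + B + C = 0" using q[rule_format, of "e2 + e3"] by (simp add: frame lin)
    ultimately show False using assms(4) by auto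
  qed
  ultimately show ?thesis by blast
qed

text \<open>The first column of A is \<beta> q_i x p, as the first frame vector is \<open>p\<close>.
  If only the first entry of b survives, cAb = 0 thus says that \<beta> w4 x x times \<beta> q1 x y
  is zero.\<close>

lemma w4_norm_product_zero:
  assumes "ker y" "\<And>x. \<beta> q2 x y = 0" "\<And>x. \<beta> q3 x y = 0"
  shows "rad y"
proof (rule radI[OF assms(1) _ assms(2,3)])
  fix x
  show "\<beta> q1 x y = 0"
  proof (rule binary_form_product_zero[where l="\<lambda>x. \<beta> q1 x y" and A=1 and B=0 and C=c])
    fix x
    show "(1 * \<beta> q2 p x * \<beta> q2 p x + 0 * \<beta> q2 p x * \<beta> q3 p x + c * \<beta> q3 p x * \<beta> q3 p x) * \<beta> q1 x y = 0"
    proof -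
      have "\<beta> q2 p x * (\<beta> q2 p x * \<beta> q1 x y) + c * \<beta> q3 p x * (\<beta> q3 p x * \<beta> q1 x y) = 0"
        using CAB[OF coker_w4 assms(1), of x]
        by (simp add: assms(2,3) coker_p[OF coker_w4] w4_eq frame sym[of _ x p])
      then show ?thesis by Groebner_Basis.algebra
    qed
  qed (auto simp: lin)
qed

text \<open>The equations cb = 0 for \<open>w4\<close> and \<open>w5\<close> are linear in \<beta>
  q2 x y and \<beta> q3 x y. Their determinant is the binary form with coefficients \<mu>, \<nu> and
  -c \<mu>, which is nonzero; by Cramer's rule both unknowns vanish.\<close>

lemma two_cokernel_forms:
  assumes w5: "coker w5" "\<beta> w5 e2 e2 = 0" and nz: "\<beta> w5 e2 e3 \<noteq> 0 \<or> \<beta> w5 e3 e3 \<noteq> 0"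
  shows corank3
proof (rule corank3I, rule w4_norm_product_zero)
  fix y x assume y: "ker y"
  define \<mu> \<nu> where "\<mu> = \<beta> w5 e2 e3" and "\<nu> = \<beta> w5 e3 e3"
  have w5e: "\<beta> w5 x e2 = \<mu> * \<beta> q3 p x" "\<beta> w5 x e3 = \<mu> * \<beta> q2 p x + \<nu> * \<beta> q3 p x" for x
    using expand_coker[OF w5(1), of x e2] expand_coker[OF w5(1), of x e3]
    by (simp_all add: w5(2) coker_p[OF w5(1)] \<mu>_def \<nu>_def sym[of w5 e3 e2])
  have 1: "\<beta> q2 p x * \<beta> q2 x y + c * \<beta> q3 p x * \<beta> q3 x y = 0" for x
    using CB[OF coker_w4 y, of x] by (simp add: coker_p[OF coker_w4] w4_eq frame)
  have 2: "\<mu> * \<beta> q3 p x * \<beta> q2 x y + (\<mu> * \<beta> q2 p x + \<nu> * \<beta> q3 p x) * \<beta> q3 x y = 0" for x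
    using CB[OF w5(1) y, of x] by (simp add: coker_p[OF w5(1)] w5e)
  have nz': "\<mu> \<noteq> 0 \<or> \<nu> \<noteq> 0 \<or> - c * \<mu> \<noteq> 0" using nz by (auto simp: \<mu>_def \<nu>_def)
  have A: "(\<mu> * \<beta> q2 p x * \<beta> q2 p x + \<nu> * \<beta> q2 p x * \<beta> q3 p x + (- c * \<mu>) * \<beta> q3 p x * \<beta> q3 p x) * \<beta> q2 x y = 0" for x
    using 1[of x] 2[of x] by Groebner_Basis.algebra
  have B: "(\<mu> * \<beta> q2 p x * \<beta> q2 p x + \<nu> * \<beta> q2 p x * \<beta> q3 p x + (- c * \<mu>) * \<beta> q3 p x * \<beta> q3 p x) * \<beta> q3 x y = 0" for x
    using 1[of x] 2[of x] by Groebner_Basis.algebra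
  show "\<beta> q2 x y = 0"
    by (rule binary_form_product_zero[where l="\<lambda>x. \<beta> q2 x y", OF _ _ A nz']) (auto simp: lin)
  show "\<beta> q3 x y = 0"
    by (rule binary_form_product_zero[where l="\<lambda>x. \<beta> q3 x y", OF _ _ B nz']) (auto simp: lin)
qed

text \<open>Polarizing the relation and evaluating at \<open>e2\<close> and \<open>e3\<close> leaves
  only the multiples of the obvious syzygy: (f, g) is proportional to (-k q3, q2), where q2, q3
  abbreviate the functionals \<beta> q2 p and \<beta> q3 p.\<close>

lemma rotation:
  assumes f: "\<And>x y. f (x + y) = f x + f y" and g: "\<And>x y. g (x + y) = g x + g y"
    and *: "\<And>x. \<beta> q2 p x * f x + k * \<beta> q3 p x * g x = 0" and k: "k \<noteq> 0"
  shows "f x = - k * g e2 * \<beta> q3 p x" "g x = g e2 * \<beta> q2 p x"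
proof -
  have pol: "\<beta> q2 p x * f y + \<beta> q2 p y * f x + k * \<beta> q3 p x * g y + k * \<beta> q3 p y * g x = 0" for x y
    using *[of x] *[of y] *[of "x + y"] unfolding lin f g by Groebner_Basis.algebra
  have f2: "f e2 = 0" using *[of e2] by (simp add: frame)
  have g3: "g e3 = 0" using *[of e3] k by (simp add: frame)
  have 1: "f x = - k * g e2 * \<beta> q3 p x" for x
  proof -
    have "f x + k * g e2 * \<beta> q3 p x = 0" using pol[of x e2] by (simp add: frame f2 ac_simps)
    then show ?thesis by (simp add: eq_neg_iff_add_eq_0)
  qed
  then show "f x = - k * g e2 * \<beta> q3 p x" .
  have "k * g x - k * (g e2 * \<beta> q2 p x) = 0"
    using pol[of x e3] by (simp add: frame g3 1[of e3] ac_simps)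
  then show "g x = g e2 * \<beta> q2 p x" using k by simp
qed

lemma CB_w4:
  assumes "ker y" shows "\<beta> q2 p x * \<beta> q2 x y + c * \<beta> q3 p x * \<beta> q3 x y = 0"
  using CB[OF coker_w4 assms, of x] by (simp add: coker_p[OF coker_w4] w4_eq frame)

lemma rot:
  assumes "c \<noteq> 0" "ker y"
  shows "\<beta> q2 x y = - c * \<beta> q3 e2 y * \<beta> q3 p x" "\<beta> q3 x y = \<beta> q3 e2 y * \<beta> q2 p x"
  by (rule rotation[where f="\<lambda>x. \<beta> q2 x y" and g="\<lambda>x. \<beta> q3 x y" and k=c, OF lin(3) lin(3) CB_w4[OF assms(2)] assms(1)])+

text \<open>By \<open>rot\<close> the single scalar \<beta> q3 e2 y controls a kernel vector; hence
  for nonzero \<open>c\<close> the kernel is at most one-dimensional modulo the radical.\<close>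

lemma rad_if_rot_zero:
  assumes "c \<noteq> 0" "ker y" "\<beta> q3 e2 y = 0" shows "rad y"
  by (rule w4_norm_product_zero[OF assms(2)])
    (simp_all only: rot[OF assms(1,2), unfolded assms(3)] mult_zero_left mult_zero_right)

lemma CAB_w4:
  assumes "ker y"
  shows "\<beta> q2 p x * (\<beta> q2 p x * \<beta> q1 x y + \<beta> q2 x e2 * \<beta> q2 x y + \<beta> q2 x e3 * \<beta> q3 x y) +
    c * \<beta> q3 p x * (\<beta> q3 p x * \<beta> q1 x y + \<beta> q3 x e2 * \<beta> q2 x y + \<beta> q3 x e3 * \<beta> q3 x y) = 0"
  using CAB[OF coker_w4 assms, of x] by (simp add: coker_p[OF coker_w4] w4_eq frame sym[of _ x p])

end

section \<open>Cokernel form of rank two: the norm form\<close>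

locale rotated_tensor = centered_tensor +
  fixes y
  assumes c0: "c \<noteq> 0" and ker_y: "ker y" and rot_y: "\<beta> q3 e2 y = 1"
begin

lemma b2: "\<beta> q2 x y = - c * \<beta> q3 p x" and b3: "\<beta> q3 x y = \<beta> q2 p x"
  using rot[OF c0 ker_y, unfolded rot_y] by simp_all

lemma swap: "\<beta> q e3 e2 = \<beta> q e2 e3" "\<beta> q y e2 = \<beta> q e2 y" "\<beta> q y e3 = \<beta> q e3 y"
  by (rule sym)+

text \<open>All values come from cAb = 0, where b is known from the rotation, at \<open>e2\<close>,
  \<open>e3\<close>, \<open>e2 + y\<close>, \<open>e2 + e3\<close> and \<open>e2 - e3\<close>.
  Combining the last two separates the remaining unknowns at the price of a factor 2.\<close>

lemma coefficients:
  shows "\<beta> q1 e2 y = - \<beta> q2 e2 e3" "\<beta> q1 e3 y = c * \<beta> q3 e2 e3" "\<beta> q1 y y = c"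
    "\<beta> q2 e3 e3 = c * \<beta> q2 e2 e2 - 2 * c * \<beta> q3 e2 e3"
    "\<beta> q3 e3 e3 = c * \<beta> q3 e2 e2 + 2 * \<beta> q2 e2 e3"
proof -
  note C = CAB_w4[OF ker_y]
  have 1: "\<beta> q1 e2 y + \<beta> q2 e2 e3 = 0"
    using C[of e2] by (simp add: frame b2 b3)
  then show l2: "\<beta> q1 e2 y = - \<beta> q2 e2 e3" by (simp only: eq_neg_iff_add_eq_0)
  have "c * (\<beta> q1 e3 y - c * \<beta> q3 e2 e3) = 0"
    using C[of e3] by (simp add: frame b2 b3 swap mult.commute)
  then show l3: "\<beta> q1 e3 y = c * \<beta> q3 e2 e3" using c0 by simp
  have "\<beta> q1 e2 y + \<beta> q1 y y + (\<beta> q2 e2 e3 - c) = 0"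
    using C[of "e2 + y"] by (simp add: frame b2 b3 lin swap ker_y)
  then show "\<beta> q1 y y = c" using 1 by Groebner_Basis.algebra
  have 2: "(\<beta> q1 e2 y + \<beta> q1 e3 y + (\<beta> q2 e2 e2 + \<beta> q2 e2 e3) * (- c) + (\<beta> q2 e2 e3 + \<beta> q2 e3 e3)) +
     c * (\<beta> q1 e2 y + \<beta> q1 e3 y + (\<beta> q3 e2 e2 + \<beta> q3 e2 e3) * (- c) + (\<beta> q3 e2 e3 + \<beta> q3 e3 e3)) = 0"
    using C[of "e2 + e3"] by (simp add: frame b2 b3 lin swap)
  have 3: "(\<beta> q1 e2 y - \<beta> q1 e3 y + (\<beta> q2 e2 e2 - \<beta> q2 e2 e3) * c + (\<beta> q2 e2 e3 - \<beta> q2 e3 e3)) -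
     c * (- (\<beta> q1 e2 y - \<beta> q1 e3 y) + (\<beta> q3 e2 e2 - \<beta> q3 e2 e3) * c + (\<beta> q3 e2 e3 - \<beta> q3 e3 e3)) = 0"
    using C[of "e2 - e3"] by (simp add: frame b2 b3 lin swap)
  have "2 * (\<beta> q2 e3 e3 - c * \<beta> q2 e2 e2 + 2 * c * \<beta> q3 e2 e3) = 0"
    using 2 3 unfolding l2 l3 by Groebner_Basis.algebra
  then have "\<beta> q2 e3 e3 - c * \<beta> q2 e2 e2 + 2 * c * \<beta> q3 e2 e3 = 0"
    using two by (simp only: mult_eq_0_iff simp_thms)
  then show "\<beta> q2 e3 e3 = c * \<beta> q2 e2 e2 - 2 * c * \<beta> q3 e2 e3" by Groebner_Basis.algebra
  have "2 * c * (\<beta> q3 e3 e3 - c * \<beta> q3 e2 e2 - 2 * \<beta> q2 e2 e3) = 0"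
    using 2 3 unfolding l2 l3 by Groebner_Basis.algebra
  then have "\<beta> q3 e3 e3 - c * \<beta> q3 e2 e2 - 2 * \<beta> q2 e2 e3 = 0"
    using two c0 by (simp only: mult_eq_0_iff simp_thms)
  then show "\<beta> q3 e3 e3 = c * \<beta> q3 e2 e2 + 2 * \<beta> q2 e2 e3" by Groebner_Basis.algebra
qed

lemma normalize:
  "\<exists>f3 r1 r2 r3. rotated_tensor vs ws \<beta> p e2 f3 r1 r2 r3 w4 c y \<and>
    \<beta> r2 e2 e2 = 0 \<and> \<beta> r3 e2 e2 = 0 \<and> \<beta> r2 e2 f3 = 0 \<and> \<beta> r3 e2 f3 = 0"
proof -
  \<comment> \<open>The corrections of \<open>r2\<close> and \<open>r3\<close> kill the values at
    (e2, e2) because \<open>w4\<close> is 1 there. Those of \<open>f3\<close> kill the values at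
    (e2, e3) because \<open>q2\<close> is 1 at (e2, p) and \<open>q3\<close> is 1 at (e2, y). The
    change of \<open>r1\<close> restores duality, which the multiple of \<open>p\<close> in
    \<open>f3\<close> would spoil.\<close>
  define f3 where "f3 = e3 - (vs (\<beta> q2 e2 e3) p + vs (\<beta> q3 e2 e3) y)"
  define r1 where "r1 = q1 + ws (\<beta> q2 e2 e3) q3"
  define r2 where "r2 = q2 - ws (\<beta> q2 e2 e2) w4"
  define r3 where "r3 = q3 - ws (\<beta> q3 e2 e2) w4"
  have w4y: "\<beta> w4 x y = 0" "\<beta> w4 y x = 0" "\<beta> w4 x p = 0" "\<beta> w4 p x = 0" for x
    using coker_ker[OF coker_w4 ker_y] coker_p[OF coker_w4] by (auto simp: sym[of w4 y x])
  have "rotated_tensor vs ws \<beta> p e2 f3 r1 r2 r3 w4 c y"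
    apply (intro rotated_tensor.intro centered_tensor.intro framed_tensor.intro rank_le_3_tensor_axioms
       framed_tensor_axioms.intro centered_tensor_axioms.intro rotated_tensor_axioms.intro two c0)
    by (simp_all add: f3_def r1_def r2_def r3_def lin frame w4 w4y ker_y rot_y swap b3)
  moreover have "\<beta> r2 e2 e2 = 0 \<and> \<beta> r3 e2 e2 = 0 \<and> \<beta> r2 e2 f3 = 0 \<and> \<beta> r3 e2 f3 = 0"
    by (simp add: f3_def r2_def r3_def lin frame w4 w4y ker_y rot_y b2 sym[of _ e2 p])
  ultimately show ?thesis by blast
qed

text \<open>The vectors \<open>p\<close>, \<open>e2\<close>, \<open>e3\<close>, \<open>y\<close>
  span modulo the radical: the kernel part of \<open>x\<close> minus a suitable multiple of
  \<open>y\<close> has rotation scalar zero.\<close>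

lemma expand_y: "\<beta> w x z = \<beta> q1 p x * \<beta> w p z + \<beta> q2 p x * \<beta> w e2 z + \<beta> q3 p x * \<beta> w e3 z
    + \<beta> q3 e2 (npart x) * \<beta> w y z"
proof -
  define v where "v = \<beta> q3 e2 (npart x)"
  have "rad (npart x - vs v y)"
  proof (rule rad_if_rot_zero[OF c0])
    show "ker (npart x - vs v y)" by (simp add: lin frame ker_y)
    show "\<beta> q3 e2 (npart x - vs v y) = 0" by (simp only: diff_v2[of _ _ "npart x"] v_def scale_v2 rot_y) simp
  qed
  then have "\<beta> w z (npart x - vs v y) = 0" by (simp only: rad_def)
  then have "\<beta> w (npart x) z = v * \<beta> w y z"
    unfolding diff_v2[of _ _ "npart x"] scale_v2 sym[of w z] by (simp only: right_minus_eq)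
  then show ?thesis using expand[of w x z] unfolding v_def by (simp only:)
qed

lemma norm_product_normalized:
  assumes N: "\<beta> q2 e2 e2 = 0" "\<beta> q3 e2 e2 = 0" "\<beta> q2 e2 e3 = 0" "\<beta> q3 e2 e3 = 0"
    and basis: "basis4 q1 q2 q3 w4"
  shows norm_product
proof -
  note C = coefficients[unfolded N, simplified]
  have w4y: "\<beta> w4 x y = 0" for x using coker_ker[OF coker_w4 ker_y] .
  \<comment> \<open>The values of \<open>q1\<close> on the span of \<open>e2\<close> and
    \<open>e3\<close> have not been determined by the contractions; the full minor on the line e2 +
    t e3 with columns \<open>p\<close>, \<open>e2\<close>, \<open>e3\<close>, \<open>y\<close>
    supplies them.\<close>
  have "\<beta> q1 e2 e3 = 0 \<and> \<beta> q1 e3 e3 = c * \<beta> q1 e2 e2"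
    using det4[where x=e2 and z=e3 and ?w1.0=q1 and ?w2.0=q2 and ?w3.0=q3 and ?w4.0=w4
      and ?y1.0=p and ?y2.0=e2 and ?y3.0=e3 and ?y4.0=y]
    by (simp add: sym[of _ e2 p] sym[of _ e3 p] frame C N b2 b3 w4 w4y swap coker_w4)
       (simp add: mult.commute)
  moreover define A where "A = \<beta> q1 e2 e2"
  ultimately have D: "\<beta> q1 e2 e3 = 0" "\<beta> q1 e3 e3 = c * A" "\<beta> q1 e2 e2 = A" by auto
  define v where "v x = \<beta> q3 e2 (npart x)" for x
  note ex = expand_y[folded v_def]
  have q2e: "\<beta> q2 e2 z = \<beta> q1 p z" "\<beta> q2 e3 z = - c * v z" "\<beta> q2 y z = - c * \<beta> q3 p z" for z
    by (subst sym, subst ex, simp add: frame b2 N C swap ker_y)+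
  have q3e: "\<beta> q3 e2 z = v z" "\<beta> q3 e3 z = \<beta> q1 p z" "\<beta> q3 y z = \<beta> q2 p z" for z
    by (subst sym, subst ex, simp add: frame b3 N C swap ker_y)+
  have q1e: "\<beta> q1 e2 z = A * \<beta> q2 p z" "\<beta> q1 e3 z = c * A * \<beta> q3 p z" "\<beta> q1 y z = c * v z" for z
    by (subst sym, subst ex, simp add: frame D N C swap ker_y)+
  have v: "v e2 = 0" "v e3 = 0" "v p = 0" "v (vs (-1) y) = -1"
    by (simp_all add: v_def frame lin N C ker_y rot_y)
  have lv: "linform (\<lambda>x. - v x)"
    by (auto simp: linform_def v_def lin rad_def algebra_simps)
  \<comment> \<open>The form of \<open>q1\<close> is the norm form in \<beta> q1 p and
    \<open>v\<close> plus \<open>A\<close> times \<open>w4\<close>; the shift removes that multiple.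
    The sign of \<open>v\<close>, and hence of the dual vector -y, is the sign of x1 x4 in case
    4.\<close>
  have F0: "basis4 q2 q3 (q1 - ws A w4) w4"
    using basis4_rotate[OF basis4_shift[OF basis]] .
  have F1: "\<beta> q2 x z = \<beta> q2 p x * \<beta> q1 p z + \<beta> q1 p x * \<beta> q2 p z +
      c * (\<beta> q3 p x * - v z + - v x * \<beta> q3 p z)" for x z
    by (subst ex) (simp add: q2e algebra_simps)
  have F2: "\<beta> q3 x z = \<beta> q3 p x * \<beta> q1 p z + \<beta> q1 p x * \<beta> q3 p z -
      (\<beta> q2 p x * - v z + - v x * \<beta> q2 p z)" for x z
    by (subst ex) (simp add: q3e algebra_simps)
  have F3: "\<beta> (q1 - ws A w4) x z = \<beta> q1 p x * \<beta> q1 p z + c * (- v x * - v z)" for x z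
    unfolding diff_w scale_w w4_eq by (subst ex) (simp add: q1e algebra_simps)
  have F4: "\<beta> w4 x z = \<beta> q2 p x * \<beta> q2 p z + c * (\<beta> q3 p x * \<beta> q3 p z)" for x z
    by (simp add: w4_eq)
  show ?thesis
    unfolding norm_product_def
    apply (rule exI[of _ c], rule exI[of _ q2], rule exI[of _ q3], rule exI[of _ "q1 - ws A w4"], rule exI[of _ w4],
        rule exI[of _ "\<lambda>x. \<beta> q2 p x"], rule exI[of _ "\<lambda>x. \<beta> q3 p x"], rule exI[of _ "\<lambda>x. \<beta> q1 p x"],
        rule exI[of _ "\<lambda>x. - v x"],
        rule exI[of _ e2], rule exI[of _ e3], rule exI[of _ p], rule exI[of _ "vs (-1) y"])
    apply (intro conjI allI)
    apply (fact c0 F0 lv F1 F2 F3 F4 linform_q | simp add: frame v ker_y scale_v2)+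
    done
qed

end

section \<open>Cokernel form of rank one\<close>

context centered_tensor begin

text \<open>Here \<open>w4\<close> is the square of the functional \<beta> q2 p, and cb = 0 makes
  \<beta> q2 vanish on kernel vectors. The coefficient \<alpha> of \<open>q2\<close> at (e3, e3) is
  the obstruction to case 2; if the kernel is not radical, a minor shows that \<alpha> is
  zero.\<close>

lemma rank_one_normalized:
  assumes c: "c = 0" and N: "\<beta> q2 e2 e2 = 0" "\<beta> q2 e2 e3 = 0" and basis: "basis4 q1 q2 q3 w4"
  shows "corank3 \<or> binary_squares"
proof (cases "\<forall>y. ker y \<longrightarrow> rad y")
  case True
  then show ?thesis using corank3I by blast
next
  case False
  have b2: "\<beta> q2 x y = 0" if "ker y" for x y
  proof -
    have "(\<forall>x. \<beta> q2 p x = 0) \<or> (\<forall>x. \<beta> q2 x y = 0)"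
      by (rule linear_forms_product_zero[OF add_v2 add_v]) (use CB_w4[OF that] c in simp)
    then show ?thesis using frame(5) by (metis zero_neq_one)
  qed
  define \<alpha> where "\<alpha> = \<beta> q2 e3 e3"
  have q2e: "\<beta> q2 x e2 = \<beta> q1 p x" "\<beta> q2 x e3 = \<alpha> * \<beta> q3 p x" for x
    by (subst expand, simp add: frame N b2 ker_npart \<alpha>_def sym[of q2 e3 e2] sym[of q2 "npart x"] del: lin)+
  \<comment> \<open>Since \<open>c = 0\<close>, the expression cAb contains the factor \<beta> q2 p
    x; cancelling it leaves this relation.\<close>
  have b13: "\<beta> q2 p x * \<beta> q1 x y + \<alpha> * \<beta> q3 p x * \<beta> q3 x y = 0" if y: "ker y" for x y
  proof -
    let ?f = "\<lambda>x. \<beta> q2 p x * \<beta> q1 x y + \<alpha> * \<beta> q3 p x * \<beta> q3 x y"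
    have "(\<forall>x. ?f x = 0) \<or> (\<forall>x. \<beta> q2 p x = 0)"
    proof (rule quadratic_linear_form_product_zero[OF two _ add_v2 diff_v2])
      show "?f x * \<beta> q2 p x = 0" for x
        using CAB_w4[OF y, of x] unfolding c q2e b2[OF y] by Groebner_Basis.algebra
    qed (simp add: lin algebra_simps)
    then show ?thesis using frame(5) by (metis zero_neq_one)
  qed
  show ?thesis
  proof (cases "\<alpha> = 0")
    case True
    have b1: "\<beta> q1 x y = 0" if y: "ker y" for x y
    proof -
      have "(\<forall>x. \<beta> q2 p x = 0) \<or> (\<forall>x. \<beta> q1 x y = 0)"
        by (rule linear_forms_product_zero[OF add_v2 add_v]) (use b13[OF that] True in simp)
      then show ?thesis using frame(5) by (metis zero_neq_one)
    qed
    from False obtain y where y: "ker y" and "\<not> rad y" by blast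
    with radI[OF y b1[OF y] b2[OF y]] obtain z where z: "\<beta> q3 z y \<noteq> 0" by blast
    have q1e3: "\<beta> q1 x e3 = 0" for x
    proof -
      \<comment> \<open>The column of \<open>y\<close> has a nonzero entry only in the row of
        \<open>q3\<close>, so the minor splits into that entry \<open>P\<close> and a 3 by 3 minor,
        up to sign \<open>Q\<close>. Both are polynomials on the line x + t z. The choice of
        \<open>z\<close> makes \<open>P\<close> nonzero even where its value at \<open>x\<close> is
        zero, so \<open>Q\<close> can be read off at t = 0.\<close>
      have u: "\<beta> q2 p x * (\<beta> q2 p x * \<beta> q1 x e3) = 0" for x
      proof -
        define P Q where "P = [:\<beta> q3 x y, \<beta> q3 z y:]" 
          and "Q = [:\<beta> q2 p x, \<beta> q2 p z:] * ([:\<beta> q2 p x, \<beta> q2 p z:] * [:\<beta> q1 x e3, \<beta> q1 z e3:])"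
        have w4e: "\<beta> w4 x p = 0" "\<beta> w4 x e2 = \<beta> q2 p x" "\<beta> w4 x e3 = 0" "\<beta> w4 x y = 0" for x
          using y by (simp_all add: w4_eq frame c)
        have "P * Q = 0"
          using det4[where x=x and z=z and ?w1.0=q1 and ?w2.0=q2 and ?w3.0=q3 and ?w4.0=w4
            and ?y1.0=p and ?y2.0=e2 and ?y3.0=e3 and ?y4.0=y]
          unfolding w4e coker_p[OF coker_w4] b1[OF y] b2[OF y] q2e True sym[of _ x p] sym[of _ z p] P_def Q_def
          by (simp only: pCons_0_0 mult_zero_left mult_zero_right) Groebner_Basis.algebra
        moreover have "P \<noteq> 0" using z by (simp add: P_def)
        ultimately have "poly Q 0 = 0" by simp
        then show ?thesis by (simp only: Q_def poly_mult poly_pCons mult_zero_left add_0_right)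
      qed
      have "(\<forall>x. \<beta> q2 p x = 0) \<or> (\<forall>x. \<beta> q1 x e3 = 0)"
        by (rule linear_forms_product_zero[OF add_v2 add_v]) (metis u mult_eq_0_iff)
      then show ?thesis using frame(5) by (metis zero_neq_one)
    qed
    define A where "A = \<beta> q1 e2 e2"
    have q1e2: "\<beta> q1 e2 x = A * \<beta> q2 p x" for x
      by (subst sym, subst expand) (simp add: frame b1 ker_npart A_def sym[of q1 e3 e2] q1e3 sym[of q1 "npart x"] del: lin)
    have q1e3': "\<beta> q1 e3 x = 0" for x using q1e3 sym by metis
    have F1: "\<beta> (q1 - ws A w4) x z = \<beta> q1 p x * \<beta> q1 p z" for x z
    proof -
      have n: "\<beta> q1 (npart x) z = 0" by (subst sym) (rule b1[OF ker_npart])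
      have "\<beta> q1 x z = \<beta> q1 p x * \<beta> q1 p z + A * \<beta> q2 p x * \<beta> q2 p z"
        by (subst expand) (simp only: q1e2 q1e3' n mult_zero_right add_0_right mult.assoc mult.left_commute)
      then show ?thesis unfolding diff_w scale_w w4_eq c by Groebner_Basis.algebra
    qed
    have F2: "\<beta> q2 x z = \<beta> q1 p x * \<beta> q2 p z + \<beta> q2 p x * \<beta> q1 p z" for x z
    proof -
      have "\<beta> q2 e2 z = \<beta> q1 p z" "\<beta> q2 e3 z = 0" "\<beta> q2 (npart x) z = 0"
        unfolding sym[of q2 e2 z] sym[of q2 e3 z] sym[of q2 "npart x" z]
        by (simp_all only: q2e True b2 ker_npart mult_zero_left)
      then show ?thesis by (subst expand) (simp del: lin)
    qed
    have F3: "\<beta> w4 x z = \<beta> q2 p x * \<beta> q2 p z" for x z by (simp add: w4_eq c)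
    have B: "basis4 q3 (q1 - ws A w4) q2 w4"
      by (intro basis4_rotate[OF basis4_rotate[OF basis4_shift[OF basis]]])
    have binary_squares
      unfolding binary_squares_def
      apply (rule exI[of _ q3], rule exI[of _ "q1 - ws A w4"], rule exI[of _ q2], rule exI[of _ w4],
        rule exI[of _ "\<lambda>x. \<beta> q1 p x"], rule exI[of _ "\<lambda>x. \<beta> q2 p x"], rule exI[of _ p], rule exI[of _ e2])
      apply (intro conjI allI)
      apply (fact B F1 F2 F3 linform_q frame)+
      done
    then show ?thesis ..
  next
    case True': False
    from False obtain y where y: "ker y" and nrad: "\<not> rad y" by blast
    define l where "l = \<beta> q3 e2 y"
    have b: "\<beta> q1 x y = - \<alpha> * l * \<beta> q3 p x" "\<beta> q3 x y = l * \<beta> q2 p x" for x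
      using rotation[where f="\<lambda>x. \<beta> q1 x y" and g="\<lambda>x. \<beta> q3 x y" and k=\<alpha>, OF add_v add_v b13[OF y] True']
      unfolding l_def by blast+
    have "l \<noteq> 0"
    proof
      assume "l = 0"
      then have "rad y" by (intro radI y b2) (simp_all only: b mult_zero_left mult_zero_right)
      with nrad show False ..
    qed
    have w4e: "\<beta> w4 x p = 0" "\<beta> w4 x e2 = \<beta> q2 p x" "\<beta> w4 x e3 = 0" "\<beta> w4 x y = 0" for x
      using y by (simp_all add: w4_eq frame c)
    \<comment> \<open>Symmetry and the rotation give this nonzero value, whereas the minor on the
      line e2 + t y forces it to be zero.\<close>
    have "\<beta> q1 y e3 = - \<alpha> * l" using sym[of q1 y e3] b(1)[of e3] by (simp add: frame)
    moreover have "l * \<beta> q1 y e3 = 0"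
      using det4[where x=e2 and z=y and ?w1.0=q1 and ?w2.0=q2 and ?w3.0=q3 and ?w4.0=w4
          and ?y1.0=p and ?y2.0=e2 and ?y3.0=e3 and ?y4.0=y]
      unfolding w4e b b2[OF y] q2e sym[of _ e2 p] sym[of _ y p]
      by (simp add: frame y)
    ultimately show ?thesis using \<open>l \<noteq> 0\<close> True' by simp
  qed
qed

lemma rank_one:
  assumes c: "c = 0" and basis: "\<And>w. coker w \<Longrightarrow> \<exists>a. \<forall>x y. \<beta> w x y = a * \<beta> w4 x y"
  shows "corank3 \<or> binary_squares"
proof -
  \<comment> \<open>The normalization of the rank two case without a vector \<open>y\<close>: only
    \<open>q2\<close> has to vanish at (e2, e2) and (e2, e3), and \<open>r1\<close> again restores
    duality.\<close>
  define f3 where "f3 = e3 - vs (\<beta> q2 e2 e3) p"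
  define r1 where "r1 = q1 + ws (\<beta> q2 e2 e3) q3"
  define r2 where "r2 = q2 - ws (\<beta> q2 e2 e2) w4"
  have w4p: "\<beta> w4 x p = 0" "\<beta> w4 p x = 0" for x
    using coker_p[OF coker_w4] by auto
  have "centered_tensor vs ws \<beta> p e2 f3 r1 r2 q3 w4 c"
    apply (intro centered_tensor.intro framed_tensor.intro rank_le_3_tensor_axioms
       framed_tensor_axioms.intro centered_tensor_axioms.intro two)
    by (simp_all add: f3_def r1_def r2_def lin frame w4 w4p)
  then interpret N: centered_tensor vs ws \<beta> p e2 f3 r1 r2 q3 w4 c .
  have "\<beta> r2 e2 e2 = 0" "\<beta> r2 e2 f3 = 0"
    by (simp_all add: f3_def r2_def lin frame w4 w4p sym[of _ e2 p])
  moreover have "basis4 r1 r2 q3 w4"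
    by (rule N.basis4I[where s=e2 and t=e2]) (use coker_w4 w4 basis in \<open>auto simp: f3_def lin w4p\<close>)
  ultimately show ?thesis using N.rank_one_normalized[OF c] by blast
qed

end

lemma (in centered_tensor) centered_cases: "corank3 \<or> binary_squares \<or> norm_product"
proof (cases "\<exists>w. coker w \<and> \<not> (\<exists>a. \<forall>x y. \<beta> w x y = a * \<beta> w4 x y)")
  case True
  then obtain w where w: "coker w" and nw: "\<nexists>a. \<forall>x y. \<beta> w x y = a * \<beta> w4 x y" by blast
  define a where "a = \<beta> w e2 e2"
  define w5 where "w5 = w - ws a w4"
  have w5: "coker w5" using w coker_w4 by (simp add: w5_def lin)
  have w52: "\<beta> w5 e2 e2 = 0" by (simp add: w5_def lin w4 a_def)
  have "\<beta> w5 e2 e3 \<noteq> 0 \<or> \<beta> w5 e3 e3 \<noteq> 0"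
  proof (rule ccontr)
    assume "\<not> ?thesis"
    then have z: "\<beta> w5 e2 e3 = 0" "\<beta> w5 e3 e3 = 0" "\<beta> w5 e3 e2 = 0" using sym[of w5 e3 e2] by auto
    have e: "\<beta> w5 x e2 = 0" "\<beta> w5 x e3 = 0" for x
      by (subst expand_coker[OF w5], simp only: z w52 coker_p[OF w5] mult_zero_right add_0_right)+
    have "\<beta> w5 x y = 0" for x y
      by (subst expand_coker[OF w5], subst (2) sym, subst (3) sym)
        (simp only: e coker_p[OF w5] mult_zero_right add_0_right)
    then have "\<beta> w x y = a * \<beta> w4 x y" for x y
      unfolding w5_def diff_w scale_w by (simp only: right_minus_eq)
    with nw show False by blast
  qed
  then show ?thesis using two_cokernel_forms[OF w5 w52] by blast
next
  case False
  then have ex: "\<exists>a. \<forall>x y. \<beta> w x y = a * \<beta> w4 x y" if "coker w" for w using that by blast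
  show ?thesis
  proof (cases "c = 0")
    case True
    then show ?thesis using rank_one[OF _ ex] by blast
  next
    case c: False
    show ?thesis
    proof (cases "\<forall>y. ker y \<longrightarrow> \<beta> q3 e2 y = 0")
      case True
      then show ?thesis using corank3I rad_if_rot_zero[OF c] by blast
    next
      case False
      then obtain y where y: "ker y" "\<beta> q3 e2 y \<noteq> 0" by blast
      define y1 where "y1 = vs (1 / \<beta> q3 e2 y) y"
      interpret R: rotated_tensor vs ws \<beta> p e2 e3 q1 q2 q3 w4 c y1
        by unfold_locales (use y in \<open>simp_all add: c y1_def lin\<close>)
      obtain f3 r1 r2 r3 where R: "rotated_tensor vs ws \<beta> p e2 f3 r1 r2 r3 w4 c y1"
        and N: "\<beta> r2 e2 e2 = 0" "\<beta> r3 e2 e2 = 0" "\<beta> r2 e2 f3 = 0" "\<beta> r3 e2 f3 = 0"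
        using R.normalize by blast
      interpret N: rotated_tensor vs ws \<beta> p e2 f3 r1 r2 r3 w4 c y1 by (rule R)
      have "basis4 r1 r2 r3 w4"
      proof (rule N.basis4I[where s=e2 and t=e2, OF N.coker_w4])
        show "\<beta> w4 e2 e2 \<noteq> 0" by (simp add: w4)
        fix w assume "\<beta> w p p = 0 \<and> \<beta> w p e2 = 0 \<and> \<beta> w p f3 = 0"
        then have "coker w" using N.coker_p by blast
        then show "\<exists>a. \<forall>x y. \<beta> w x y = a * \<beta> w4 x y" by (rule ex)
      qed
      from N.norm_product_normalized[OF N this] show ?thesis by blast
    qed
  qed
qed

theorem (in framed_tensor) rank_3_cases_odd:
  assumes two: "(2::'a) \<noteq> 0"
  shows "spanned3 \<or> corank3 \<or> binary_squares \<or> norm_product"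
proof (cases "\<forall>w x y. coker w \<longrightarrow> \<beta> w x y = 0")
  case True
  then show ?thesis using spanned3I by blast
next
  case False
  then obtain w0 s t where w0: "coker w0" and st: "\<beta> w0 s t \<noteq> 0" by blast
  have "\<exists>x. \<beta> w0 x x \<noteq> 0"
  proof (rule ccontr)
    assume *: "\<nexists>x. \<beta> w0 x x \<noteq> 0"
    have "\<beta> w0 s s = 0" "\<beta> w0 t t = 0" "\<beta> w0 (s + t) (s + t) = 0" using * by blast+
    then have "2 * \<beta> w0 s t = 0" unfolding lin sym[of w0 t s] by Groebner_Basis.algebra
    with two st show False by simp
  qed
  then obtain x0 where x0: "\<beta> w0 x0 x0 \<noteq> 0" ..
  \<comment> \<open>With \<open>y = p\<close> the sum in \<open>CB\<close> coincides with the
    expansion of \<beta> w0 x0 x0 by \<open>expand_coker\<close>; so \<open>p\<close> in its own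
    kernel would contradict the choice of \<open>x0\<close>.\<close>
  have "\<not> ker p"
  proof
    assume "ker p"
    have "\<beta> w0 x0 x0 = \<beta> q1 p x0 * \<beta> w0 e1 x0 + \<beta> q2 p x0 * \<beta> w0 e2 x0 + \<beta> q3 p x0 * \<beta> w0 e3 x0"
      by (rule expand_coker[OF w0])
    also have "\<dots> = \<beta> w0 x0 e1 * \<beta> q1 x0 p + \<beta> w0 x0 e2 * \<beta> q2 x0 p + \<beta> w0 x0 e3 * \<beta> q3 x0 p"
      by (simp only: sym[of _ x0 p] sym[of _ x0 e1] sym[of _ x0 e2] sym[of _ x0 e3] mult.commute)
    also have "\<dots> = 0" by (rule CB[OF w0 \<open>ker p\<close>])
    finally show False using x0 by simp
  qed
  then consider "\<beta> q1 p p \<noteq> 0" | "\<beta> q2 p p \<noteq> 0" | "\<beta> q3 p p \<noteq> 0" by blast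
  then have "\<exists>f2 f3 r1 r2 r3. framed_tensor vs ws \<beta> p p f2 f3 r1 r2 r3"
  proof cases
    case 1
    then show ?thesis
      using reframe[OF refl frame(2,3) refl frame(5,6) refl frame(8,9)] by fastforce
  next
    case 2
    then show ?thesis
      using reframe[OF refl frame(1,3) refl frame(4,6) refl frame(7,9)] by fastforce
  next
    case 3
    then show ?thesis
      using reframe[OF refl frame(1,2) refl frame(4,5) refl frame(7,8)] by fastforce
  qed
  then obtain f2 f3 r1 r2 r3 where "framed_tensor vs ws \<beta> p p f2 f3 r1 r2 r3" by blast
  then interpret F: framed_tensor vs ws \<beta> p p f2 f3 r1 r2 r3 .
  have Fw0: "\<beta> w0 p x = 0" "\<beta> w0 x p = 0" for x using coker_p[OF w0] by auto
  then have Fw0': "\<beta> w0 p p = 0 \<and> \<beta> w0 p f2 = 0 \<and> \<beta> w0 p f3 = 0" by blast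
  define a b d where "a = \<beta> w0 f2 f2" and "b = \<beta> w0 f2 f3" and "d = \<beta> w0 f3 f3"
  have abd: "a \<noteq> 0 \<or> b \<noteq> 0 \<or> d \<noteq> 0"
  proof (rule ccontr)
    assume "\<not> ?thesis"
    then have z: "\<beta> w0 f2 f2 = 0" "\<beta> w0 f2 f3 = 0" "\<beta> w0 f3 f3 = 0" "\<beta> w0 f3 f2 = 0"
      using sym[of w0 f3 f2] by (auto simp: a_def b_def d_def)
    have e: "\<beta> w0 x f2 = 0" "\<beta> w0 x f3 = 0" for x
      by (subst F.expand_coker[OF Fw0'], simp only: z Fw0 mult_zero_right add_0_right)+
    have "\<beta> w0 x0 x0 = 0"
      by (subst F.expand_coker[OF Fw0'], subst (2) sym, subst (3) sym)
        (simp only: e Fw0 mult_zero_right add_0_right)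
    with x0 show False by simp
  qed
  \<comment> \<open>Diagonalization of the binary form of \<open>w0\<close>: a nonzero diagonal
    entry permits completing the square; otherwise \<open>f2 + f3\<close> and \<open>f2 - f3\<close>
    are orthogonal, and the value at the former is 2 b.\<close>
  have "\<exists>g2 g3 s1 s2 s3. framed_tensor vs ws \<beta> p p g2 g3 s1 s2 s3 \<and> \<beta> w0 g2 g2 \<noteq> 0 \<and> \<beta> w0 g2 g3 = 0"
  proof -
    consider "a \<noteq> 0" | "d \<noteq> 0" | "a = 0" "d = 0" "b \<noteq> 0" using abd by blast
    then show ?thesis
    proof cases
      case 1
      define g3 where "g3 = f3 - vs (b / a) f2"
      have "\<exists>s1 s2 s3. framed_tensor vs ws \<beta> p p f2 g3 s1 s2 s3"
        by (rule F.reframe[OF refl refl refl refl refl refl refl refl refl]) (simp add: g3_def lin F.frame)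
      moreover have "\<beta> w0 f2 g3 = 0" "\<beta> w0 f2 f2 \<noteq> 0"
        using 1 by (simp_all add: g3_def lin a_def[symmetric] b_def[symmetric])
      ultimately show ?thesis by blast
    next
      case 2
      define g3 where "g3 = f2 - vs (b / d) f3"
      have "\<exists>s1 s2 s3. framed_tensor vs ws \<beta> p p f3 g3 s1 s2 s3"
        by (rule F.reframe[OF refl refl refl refl refl refl refl refl refl]) (simp add: g3_def lin F.frame)
      moreover have "\<beta> w0 f3 g3 = 0" "\<beta> w0 f3 f3 \<noteq> 0"
        using 2 by (simp_all add: g3_def lin d_def[symmetric] b_def[symmetric] sym[of w0 f3 f2])
      ultimately show ?thesis by blast
    next
      case 3
      have "\<exists>s1 s2 s3. framed_tensor vs ws \<beta> p p (f2 + f3) (f2 - f3) s1 s2 s3"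
        by (rule F.reframe[OF refl refl refl refl refl refl refl refl refl])
          (use two in \<open>simp add: lin F.frame\<close>)
      moreover have "\<beta> w0 (f2 + f3) (f2 - f3) = 0"
        using 3 by (simp add: lin a_def d_def sym[of w0 f3 f2])
      moreover have "\<beta> w0 (f2 + f3) (f2 + f3) = 2 * b"
        using 3 by (simp add: lin a_def b_def d_def sym[of w0 f3 f2])
      then have "\<beta> w0 (f2 + f3) (f2 + f3) \<noteq> 0" using 3 two by simp
      ultimately show ?thesis by blast
    qed
  qed
  then obtain g2 g3 s1 s2 s3 where G: "framed_tensor vs ws \<beta> p p g2 g3 s1 s2 s3"
    and g: "\<beta> w0 g2 g2 \<noteq> 0" "\<beta> w0 g2 g3 = 0" by blast
  interpret G: framed_tensor vs ws \<beta> p p g2 g3 s1 s2 s3 by (rule G)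
  define w4 where "w4 = ws (1 / \<beta> w0 g2 g2) w0"
  interpret C: centered_tensor vs ws \<beta> p g2 g3 s1 s2 s3 w4 "\<beta> w4 g3 g3"
    by unfold_locales (use g two in \<open>simp_all add: w4_def lin Fw0\<close>)
  show ?thesis using C.centered_cases by blast
qed

section \<open>Characteristic 2\<close>

text \<open>An alternating form in three functionals is decomposable, so a cokernel form can be
  normalized to the wedge product of \<beta> q1 p and \<beta> q2 p. Since \<beta> q p p = 0, the
  point \<open>p\<close> cannot be a frame vector here.\<close>

locale alternating_framed_tensor = framed_tensor vs ws \<beta> p e1 e2 e3 q1 q2 q3
  for vs :: "'e::field \<Rightarrow> 'v::ab_group_add \<Rightarrow> 'v" and ws :: "'e \<Rightarrow> 'w::ab_group_add \<Rightarrow> 'w"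
    and \<beta> p e1 e2 e3 q1 q2 q3 +
  fixes w4
  assumes alt: "\<beta> w x x = 0" and two0: "(2::'e) = 0" and coker_w4: "coker w4"
    and w4: "\<beta> w4 e1 e2 = 1" "\<beta> w4 e1 e3 = 0" "\<beta> w4 e2 e3 = 0"
begin

lemma eq_iff_add_eq_0: "a = b \<longleftrightarrow> a + b = (0::'e)"
proof -
  have "b + b = 0" using two0 by (metis mult_2 mult_zero_left)
  then show ?thesis by (metis add.right_cancel)
qed

lemma w4_eq: "\<beta> w4 x y = \<beta> q1 p x * \<beta> q2 p y + \<beta> q2 p x * \<beta> q1 p y"
proof -
  have w4': "\<beta> w4 e2 e1 = 1" "\<beta> w4 e3 e1 = 0" "\<beta> w4 e3 e2 = 0"
    using w4 sym by metis+
  have "\<beta> w4 x e1 = \<beta> q2 p x" "\<beta> w4 x e2 = \<beta> q1 p x" "\<beta> w4 x e3 = 0" for x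
    by (subst expand_coker[OF coker_w4], simp add: w4 w4' alt)+
  then have "\<beta> w4 e1 x = \<beta> q2 p x" "\<beta> w4 e2 x = \<beta> q1 p x" "\<beta> w4 e3 x = 0" for x
    using sym by metis+
  then show ?thesis by (subst expand_coker[OF coker_w4]) simp
qed

text \<open>The counterpart of \<open>rotation\<close>: again only the multiples of the obvious
  syzygy remain, whose sign is invisible in characteristic 2.\<close>

lemma parallel:
  assumes f: "\<And>x y. f (x + y) = f x + f y" and g: "\<And>x y. g (x + y) = g x + g y"
    and *: "\<And>x. \<beta> q1 p x * f x + \<beta> q2 p x * g x = 0"
  shows "g x = g e1 * \<beta> q1 p x" "f x = g e1 * \<beta> q2 p x"
proof -
  have pol: "\<beta> q1 p x * f y + \<beta> q1 p y * f x + \<beta> q2 p x * g y + \<beta> q2 p y * g x = 0" for x y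
    using *[of x] *[of y] *[of "x + y"] unfolding lin f g by Groebner_Basis.algebra
  have f1: "f e1 = 0" using *[of e1] by (simp add: frame)
  have g2: "g e2 = 0" using *[of e2] by (simp add: frame)
  have 1: "f x = g e1 * \<beta> q2 p x" for x
    unfolding eq_iff_add_eq_0[of "f x"] using pol[of x e1] by (simp add: frame f1 mult.commute)
  then show "f x = g e1 * \<beta> q2 p x" .
  have "f e2 = g e1" using 1[of e2] by (simp add: frame)
  then show "g x = g e1 * \<beta> q1 p x"
    unfolding eq_iff_add_eq_0[of "g x"] using pol[of x e2] by (simp add: frame g2 ac_simps)
qed

lemma b12:
  assumes "ker y"
  shows "\<beta> q1 x y = \<beta> q1 e1 y * \<beta> q1 p x" "\<beta> q2 x y = \<beta> q1 e1 y * \<beta> q2 p x"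
proof -
  have "\<beta> q1 p x * \<beta> q2 x y + \<beta> q2 p x * \<beta> q1 x y = 0" for x
    using CB[OF coker_w4 assms, of x] by (simp add: w4_eq frame add.commute)
  from parallel[where f="\<lambda>x. \<beta> q2 x y" and g="\<lambda>x. \<beta> q1 x y", OF add_v add_v this]
  show "\<beta> q1 x y = \<beta> q1 e1 y * \<beta> q1 p x" "\<beta> q2 x y = \<beta> q1 e1 y * \<beta> q2 p x" by blast+
qed

text \<open>By \<open>b12\<close> a kernel vector acts on \<open>q1\<close> and \<open>q2\<close>
  like a multiple of \<open>p\<close>. Subtracting this multiple annihilates both and stays in the
  kernel, which contains \<open>p\<close>; the direction of \<open>p\<close> becomes the fourth
  vector in \<open>corank4\<close>.\<close>

abbreviation "ypart y \<equiv> y - vs (\<beta> q1 e1 y) p"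

lemma ypart:
  assumes "ker y"
  shows "ker (ypart y)" "\<beta> q1 x (ypart y) = 0" "\<beta> q2 x (ypart y) = 0"
proof -
  show "ker (ypart y)" using assms by (simp add: lin alt)
  show "\<beta> q1 x (ypart y) = 0" "\<beta> q2 x (ypart y) = 0"
    unfolding diff_v2 scale_v2 b12[OF assms, of x] sym[of _ x p] by simp_all
qed

lemma corank4I:
  assumes "\<And>y. ker y \<Longrightarrow> rad (ypart y)"
  shows corank4
proof -
  have "\<beta> w x v = \<beta> q1 p v * \<beta> w x e1 + \<beta> q2 p v * \<beta> w x e2 + \<beta> q3 p v * \<beta> w x e3 +
      \<beta> q1 e1 (npart v) * \<beta> w x p" for v w x
  proof -
    define n where "n = npart v"
    have "\<beta> w x (ypart n) = 0" using assms[OF ker_npart] unfolding rad_def n_def by blast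
    then have 1: "\<beta> w x n = \<beta> q1 e1 n * \<beta> w x p" unfolding diff_v2 scale_v2 by (simp only: right_minus_eq)
    have "v = (vs (\<beta> q1 p v) e1 + vs (\<beta> q2 p v) e2 + vs (\<beta> q3 p v) e3) + n"
      by (simp add: n_def)
    then have "\<beta> w x v = \<beta> w x ((vs (\<beta> q1 p v) e1 + vs (\<beta> q2 p v) e2 + vs (\<beta> q3 p v) e3) + n)" by (rule arg_cong)
    then show ?thesis unfolding n_def[symmetric] add_v2 scale_v2 1 .
  qed
  then show ?thesis unfolding corank4_def by blast
qed

text \<open>After the correction by \<open>p\<close> only \<beta> q3 survives in cb = 0. Its factor,
  the third entry of c, is the linear form with coefficients \<mu> and \<nu>, which is
  nonzero.\<close>

lemma two_cokernel_forms:
  assumes w5: "coker w5" "\<beta> w5 e1 e2 = 0" and nz: "\<beta> w5 e1 e3 \<noteq> 0 \<or> \<beta> w5 e2 e3 \<noteq> 0"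
  shows corank4
proof (rule corank4I)
  fix y assume y: "ker y"
  define \<mu> \<nu> where "\<mu> = \<beta> w5 e1 e3" and "\<nu> = \<beta> w5 e2 e3"
  have w5': "\<beta> w5 e2 e1 = 0" "\<beta> w5 e3 e1 = \<mu>" "\<beta> w5 e3 e2 = \<nu>"
    unfolding \<mu>_def \<nu>_def using w5 sym by metis+
  have w5e: "\<beta> w5 x e1 = \<mu> * \<beta> q3 p x" "\<beta> w5 x e2 = \<nu> * \<beta> q3 p x"
     "\<beta> w5 x e3 = \<mu> * \<beta> q1 p x + \<nu> * \<beta> q2 p x" for x
    by (subst expand_coker[OF w5(1)], simp add: w5(2) w5' alt \<mu>_def[symmetric] \<nu>_def[symmetric] mult.commute)+
  let ?z = "ypart y"
  have "(\<mu> * \<beta> q1 p x + \<nu> * \<beta> q2 p x) * \<beta> q3 x ?z = 0" for x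
    using CB[OF w5(1) ypart(1)[OF y], of x] unfolding ypart(2,3)[OF y] w5e
    by (simp only: mult_zero_right add_0_left)
  then have "(\<forall>x. \<mu> * \<beta> q1 p x + \<nu> * \<beta> q2 p x = 0) \<or> (\<forall>x. \<beta> q3 x ?z = 0)"
    by (intro linear_forms_product_zero) (simp_all only: add_v add_v2 distrib_left ac_simps)
  moreover have "\<not> (\<forall>x. \<mu> * \<beta> q1 p x + \<nu> * \<beta> q2 p x = 0)"
  proof
    assume *: "\<forall>x. \<mu> * \<beta> q1 p x + \<nu> * \<beta> q2 p x = 0"
    have "\<mu> = 0" using *[rule_format, of e1] by (simp add: frame)
    moreover have "\<nu> = 0" using *[rule_format, of e2] by (simp add: frame)
    ultimately show False using nz by (simp add: \<mu>_def \<nu>_def)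
  qed
  ultimately show "rad ?z" using radI[OF ypart[OF y]] by blast
qed

lemma one_cokernel_form:
  assumes basis: "basis4 q1 q2 q3 w4"
  shows "corank4 \<or> ternary_alternating"
proof (cases "\<forall>y. ker y \<longrightarrow> rad (ypart y)")
  case True
  then show ?thesis using corank4I by blast
next
  case False
  then obtain y0 where y0: "ker y0" "\<not> rad (ypart y0)" by blast
  define y where "y = ypart y0"
  note y = ypart[OF y0(1), folded y_def]
  from y0(2) radI[OF y] obtain z where z: "\<beta> q3 z y \<noteq> 0" unfolding y_def by blast
  have w4e: "\<beta> w4 x p = 0" "\<beta> w4 x e1 = \<beta> q2 p x" "\<beta> w4 x e2 = \<beta> q1 p x" "\<beta> w4 x e3 = 0" "\<beta> w4 x y = 0" for x
    using y(1) by (simp_all add: w4_eq frame alt)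
  \<comment> \<open>Again the column of \<open>y\<close> splits off a nonzero factor
    \<open>P\<close>. Using \<open>e1\<close> or \<open>e2\<close> as the third column shows that
    \<open>Q\<close> times \<beta> q2 p or \<beta> q1 p vanishes; where both functionals are zero,
    Q(0) is zero by its own formula.\<close>
  have q: "\<beta> q1 p x * \<beta> q2 x e3 + \<beta> q2 p x * \<beta> q1 x e3 = 0" for x
  proof -
    define P Q where "P = [:\<beta> q3 x y, \<beta> q3 z y:]"
      and "Q = [:\<beta> q1 p x, \<beta> q1 p z:] * [:\<beta> q2 x e3, \<beta> q2 z e3:] - [:\<beta> q2 p x, \<beta> q2 p z:] * [:\<beta> q1 x e3, \<beta> q1 z e3:]"
    have P: "P \<noteq> 0" using z by (simp add: P_def)
    have "P * (Q * [:\<beta> q2 p x, \<beta> q2 p z:]) = 0"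
      using det4[where x=x and z=z and ?w1.0=q1 and ?w2.0=q2 and ?w3.0=q3 and ?w4.0=w4
            and ?y1.0=p and ?y2.0=e3 and ?y3.0=e1 and ?y4.0=y]
      unfolding w4e y(2,3) sym[of q1 x p] sym[of q1 z p] sym[of q2 x p] sym[of q2 z p] P_def Q_def
      by (simp only: pCons_0_0 mult_zero_left mult_zero_right) Groebner_Basis.algebra
    then have "poly (Q * [:\<beta> q2 p x, \<beta> q2 p z:]) 0 = 0" using P by simp
    then have 1: "poly Q 0 * \<beta> q2 p x = 0" by (simp only: poly_mult poly_pCons mult_zero_left add_0_right)
    have "P * (Q * [:\<beta> q1 p x, \<beta> q1 p z:]) = 0"
      using det4[where x=x and z=z and ?w1.0=q1 and ?w2.0=q2 and ?w3.0=q3 and ?w4.0=w4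
            and ?y1.0=p and ?y2.0=e3 and ?y3.0=e2 and ?y4.0=y]
      unfolding w4e y(2,3) sym[of q1 x p] sym[of q1 z p] sym[of q2 x p] sym[of q2 z p] P_def Q_def
      by (simp only: pCons_0_0 mult_zero_left mult_zero_right) Groebner_Basis.algebra
    then have "poly (Q * [:\<beta> q1 p x, \<beta> q1 p z:]) 0 = 0" using P by simp
    then have 2: "poly Q 0 * \<beta> q1 p x = 0" by (simp only: poly_mult poly_pCons mult_zero_left add_0_right)
    have Q0: "poly Q 0 = \<beta> q1 p x * \<beta> q2 x e3 - \<beta> q2 p x * \<beta> q1 x e3"
      by (simp only: Q_def poly_mult poly_diff poly_pCons mult_zero_left add_0_right)
    have "poly Q 0 = 0" using 1 2 Q0 by (cases "\<beta> q1 p x = 0 \<and> \<beta> q2 p x = 0") auto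
    then show ?thesis unfolding Q0 right_minus_eq eq_iff_add_eq_0[of "\<beta> q1 p x * \<beta> q2 x e3"] .
  qed
  define a where "a = \<beta> q1 e1 e3"
  have qe3: "\<beta> q1 x e3 = a * \<beta> q1 p x" "\<beta> q2 x e3 = a * \<beta> q2 p x" for x
    using parallel[where f="\<lambda>x. \<beta> q2 x e3" and g="\<lambda>x. \<beta> q1 x e3", OF add_v add_v q] unfolding a_def by blast+
  \<comment> \<open>The functional dual to \<open>p\<close>: on kernel vectors it is the scalar of
    \<open>b12\<close>, and its value \<open>a\<close> at \<open>e3\<close> reflects that by
    \<open>qe3\<close> this vector acts on \<open>q1\<close> and \<open>q2\<close> like
    \<open>a\<close> times \<open>p\<close>.\<close>
  define t where "t x = \<beta> q1 e1 (npart x) + a * \<beta> q3 p x" for x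
  define e f where "e = \<beta> q1 e1 e2" and "f = \<beta> q2 e1 e2"
  have n: "\<beta> q1 (npart x) z = \<beta> q1 e1 (npart x) * \<beta> q1 p z"
     "\<beta> q2 (npart x) z = \<beta> q1 e1 (npart x) * \<beta> q2 p z" for x z
    by (subst sym, rule b12[OF ker_npart])+
  have e3q: "\<beta> q1 e3 x = a * \<beta> q1 p x" "\<beta> q2 e3 x = a * \<beta> q2 p x" for x
    by (subst sym, rule qe3)+
  have ef: "\<beta> q1 e2 e1 = e" "\<beta> q2 e2 e1 = f" unfolding e_def f_def by (rule sym)+
  have Q: "\<beta> q1 e1 x = e * \<beta> q2 p x + t x" "\<beta> q1 e2 x = e * \<beta> q1 p x"
     "\<beta> q2 e1 x = f * \<beta> q2 p x" "\<beta> q2 e2 x = f * \<beta> q1 p x + t x" for x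
  proof -
    have e31: "\<beta> q1 e3 e1 = a" "\<beta> q1 e3 e2 = 0" "\<beta> q2 e3 e1 = 0" "\<beta> q2 e3 e2 = a"
      by (simp_all add: e3q frame)
    have "\<beta> q1 x e1 = e * \<beta> q2 p x + t x" "\<beta> q1 x e2 = e * \<beta> q1 p x"
     "\<beta> q2 x e1 = f * \<beta> q2 p x" "\<beta> q2 x e2 = f * \<beta> q1 p x + t x"
      unfolding expand[of _ x e1] expand[of _ x e2] e31 ef e_def[symmetric] f_def[symmetric] alt n frame t_def
      by (simp_all only: mult_zero_right mult_1_right mult_zero_left add_0_right add_0_left mult_1_left ac_simps)
    then show "\<beta> q1 e1 x = e * \<beta> q2 p x + t x" "\<beta> q1 e2 x = e * \<beta> q1 p x"
     "\<beta> q2 e1 x = f * \<beta> q2 p x" "\<beta> q2 e2 x = f * \<beta> q1 p x + t x"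
      unfolding sym[of _ e1 x] sym[of _ e2 x] by blast+
  qed
  have n': "\<beta> q1 (npart x) z = (t x - a * \<beta> q3 p x) * \<beta> q1 p z"
     "\<beta> q2 (npart x) z = (t x - a * \<beta> q3 p x) * \<beta> q2 p z" for x z
    unfolding n t_def add_diff_cancel_right' by (rule refl)+
  have F1: "\<beta> (q1 - ws e w4) x z = t x * \<beta> q1 p z + \<beta> q1 p x * t z" for x z
  proof -
    have "\<beta> q1 x z = \<beta> q1 p x * (e * \<beta> q2 p z + t z) + \<beta> q2 p x * (e * \<beta> q1 p z) +
       \<beta> q3 p x * (a * \<beta> q1 p z) + (t x - a * \<beta> q3 p x) * \<beta> q1 p z"
      by (subst expand) (simp only: Q n' e3q)
    then show ?thesis unfolding diff_w scale_w w4_eq by Groebner_Basis.algebra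
  qed
  have F2: "\<beta> (q2 - ws f w4) x z = t x * \<beta> q2 p z + \<beta> q2 p x * t z" for x z
  proof -
    have "\<beta> q2 x z = \<beta> q1 p x * (f * \<beta> q2 p z) + \<beta> q2 p x * (f * \<beta> q1 p z + t z) +
       \<beta> q3 p x * (a * \<beta> q2 p z) + (t x - a * \<beta> q3 p x) * \<beta> q2 p z"
      by (subst expand) (simp only: Q n' e3q)
    then show ?thesis unfolding diff_w scale_w w4_eq by Groebner_Basis.algebra
  qed
  have B: "basis4 q3 (q1 - ws e w4) (q2 - ws f w4) w4"
    by (intro basis4_rotate[OF basis4_rotate[OF basis4_shift[OF basis4_rotate[OF basis4_rotate[OF basis4_shift[OF basis4_rotate[OF basis]]]]]]])
  have t: "t p = 1" "t e1 = 0" "t e2 = 0"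
    by (simp_all add: t_def frame lin alt sym[of _ e1 p])
  have lt: "linform t"
    by (auto simp: linform_def t_def lin rad_def algebra_simps)
  have ternary_alternating
    unfolding ternary_alternating_def
    apply (rule exI[of _ q3], rule exI[of _ "q1 - ws e w4"], rule exI[of _ "q2 - ws f w4"], rule exI[of _ w4],
        rule exI[of _ t], rule exI[of _ "\<lambda>x. \<beta> q1 p x"], rule exI[of _ "\<lambda>x. \<beta> q2 p x"],
        rule exI[of _ p], rule exI[of _ e1], rule exI[of _ e2])
    apply (intro conjI allI)
    apply (fact B F1 F2 w4_eq lt linform_q frame t alt)+
    done
  then show ?thesis ..
qed

lemma alternating_cases: "corank4 \<or> ternary_alternating"
proof (cases "\<exists>w. coker w \<and> \<not> (\<exists>a. \<forall>x y. \<beta> w x y = a * \<beta> w4 x y)")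
  case True
  then obtain w where w: "coker w" and nw: "\<nexists>a. \<forall>x y. \<beta> w x y = a * \<beta> w4 x y" by blast
  define a where "a = \<beta> w e1 e2"
  define w5 where "w5 = w - ws a w4"
  have w5: "coker w5" using w coker_w4 by (simp add: w5_def lin)
  have w52: "\<beta> w5 e1 e2 = 0" by (simp add: w5_def lin w4 a_def)
  have "\<beta> w5 e1 e3 \<noteq> 0 \<or> \<beta> w5 e2 e3 \<noteq> 0"
  proof (rule ccontr)
    assume "\<not> ?thesis"
    then have z: "\<beta> w5 e1 e3 = 0" "\<beta> w5 e2 e3 = 0" "\<beta> w5 e3 e1 = 0" "\<beta> w5 e3 e2 = 0" "\<beta> w5 e2 e1 = 0"
      using sym[of w5 e3 e1] sym[of w5 e3 e2] sym[of w5 e2 e1] w52 by auto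
    have e: "\<beta> w5 x e1 = 0" "\<beta> w5 x e2 = 0" "\<beta> w5 x e3 = 0" for x
      by (subst expand_coker[OF w5], simp only: z w52 alt mult_zero_right add_0_right)+
    have "\<beta> w5 x y = 0" for x y
      by (subst expand_coker[OF w5], subst sym[of w5 e1], subst sym[of w5 e2], subst sym[of w5 e3])
        (simp only: e mult_zero_right add_0_right)
    then have "\<beta> w x y = a * \<beta> w4 x y" for x y
      unfolding w5_def diff_w scale_w by (simp only: right_minus_eq)
    with nw show False by blast
  qed
  then show ?thesis using two_cokernel_forms[OF w5 w52] by blast
next
  case False
  then have ex: "\<exists>a. \<forall>x y. \<beta> w x y = a * \<beta> w4 x y" if "coker w" for w using that by blast
  have "\<beta> w4 e1 e2 \<noteq> 0" by (simp add: w4)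
  from one_cokernel_form[OF basis4I[OF coker_w4 this ex]] show ?thesis .
qed

end

theorem (in framed_tensor) rank_3_cases_even:
  assumes alt: "\<And>w x. \<beta> w x x = 0" and two: "(2::'a) = 0"
  shows "spanned3 \<or> corank4 \<or> ternary_alternating"
proof (cases "\<forall>w x y. coker w \<longrightarrow> \<beta> w x y = 0")
  case True
  then show ?thesis using spanned3I by blast
next
  case False
  then obtain w0 s t where w0: "coker w0" and st: "\<beta> w0 s t \<noteq> 0" by blast
  define a b d where "a = \<beta> w0 e1 e2" and "b = \<beta> w0 e1 e3" and "d = \<beta> w0 e2 e3"
  have dbl: "r + r = 0" for r :: 'a using two by (metis mult_2 mult_zero_left)
  have fl: "\<beta> w0 e2 e1 = a" "\<beta> w0 e3 e1 = b" "\<beta> w0 e3 e2 = d" unfolding a_def b_def d_def by (rule sym)+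
  have abd: "a \<noteq> 0 \<or> b \<noteq> 0 \<or> d \<noteq> 0"
  proof (rule ccontr)
    assume "\<not> ?thesis"
    then have z: "\<beta> w0 e1 e3 = 0" "\<beta> w0 e2 e3 = 0" "\<beta> w0 e3 e1 = 0" "\<beta> w0 e3 e2 = 0" "\<beta> w0 e1 e2 = 0" "\<beta> w0 e2 e1 = 0"
      unfolding fl by (simp_all add: a_def b_def d_def)
    have e: "\<beta> w0 x e1 = 0" "\<beta> w0 x e2 = 0" "\<beta> w0 x e3 = 0" for x
      by (subst expand_coker[OF w0], simp only: z alt mult_zero_right add_0_right)+
    have "\<beta> w0 s t = 0"
      by (subst expand_coker[OF w0], subst sym[of w0 e1], subst sym[of w0 e2], subst sym[of w0 e3])
        (simp only: e mult_zero_right add_0_right)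
    with st show False by simp
  qed
  have cp: "\<beta> w0 p x = 0" for x using coker_p[OF w0] by blast
  have fin: "?thesis" if fr: "\<exists>r1 r2 r3. framed_tensor vs ws \<beta> p f1 f2 f3 r1 r2 r3"
    and nz: "\<beta> w0 f1 f2 \<noteq> 0" "\<beta> w0 f1 f3 = 0" "\<beta> w0 f2 f3 = 0" for f1 f2 f3
  proof -
    from fr obtain r1 r2 r3 where F: "framed_tensor vs ws \<beta> p f1 f2 f3 r1 r2 r3" by blast
    interpret F: framed_tensor vs ws \<beta> p f1 f2 f3 r1 r2 r3 by (rule F)
    interpret F: alternating_framed_tensor vs ws \<beta> p f1 f2 f3 r1 r2 r3 "ws (1 / \<beta> w0 f1 f2) w0"
      by unfold_locales (use nz two in \<open>simp_all add: alt lin cp\<close>)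
    show ?thesis using F.alternating_cases by blast
  qed
  from abd consider "a \<noteq> 0" | "b \<noteq> 0" | "d \<noteq> 0" by blast
  then show ?thesis
  proof cases
    case 1
    show ?thesis
      \<comment> \<open>The third vector spans the kernel of the alternating form \<open>w0\<close>
        on the span of the frame; in the other two cases the roles of the frame vectors are
        exchanged.\<close>
      apply (rule fin[of e1 e2 "e3 + (vs (d / a) e1 + vs (b / a) e2)"])
      apply (rule reframe[OF refl refl refl refl refl refl refl refl refl])
      using 1 by (simp_all add: lin frame a_def[symmetric] b_def[symmetric] d_def[symmetric] fl alt dbl)
  next
    case 2
    show ?thesis
      apply (rule fin[of e1 e3 "e2 + (vs (d / b) e1 + vs (a / b) e3)"])
      apply (rule reframe[OF refl refl refl refl refl refl refl refl refl])
      using 2 by (simp_all add: lin frame a_def[symmetric] b_def[symmetric] d_def[symmetric] fl alt dbl)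
  next
    case 3
    show ?thesis
      apply (rule fin[of e2 e3 "e1 + (vs (b / d) e2 + vs (a / d) e3)"])
      apply (rule reframe[OF refl refl refl refl refl refl refl refl refl])
      using 3 by (simp_all add: lin frame a_def[symmetric] b_def[symmetric] d_def[symmetric] fl alt dbl)
  qed
qed

section \<open>Rank and minors\<close>

lemma sum_mult_delta:
  fixes f :: "nat \<Rightarrow> 'a::semiring_1"
  shows "(\<Sum>l<n. f l * (if l = j then 1 else 0)) = (if j < n then f j else 0)"
    and "(\<Sum>l<n. (if j = l then 1 else 0) * f l) = (if j < n then f j else 0)"
  by (induction n) (auto simp: less_Suc_eq)

text \<open>Factorization through r dimensions. The index sets may be infinite, so that all vectors
  can serve as rows and columns; over a field the condition is equivalent to the vanishing of the
  minors of size r + 1.\<close>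

definition rank_le :: "nat \<Rightarrow> 'i set \<Rightarrow> 'j set \<Rightarrow> ('i \<Rightarrow> 'j \<Rightarrow> 'a::comm_ring_1) \<Rightarrow> bool"
  where "rank_le r I J A \<longleftrightarrow> (\<exists>g h. \<forall>i\<in>I. \<forall>j\<in>J. A i j = (\<Sum>k<r. g k i * h k j))"

definition minor :: "nat \<Rightarrow> (nat \<Rightarrow> 'i) \<Rightarrow> (nat \<Rightarrow> 'j) \<Rightarrow> ('i \<Rightarrow> 'j \<Rightarrow> 'a::comm_ring_1) \<Rightarrow> 'a"
  where "minor r a b A = det (mat r r (\<lambda>(k, l). A (a k) (b l)))"

lemma rank_leI: "(\<And>i j. i \<in> I \<Longrightarrow> j \<in> J \<Longrightarrow> A i j = (\<Sum>k<r. g k i * h k j)) \<Longrightarrow> rank_le r I J A"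
  unfolding rank_le_def by blast

lemma minor_zero_if_rank_le:
  assumes "rank_le r I J A" "\<And>k. k \<le> r \<Longrightarrow> a k \<in> I" "\<And>k. k \<le> r \<Longrightarrow> b k \<in> J"
  shows "minor (Suc r) a b A = 0"
proof -
  obtain g h where gh: "\<And>i j. i \<in> I \<Longrightarrow> j \<in> J \<Longrightarrow> A i j = (\<Sum>k<r. g k i * h k j)"
    using assms(1) unfolding rank_le_def by blast
  \<comment> \<open>Padding both factors with zeros to size r + 1 gives \<open>G\<close> a zero last
    column.\<close>
  define G where "G = mat (Suc r) (Suc r) (\<lambda>(k,l). if l < r then g l (a k) else 0)"
  define H where "H = mat (Suc r) (Suc r) (\<lambda>(k,l). if k < r then h k (b l) else 0)"
  have "mat (Suc r) (Suc r) (\<lambda>(k, l). A (a k) (b l)) = G * H"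
    by (rule eq_matI) (auto simp: G_def H_def scalar_prod_def gh assms atLeast0LessThan less_Suc_eq_le)
  moreover have "det G = 0"
    by (subst laplace_expansion_column[of _ "Suc r" r]) (auto simp: G_def intro!: sum.neutral)
  moreover have "G \<in> carrier_mat (Suc r) (Suc r)" "H \<in> carrier_mat (Suc r) (Suc r)"
    by (auto simp: G_def H_def)
  ultimately show ?thesis unfolding minor_def by (simp add: det_mult)
qed

text \<open>A factorization whose left factor consists of columns of \<open>A\<close> itself; the
  indices of these columns later give unit vectors that span modulo the kernel.\<close>

definition column_expansion :: "'i set \<Rightarrow> 'j set \<Rightarrow> ('i \<Rightarrow> 'j \<Rightarrow> 'a::comm_ring_1) \<Rightarrow> nat \<Rightarrow> (nat \<Rightarrow> 'j) \<Rightarrow> (nat \<Rightarrow> 'j \<Rightarrow> 'a) \<Rightarrow> bool"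
  where "column_expansion I J A s b h \<longleftrightarrow> (\<forall>k<s. b k \<in> J) \<and> (\<forall>i\<in>I. \<forall>j\<in>J. A i j = (\<Sum>k<s. A i (b k) * h k j))"

text \<open>Cramer's rule: a nonzero minor of maximal size is bordered by row \<open>i\<close> and
  column \<open>j\<close>. In the expansion along the new row the cofactors are independent of
  \<open>i\<close>, and that of \<open>A i j\<close> is the chosen minor.\<close>

lemma column_expansion_if_minors_zero:
  fixes A :: "'i \<Rightarrow> 'j \<Rightarrow> 'a::field"
  assumes "\<And>a b. (\<And>k. k \<le> r \<Longrightarrow> a k \<in> I) \<Longrightarrow> (\<And>k. k \<le> r \<Longrightarrow> b k \<in> J) \<Longrightarrow> minor (Suc r) a b A = 0"
  shows "\<exists>s\<le>r. \<exists>b h. column_expansion I J A s b h"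
  using assms
proof (induction r)
  case 0
  have "A i j = 0" if "i \<in> I" "j \<in> J" for i j
    using 0[of "\<lambda>_. i" "\<lambda>_. j"] that by (simp add: minor_def det_mat_Suc)
  then have "column_expansion I J A 0 undefined undefined" by (simp add: column_expansion_def)
  then show ?case by blast
next
  case (Suc r)
  show ?case
  proof (cases "\<forall>a b. (\<forall>k\<le>r. a k \<in> I) \<longrightarrow> (\<forall>k\<le>r. b k \<in> J) \<longrightarrow> minor (Suc r) a b A = 0")
    case True
    then have "\<exists>s\<le>r. \<exists>b h. column_expansion I J A s b h"
      by (intro Suc.IH) blast
    then show ?thesis using le_SucI by blast
  next
    case False
    then obtain a b where ab: "\<And>k. k \<le> r \<Longrightarrow> a k \<in> I" "\<And>k. k \<le> r \<Longrightarrow> b k \<in> J"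
      and nz: "minor (Suc r) a b A \<noteq> 0" by blast
    let ?n = "Suc r"
    define D where "D = minor ?n a b A"
    define cof where "cof l j = (-1) ^ (?n + l) *
      det (mat ?n ?n (\<lambda>(k,c). A (a k) ((b(?n := j)) (if c < l then c else Suc c))))" for l j
    have "A i j = (\<Sum>l<?n. A i (b l) * (- cof l j / D))" if ij: "i \<in> I" "j \<in> J" for i j
    proof -
      define M where "M = mat (Suc ?n) (Suc ?n) (\<lambda>(k,l). A ((a(?n := i)) k) ((b(?n := j)) l))"
      have "minor (Suc ?n) (a(?n := i)) (b(?n := j)) A = 0"
        by (rule Suc.prems) (use ab ij in \<open>auto simp: le_Suc_eq\<close>)
      then have "(\<Sum>l<Suc ?n. M $$ (?n, l) * cofactor M ?n l) = 0"
        unfolding minor_def M_def[symmetric]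
        by (subst (asm) laplace_expansion_row[of _ "Suc ?n" ?n]) (auto simp: M_def)
      moreover have "cofactor M ?n l = cof l j" if "l < Suc ?n" for l
        using that unfolding cofactor_def cof_def
        by (intro arg_cong2[where f=times] arg_cong[where f=det] refl)
           (auto simp: M_def mat_delete_def intro!: eq_matI)
      moreover have "cof ?n j = D"
        unfolding cof_def D_def minor_def
        by (simp add: cong: if_cong)
          (intro arg_cong[where f=det], auto intro!: eq_matI)
      moreover have "M $$ (?n, l) = (if l < ?n then A i (b l) else A i j)" if "l < Suc ?n" for l
        using that by (auto simp: M_def)
      ultimately have "(\<Sum>l<Suc ?n. (if l < ?n then A i (b l) else A i j) * cof l j) = 0" "cof ?n j = D"
        by simp_all
      then have "(\<Sum>l<?n. A i (b l) * cof l j) + A i j * D = 0" by simp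
      then have "A i j * D = - (\<Sum>l<?n. A i (b l) * cof l j)"
        by (simp only: eq_neg_iff_add_eq_0 add.commute)
      then have "A i j = - (\<Sum>l<?n. A i (b l) * cof l j) / D"
        using nz by (simp only: D_def nonzero_eq_divide_eq not_False_eq_True)
      also have "\<dots> = (\<Sum>l<?n. A i (b l) * (- cof l j / D))"
        by (simp only: sum_negf[symmetric] sum_divide_distrib mult_minus_right times_divide_eq_right)
      finally show ?thesis .
    qed
    then have "\<forall>i\<in>I. \<forall>j\<in>J. A i j = (\<Sum>l<?n. A i (b l) * (- cof l j / D))" by (intro ballI)
    moreover have "\<forall>k<?n. b k \<in> J" using ab(2) by (simp add: less_Suc_eq_le)
    ultimately have "column_expansion I J A ?n b (\<lambda>l j. - cof l j / D)"
      unfolding column_expansion_def by (intro conjI)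
    then show ?thesis by blast
  qed
qed

lemma rank_le_if_minors_zero:
  fixes A :: "'i \<Rightarrow> 'j \<Rightarrow> 'a::field"
  assumes "\<And>a b. (\<And>k. k \<le> r \<Longrightarrow> a k \<in> I) \<Longrightarrow> (\<And>k. k \<le> r \<Longrightarrow> b k \<in> J) \<Longrightarrow> minor (Suc r) a b A = 0"
  shows "rank_le r I J A"
proof -
  have "\<exists>s\<le>r. \<exists>b h. column_expansion I J A s b h"
    by (rule column_expansion_if_minors_zero) (rule assms)
  then obtain s b h where s: "s \<le> r" and e: "column_expansion I J A s b h" by blast
  have bh: "\<forall>i\<in>I. \<forall>j\<in>J. A i j = (\<Sum>k<s. A i (b k) * h k j)"
    using e unfolding column_expansion_def by (rule conjunct2)
  show ?thesis
  proof (rule rank_leI[where g="\<lambda>k i. if k < s then A i (b k) else 0" and h=h])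
    fix i j assume ij: "i \<in> I" "j \<in> J"
    have "(\<Sum>k<s. A i (b k) * h k j) = (\<Sum>k<r. (if k < s then A i (b k) else 0) * h k j)"
      by (rule sum.mono_neutral_cong_left) (use s in auto)
    then show "A i j = (\<Sum>k<r. (if k < s then A i (b k) else 0) * h k j)"
      by (rule trans[OF bh[rule_format, OF ij]])
  qed
qed

lemma rank_le_transpose:
  assumes "rank_le r I J A" shows "rank_le r J I (\<lambda>j i. A i j)"
proof -
  obtain g h where gh: "\<And>i j. i \<in> I \<Longrightarrow> j \<in> J \<Longrightarrow> A i j = (\<Sum>k<r. g k i * h k j)"
    using assms unfolding rank_le_def by blast
  show ?thesis by (rule rank_leI[where g=h and h=g]) (simp add: gh mult.commute)
qed

lemma rank_le_rows:
  assumes "\<And>i j. i < m \<Longrightarrow> r \<le> i \<Longrightarrow> j \<in> J \<Longrightarrow> A i j = 0"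
  shows "rank_le r {..<m} J A"
  by (rule rank_leI[where g="\<lambda>k i. if i = k then 1 else 0" and h=A], subst sum_mult_delta)
     (simp add: assms)

lemma rank_le_relation:
  fixes A :: "nat \<Rightarrow> 'j \<Rightarrow> 'a::field"
  assumes 0: "\<And>i j. i < m \<Longrightarrow> r < i \<Longrightarrow> j \<in> J \<Longrightarrow> A i j = 0"
    and f: "\<And>j. j \<in> J \<Longrightarrow> (\<Sum>i<Suc r. f i * A i j) = 0" "f r \<noteq> 0"
  shows "rank_le r {..<m} J A"
proof (rule rank_leI[where g="\<lambda>k i. if i < r then (if i = k then 1 else 0) else if i = r then - f k / f r else 0" and h=A])
  fix i j assume i: "i \<in> {..<m}" and j: "j \<in> J"
  consider "i < r" | "i = r" | "r < i" by linarith
  then show "A i j = (\<Sum>k<r. (if i < r then (if i = k then 1 else 0) else if i = r then - f k / f r else 0) * A k j)"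
  proof cases
    case 1
    then have "(\<Sum>k<r. (if i = k then 1 else 0) * A k j) = (\<Sum>k<r. if i = k then A k j else 0)"
      by (intro sum.cong refl) simp
    then show ?thesis using 1 by simp
  next
    case 2
    have "f r * A r j = - (\<Sum>k<r. f k * A k j)" using f(1)[OF j] by (simp add: eq_neg_iff_add_eq_0 add.commute)
    then have "A r j = - (\<Sum>k<r. f k * A k j) / f r" using f(2) by (simp add: field_simps)
    also have "\<dots> = (\<Sum>k<r. - f k / f r * A k j)"
      by (simp only: sum_negf[symmetric] sum_divide_distrib minus_mult_left times_divide_eq_left)
    finally show ?thesis using 2 by simp
  next
    case 3
    then show ?thesis using 0 i j by simp
  qed
qed

lemma (in comm_ring_hom) minor_hom: "minor r a b (\<lambda>i j. hom (A i j)) = hom (minor r a b A)"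
proof -
  have "map_mat hom (mat r r (\<lambda>(k, l). A (a k) (b l))) = mat r r (\<lambda>(k, l). hom (A (a k) (b l)))"
    by (auto intro!: eq_matI)
  then show ?thesis unfolding minor_def by (simp flip: hom_det)
qed

lemma rank_le_mat_iff:
  fixes A :: "'a::field mat"
  assumes A: "A \<in> carrier_mat m n"
  shows "vec_space.rank m A \<le> r \<longleftrightarrow> rank_le r {..<m} {..<n} (\<lambda>i j. A $$ (i, j))"
proof
  interpret vec_space "TYPE('a)" m .
  assume r: "rank A \<le> r"
  show "rank_le r {..<m} {..<n} (\<lambda>i j. A $$ (i, j))"
  proof (rule rank_le_if_minors_zero, rule ccontr)
    fix a b assume a: "\<And>k. k \<le> r \<Longrightarrow> a k \<in> {..<m}" and b: "\<And>k. k \<le> r \<Longrightarrow> b k \<in> {..<n}"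
    assume nz: "minor (Suc r) a b (\<lambda>i j. A $$ (i, j)) \<noteq> 0"
    \<comment> \<open>A nonzero minor makes its r + 1 columns distinct and independent, because an
      equality or a linear relation between columns of \<open>A\<close> restricts to the rows of the
      minor.\<close>
    define xs where "xs = map (\<lambda>k. col A (b k)) [0..<Suc r]"
    define B where "B = mat_of_cols m xs"
    define M where "M = mat (Suc r) (Suc r) (\<lambda>(k, l). A $$ (a k, b l))"
    have M: "M \<in> carrier_mat (Suc r) (Suc r)" by (simp add: M_def)
    have xs: "set xs \<subseteq> carrier_vec m" "length xs = Suc r" using A by (auto simp: xs_def)
    have B: "B \<in> carrier_mat m (Suc r)" "cols B = xs" using xs by (auto simp: B_def)
    have xsn: "xs ! k = col A (b k)" if "k \<le> r" for k
      using that unfolding xs_def by (simp del: upt_Suc)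
    have idx: "xs ! k $ a l = M $$ (l, k)" if "k \<le> r" "l \<le> r" for k l
      using a[OF that(2)] b[OF that(1)] A that by (simp add: xsn M_def)
    have dist: "distinct xs"
    proof (rule ccontr)
      assume "\<not> distinct xs"
      then obtain k l where kl: "k \<le> r" "l \<le> r" "k \<noteq> l" "xs ! k = xs ! l"
        using xs(2) by (auto simp: distinct_conv_nth less_Suc_eq_le)
      have "col M k = col M l"
        using kl idx[OF kl(1)] idx[OF kl(2)] by (auto simp: M_def intro!: eq_vecI)
      then have "det M = 0" using det_identical_cols[OF M kl(3)] kl by simp
      with nz show False by (simp add: minor_def M_def)
    qed
    have "lin_indpt (set xs)"
    proof
      assume "lin_dep (set xs)"
      then obtain v where v: "v \<in> carrier_vec (Suc r)" "v \<noteq> 0\<^sub>v (Suc r)" "B *\<^sub>v v = 0\<^sub>v m"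
        using lin_depE[OF B(1)] B(2) dist by metis
      have "M *\<^sub>v v = 0\<^sub>v (Suc r)"
      proof (rule eq_vecI)
        fix k assume "k < dim_vec (0\<^sub>v (Suc r))"
        then have k: "k \<le> r" by simp
        have "(B *\<^sub>v v) $ a k = 0" using v(3) a[OF k] by simp
        moreover have "row B (a k) = row M k"
          using k a[OF k] idx[OF _ k] xs by (auto simp: B_def M mat_of_cols_def M_def intro!: eq_vecI)
        ultimately show "(M *\<^sub>v v) $ k = 0\<^sub>v (Suc r) $ k"
          using k a[OF k] B(1) M by simp
      qed (use M in auto)
      then have "det M = 0" using v det_0_iff_vec_prod_zero_field[OF M] by blast
      with nz show False by (simp add: minor_def M_def)
    qed
    moreover have "set xs \<subseteq> set (cols A)"
      using b A by (auto simp: xs_def cols_def simp del: upt_Suc)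
    ultimately have "card (set xs) \<le> rank A" by (intro rank_ge_card_indpt[OF A])
    with dist xs(2) r show False by (simp add: distinct_card)
  qed
next
  interpret vec_space "TYPE('a)" m .
  assume "rank_le r {..<m} {..<n} (\<lambda>i j. A $$ (i, j))"
  then obtain g h where gh: "\<And>i j. i < m \<Longrightarrow> j < n \<Longrightarrow> A $$ (i, j) = (\<Sum>k<r. g k i * h k j)"
    unfolding rank_le_def by auto
  obtain S where S: "finite S" "maximal S (\<lambda>T. T \<subseteq> set (cols A) \<and> lin_indpt T)"
    using maximal_exists_superset[of "set (cols A)" "\<lambda>T. T \<subseteq> set (cols A) \<and> lin_indpt T" "{}"]
    by (auto simp: finite_lin_indpt2)
  then have Sc: "S \<subseteq> set (cols A)" "lin_indpt S" by (auto simp: maximal_def)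
  show "rank A \<le> r"
  proof (rule ccontr)
    assume "\<not> rank A \<le> r"
    then have cS: "r < card S" using rank_card_indpt[OF A S(2)] by simp
    obtain xs where xs: "set xs = S" "distinct xs" using finite_distinct_list[OF S(1)] by blast
    define s where "s = length xs"
    have s: "r < s" using cS xs distinct_card[of xs] by (simp add: s_def)
    have xsc: "set xs \<subseteq> carrier_vec m" using Sc(1) xs(1) A cols_dim by blast
    have "\<exists>j<n. xs ! l = col A j" if "l < s" for l
      using that Sc(1) xs(1) A nth_mem[of l xs] by (fastforce simp: s_def cols_def)
    then obtain j where j: "\<And>l. l < s \<Longrightarrow> j l < n" "\<And>l. l < s \<Longrightarrow> xs ! l = col A (j l)" by metis
    define B where "B = mat_of_cols m xs"
    have B: "B \<in> carrier_mat m s" "cols B = xs" using xsc by (auto simp: B_def s_def)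
    \<comment> \<open>As \<open>s\<close> exceeds \<open>r\<close>, padding the right factor to size
      \<open>s\<close> creates zero rows. A kernel vector of this singular matrix is a relation
      between columns that were chosen independent.\<close>
    define H where "H = mat s s (\<lambda>(k,l). if k < r then h k (j l) else 0)"
    have H: "H \<in> carrier_mat s s" by (simp add: H_def)
    have "det H = 0"
      by (subst laplace_expansion_row[OF H s]) (auto simp: H_def s intro!: sum.neutral)
    then obtain v where v: "v \<in> carrier_vec s" "v \<noteq> 0\<^sub>v s" "H *\<^sub>v v = 0\<^sub>v s"
      using det_0_iff_vec_prod_zero_field[OF H] by blast
    have Hv: "(\<Sum>l<s. h k (j l) * v $ l) = 0" if "k < r" for k
    proof -
      have "(H *\<^sub>v v) $ k = 0" using v(3) that s by simp
      then show ?thesis using that s v(1) by (simp add: H_def scalar_prod_def atLeast0LessThan)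
    qed
    have "B *\<^sub>v v = 0\<^sub>v m"
    proof (rule eq_vecI)
      fix i assume "i < dim_vec (0\<^sub>v m)"
      then have i: "i < m" by simp
      have "(B *\<^sub>v v) $ i = (\<Sum>l<s. (\<Sum>k<r. g k i * h k (j l)) * v $ l)"
        using i v(1) B(1) j A by (auto simp: scalar_prod_def atLeast0LessThan gh B_def s_def mat_of_cols_index intro!: sum.cong)
      also have "\<dots> = (\<Sum>k<r. g k i * (\<Sum>l<s. h k (j l) * v $ l))"
        by (simp only: sum_distrib_right sum_distrib_left mult.assoc) (rule sum.swap)
      also have "\<dots> = 0" by (simp add: Hv)
      finally show "(B *\<^sub>v v) $ i = 0\<^sub>v m $ i" using i by simp
    qed (use B in auto)
    then have "lin_dep (set (cols B))" using lin_depI[OF B(1) v(1,2)] B(2) xs(2) by metis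
    then show False using Sc(2) B(2) xs(1) by simp
  qed
qed

section \<open>Polynomials and quadratic forms\<close>

definition monomial_value :: "(nat \<Rightarrow> 'b::comm_ring_1) \<Rightarrow> (nat \<Rightarrow>\<^sub>0 nat) \<Rightarrow> 'b"
  where "monomial_value x e = (\<Prod>i\<in>Poly_Mapping.keys e. x i ^ Poly_Mapping.lookup e i)"

text \<open>The homomorphism on coefficients lets one evaluation cover substitution of polynomials
  (\<open>h = Const\<close>), values at points, and restriction to lines over an extension
  field.\<close>

definition eval_mpoly :: "('a::comm_ring_1 \<Rightarrow> 'b::comm_ring_1) \<Rightarrow> (nat \<Rightarrow> 'b) \<Rightarrow> 'a mpoly \<Rightarrow> 'b"
  where "eval_mpoly h x p = (\<Sum>e\<in>Poly_Mapping.keys p. h (Poly_Mapping.lookup p e) * monomial_value x e)"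

lemma subst_mpoly_eq_eval: "subst_mpoly \<sigma> = eval_mpoly Const \<sigma>"
  by (rule ext) (simp add: subst_mpoly_def eval_mpoly_def monomial_value_def)

lemma monomial_value_superset:
  assumes "finite S" "Poly_Mapping.keys e \<subseteq> S"
  shows "monomial_value x e = (\<Prod>i\<in>S. x i ^ Poly_Mapping.lookup e i)"
  unfolding monomial_value_def
  by (rule prod.mono_neutral_left) (use assms in \<open>auto simp: in_keys_iff\<close>)

lemma monomial_value_add: "monomial_value x (e + f) = monomial_value x e * monomial_value x f"
proof -
  let ?S = "Poly_Mapping.keys e \<union> Poly_Mapping.keys f"
  have k: "Poly_Mapping.keys (e + f) \<subseteq> ?S" by (rule Poly_Mapping.keys_add)
  have S: "finite ?S" by simp
  show ?thesis
    unfolding monomial_value_superset[OF S k] monomial_value_superset[OF S Un_upper1]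
      monomial_value_superset[OF S Un_upper2] prod.distrib[symmetric]
    by (simp add: lookup_add power_add)
qed

lemma mpoly_eq_sum_single:
  "p = (\<Sum>e\<in>Poly_Mapping.keys p. Poly_Mapping.single e (Poly_Mapping.lookup p e))"
  by (rule poly_mapping_eqI)
     (auto simp: lookup_sum lookup_single when_def in_keys_iff sum.delta intro!: sum.neutral split: if_splits)

locale mpoly_eval = comm_ring_hom h for h :: "'a::comm_ring_1 \<Rightarrow> 'b::comm_ring_1"
begin

lemma eval_superset:
  assumes "finite S" "Poly_Mapping.keys p \<subseteq> S"
  shows "eval_mpoly h x p = (\<Sum>e\<in>S. h (Poly_Mapping.lookup p e) * monomial_value x e)"
  unfolding eval_mpoly_def
  by (rule sum.mono_neutral_left) (use assms in \<open>auto simp: in_keys_iff\<close>)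

lemma eval_add: "eval_mpoly h x (p + q) = eval_mpoly h x p + eval_mpoly h x q"
proof -
  let ?S = "Poly_Mapping.keys p \<union> Poly_Mapping.keys q"
  have k: "Poly_Mapping.keys (p + q) \<subseteq> ?S" by (rule Poly_Mapping.keys_add)
  have S: "finite ?S" by simp
  show ?thesis
    unfolding eval_superset[OF S k] eval_superset[OF S Un_upper1] eval_superset[OF S Un_upper2]
    by (simp add: lookup_add hom_add distrib_right sum.distrib)
qed

lemma eval_zero: "eval_mpoly h x 0 = 0"
  by (simp add: eval_mpoly_def)

lemma eval_sum: "eval_mpoly h x (sum f S) = (\<Sum>s\<in>S. eval_mpoly h x (f s))"
  by (induction S rule: infinite_finite_induct) (simp_all add: eval_zero eval_add)

lemma eval_single: "eval_mpoly h x (Poly_Mapping.single e a) = h a * monomial_value x e"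
  using eval_superset[of "{e}" "Poly_Mapping.single e a" x] by (simp split: if_splits)

lemma eval_mult: "eval_mpoly h x (p * q) = eval_mpoly h x p * eval_mpoly h x q"
proof -
  let ?s = "\<lambda>p e. Poly_Mapping.single e (Poly_Mapping.lookup p e)"
  have "p * q = (\<Sum>e\<in>Poly_Mapping.keys p. ?s p e) * (\<Sum>e\<in>Poly_Mapping.keys q. ?s q e)"
    by (simp flip: mpoly_eq_sum_single)
  also have "\<dots> = (\<Sum>e\<in>Poly_Mapping.keys p. \<Sum>f\<in>Poly_Mapping.keys q. ?s p e * ?s q f)"
    by (rule sum_product)
  also have "eval_mpoly h x \<dots> = (\<Sum>e\<in>Poly_Mapping.keys p. \<Sum>f\<in>Poly_Mapping.keys q.
      (h (Poly_Mapping.lookup p e) * monomial_value x e) * (h (Poly_Mapping.lookup q f) * monomial_value x f))"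
    by (simp add: eval_sum mult_single eval_single monomial_value_add hom_mult ac_simps)
  also have "\<dots> = eval_mpoly h x p * eval_mpoly h x q"
    unfolding eval_mpoly_def by (rule sum_product[symmetric])
  finally show ?thesis .
qed

lemma eval_Const: "eval_mpoly h x (Const a) = h a"
  by (simp add: Const_def eval_single monomial_value_def)

lemma eval_X: "eval_mpoly h x (X i) = x i"
  by (simp add: X_def eval_single monomial_value_def)

lemma eval_hom: "comm_ring_hom (eval_mpoly h x)"
  by unfold_locales (auto simp: eval_add eval_mult eval_zero eval_Const[of x 1, unfolded Const_def, simplified])

end

lemma Const_hom: "comm_ring_hom (Const :: 'a::comm_ring_1 \<Rightarrow> 'a mpoly)"
  by unfold_locales (simp_all add: Const_def single_add mult_single)

interpretation Const: comm_ring_hom "Const :: 'a::comm_ring_1 \<Rightarrow> 'a mpoly"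
  by (rule Const_hom)

interpretation Const: mpoly_eval "Const :: 'a::comm_ring_1 \<Rightarrow> 'a mpoly"
  by unfold_locales

interpretation to_fract: inj_comm_ring_hom "to_fract :: 'a::idom \<Rightarrow> 'a fract"
  by unfold_locales simp_all

lemma Const_eq_0_iff: "Const a = 0 \<longleftrightarrow> a = 0"
  unfolding Const_def by (metis lookup_single_eq lookup_zero single_zero)

lemma lookup_Const_mult: "Poly_Mapping.lookup (Const a * p) e = a * Poly_Mapping.lookup p e"
proof -
  have "Const a * p = Poly_Mapping.map ((*) a) p" unfolding Const_def by (rule mult_map_scale_conv_mult[symmetric])
  then show ?thesis by (simp add: Poly_Mapping.map.rep_eq when_def)
qed

lemma pderiv_mpoly_superset:
  assumes "finite S" "Poly_Mapping.keys p \<subseteq> S"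
  shows "pderiv_mpoly i p = (\<Sum>e\<in>S. Poly_Mapping.single (e - Poly_Mapping.single i 1)
      (of_nat (Poly_Mapping.lookup e i) * Poly_Mapping.lookup p e))"
  unfolding pderiv_mpoly_def
  by (rule sum.mono_neutral_left) (use assms in \<open>auto simp: in_keys_iff\<close>)

lemma pderiv_mpoly_add: "pderiv_mpoly i (p + q) = pderiv_mpoly i p + pderiv_mpoly i q"
proof -
  let ?S = "Poly_Mapping.keys p \<union> Poly_Mapping.keys q"
  have k: "Poly_Mapping.keys (p + q) \<subseteq> ?S" by (rule Poly_Mapping.keys_add)
  have S: "finite ?S" by simp
  show ?thesis
    unfolding pderiv_mpoly_superset[OF S k] pderiv_mpoly_superset[OF S Un_upper1]
      pderiv_mpoly_superset[OF S Un_upper2]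
    by (simp add: lookup_add distrib_left single_add sum.distrib)
qed

lemma pderiv_mpoly_Const_mult: "pderiv_mpoly i (Const a * p) = Const a * pderiv_mpoly i p"
proof -
  have k: "Poly_Mapping.keys (Const a * p) \<subseteq> Poly_Mapping.keys p"
    by (auto simp: in_keys_iff lookup_Const_mult)
  show ?thesis
    by (subst pderiv_mpoly_superset[OF finite_keys k])
       (simp add: pderiv_mpoly_def sum_distrib_left lookup_Const_mult, simp add: Const_def mult_single mult.left_commute)
qed

lemma pderiv_mpoly_zero: "pderiv_mpoly i 0 = 0"
  by (simp add: pderiv_mpoly_def)

lemma pderiv_mpoly_minus: "pderiv_mpoly i (p - q) = pderiv_mpoly i p - pderiv_mpoly i q"
  using pderiv_mpoly_add[of i "p - q" q] by simp

lemma pderiv_mpoly_sum: "pderiv_mpoly i (sum f S) = (\<Sum>s\<in>S. pderiv_mpoly i (f s))"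
  by (induction S rule: infinite_finite_induct) (simp_all add: pderiv_mpoly_zero pderiv_mpoly_add)

lemma pderiv_mpoly_X_mult_X:
  "pderiv_mpoly i (X a * X b :: 'a::comm_ring_1 mpoly) = (if a = i then X b else 0) + (if b = i then X a else 0)"
proof -
  let ?d = "\<lambda>i. Poly_Mapping.single i (1::nat)"
  have "(X a * X b :: 'a mpoly) = Poly_Mapping.single (?d a + ?d b) 1"
    by (simp add: X_def mult_single)
  moreover have "pderiv_mpoly i (Poly_Mapping.single e (1::'a)) =
      Poly_Mapping.single (e - ?d i) (of_nat (Poly_Mapping.lookup e i))" for e
    using pderiv_mpoly_superset[of "{e}" "Poly_Mapping.single e (1::'a)" i] by simp
  ultimately have "pderiv_mpoly i (X a * X b :: 'a mpoly) =
      Poly_Mapping.single (?d a + ?d b - ?d i) (of_nat (Poly_Mapping.lookup (?d a + ?d b) i))"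
    by simp
  then show ?thesis
    by (auto simp: X_def lookup_add lookup_single single_add[symmetric])
qed

text \<open>The coefficient array need not be symmetric, since mixed coefficients cannot be halved
  in characteristic 2; different arrays may represent the same polynomial.\<close>

definition quadratic_form :: "nat \<Rightarrow> (nat \<Rightarrow> nat \<Rightarrow> 'a::comm_ring_1) \<Rightarrow> 'a mpoly"
  where "quadratic_form n d = (\<Sum>j<n. \<Sum>k<n. Const (d j k) * (X j * X k))"

lemma pderiv_quadratic_form:
  assumes "i < n"
  shows "pderiv_mpoly i (quadratic_form n d) = (\<Sum>k<n. Const (d i k + d k i) * X k)"
proof -
  have "pderiv_mpoly i (quadratic_form n d) =
      (\<Sum>j<n. \<Sum>k<n. (if j = i then Const (d j k) * X k else 0) + (if k = i then Const (d j k) * X j else 0))"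
    unfolding quadratic_form_def pderiv_mpoly_sum pderiv_mpoly_Const_mult pderiv_mpoly_X_mult_X
    by (intro sum.cong refl) (auto simp: distrib_left)
  also have "\<dots> = (\<Sum>j<n. \<Sum>k<n. if j = i then Const (d j k) * X k else 0) +
      (\<Sum>j<n. \<Sum>k<n. if k = i then Const (d j k) * X j else 0)"
    by (simp only: sum.distrib)
  also have "(\<Sum>j<n. \<Sum>k<n. if j = i then Const (d j k) * X k else 0) = (\<Sum>k<n. Const (d i k) * X k)"
    by (subst sum.swap) (simp add: sum.delta assms)
  also have "(\<Sum>j<n. \<Sum>k<n. if k = i then Const (d j k) * X j else 0) = (\<Sum>k<n. Const (d k i) * X k)"
    by (simp add: sum.delta assms)
  finally show ?thesis by (simp add: Const.hom_add distrib_right sum.distrib)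
qed

lemma total_deg_superset:
  assumes "finite S" "Poly_Mapping.keys e \<subseteq> S"
  shows "total_deg e = (\<Sum>i\<in>S. Poly_Mapping.lookup e i)"
  unfolding total_deg_def
  by (rule sum.mono_neutral_left) (use assms in \<open>auto simp: in_keys_iff\<close>)

lemma total_deg_2:
  assumes "total_deg e = 2"
  obtains j k where "j \<le> k" "e = Poly_Mapping.single j 1 + Poly_Mapping.single k 1"
proof -
  have "e \<noteq> 0" using assms by (auto simp: total_deg_def)
  then obtain j where j: "j \<in> Poly_Mapping.keys e" by fastforce
  define e' where "e' = e - Poly_Mapping.single j 1"
  have e: "e = e' + Poly_Mapping.single j 1"
    using j by (intro poly_mapping_eqI) (auto simp: e'_def lookup_add lookup_minus lookup_single in_keys_iff when_def)
  have td: "total_deg (f + Poly_Mapping.single j 1) = Suc (total_deg f)" for f j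
  proof -
    let ?S = "insert j (Poly_Mapping.keys f)"
    have "Poly_Mapping.keys (f + Poly_Mapping.single j 1) \<subseteq> ?S"
      using Poly_Mapping.keys_add[of f "Poly_Mapping.single j (1::nat)"] by auto
    then show ?thesis
      by (subst (1 2) total_deg_superset[of ?S])
         (auto simp: lookup_add sum.distrib lookup_single when_def)
  qed
  then have "total_deg e' = 1" using assms unfolding e by simp
  then have "e' \<noteq> 0" by (auto simp: total_deg_def)
  then obtain k where k: "k \<in> Poly_Mapping.keys e'" by fastforce
  define f where "f = e' - Poly_Mapping.single k 1"
  have e': "e' = f + Poly_Mapping.single k 1"
    using k by (intro poly_mapping_eqI) (auto simp: f_def lookup_add lookup_minus lookup_single in_keys_iff when_def)
  have "total_deg f = 0" using \<open>total_deg e' = 1\<close> td unfolding e' by simp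
  then have "f = 0" by (auto simp: total_deg_def in_keys_iff intro!: poly_mapping_eqI)
  then have "e = Poly_Mapping.single j 1 + Poly_Mapping.single k 1" using e e' by (simp add: add.commute)
  then show thesis using that[of j k] that[of k j] by (cases "j \<le> k") (auto simp: add.commute)
qed

lemma quadratic_homogeneous_eq:
  fixes p :: "'a::comm_ring_1 mpoly"
  assumes "p \<in> mpolys n" "homogeneous 2 p"
  shows "\<exists>d. p = quadratic_form n d"
proof
  \<comment> \<open>An upper triangular array, so that each monomial arises from exactly one pair of
    indices.\<close>
  let ?d = "\<lambda>j k. if j \<le> k then Poly_Mapping.lookup p (Poly_Mapping.single j 1 + Poly_Mapping.single k 1) else 0"
  let ?e = "\<lambda>(j, k). Poly_Mapping.single j 1 + Poly_Mapping.single k (1::nat)"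
  define S where "S = {(j, k). j < n \<and> k < n \<and> j \<le> k}"
  have S: "finite S" by (rule finite_subset[of _ "{..<n} \<times> {..<n}"]) (auto simp: S_def)
  have inj: "inj_on ?e S"
  proof (rule inj_onI)
    fix s t assume "s \<in> S" "t \<in> S" and eq: "?e s = ?e t"
    then obtain j k l m where st: "s = (j, k)" "t = (l, m)" "j \<le> k" "l \<le> m" by (auto simp: S_def)
    have L: "(1 when j = i) + (1 when k = i) = (1 when l = i) + (1 when m = i :: nat)" for i
      using arg_cong[OF eq, of "\<lambda>e. Poly_Mapping.lookup e i"] by (simp add: st lookup_add lookup_single)
    show "s = t" using L[of j] L[of k] L[of l] L[of m] st by (auto simp: when_def split: if_splits)
  qed
  have keys: "Poly_Mapping.keys p \<subseteq> ?e ` S"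
  proof
    fix e assume e: "e \<in> Poly_Mapping.keys p"
    then obtain j k where jk: "j \<le> k" "e = Poly_Mapping.single j 1 + Poly_Mapping.single k 1"
      using assms(2) total_deg_2 unfolding homogeneous_def by metis
    have "Poly_Mapping.keys e \<subseteq> {..<n}" using assms(1) e by (auto simp: mpolys_def)
    moreover have "j \<in> Poly_Mapping.keys e" "k \<in> Poly_Mapping.keys e"
      by (auto simp: jk in_keys_iff lookup_add lookup_single)
    ultimately show "e \<in> ?e ` S" using jk by (auto simp: S_def)
  qed
  have "p = (\<Sum>e\<in>?e ` S. Poly_Mapping.single e (Poly_Mapping.lookup p e))"
    by (subst mpoly_eq_sum_single, rule sum.mono_neutral_left)
       (use keys S in \<open>auto simp: in_keys_iff\<close>)
  also have "\<dots> = (\<Sum>(j,k)\<in>S. Const (?d j k) * (X j * X k))"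
    by (subst sum.reindex[OF inj]) (auto simp: S_def Const_def X_def mult_single intro!: sum.cong)
  also have "\<dots> = (\<Sum>(j,k)\<in>{..<n} \<times> {..<n}. Const (?d j k) * (X j * X k))"
    by (rule sum.mono_neutral_left) (auto simp: S_def split: if_splits)
  also have "\<dots> = quadratic_form n ?d"
    unfolding quadratic_form_def by (rule sum.cartesian_product[symmetric])
  finally show "p = quadratic_form n ?d" .
qed

lemma eval_hom_quadratic_form:
  assumes "comm_ring_hom \<phi>"
  shows "\<phi> (quadratic_form n d) = (\<Sum>j<n. \<Sum>k<n. \<phi> (Const (d j k)) * (\<phi> (X j) * \<phi> (X k)))"
proof -
  interpret comm_ring_hom \<phi> by (rule assms)
  show ?thesis unfolding quadratic_form_def by (simp add: hom_sum hom_mult)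
qed

lemma quadratic_form_product:
  "(\<Sum>j<n. Const (f j) * X j) * (\<Sum>k<n. Const (g k) * X k) = quadratic_form n (\<lambda>j k. f j * g k)"
  unfolding quadratic_form_def sum_product by (simp add: Const.hom_mult ac_simps)

lemma quadratic_form_sum: "(\<Sum>s\<in>S. Const (a s) * quadratic_form n (d s)) = quadratic_form n (\<lambda>j k. \<Sum>s\<in>S. a s * d s j k)"
proof -
  have "(\<Sum>s\<in>S. Const (a s) * quadratic_form n (d s)) =
      (\<Sum>s\<in>S. \<Sum>j<n. \<Sum>k<n. Const (a s * d s j k) * (X j * X k))"
    unfolding quadratic_form_def by (simp add: sum_distrib_left Const.hom_mult mult.assoc)
  also have "\<dots> = (\<Sum>j<n. \<Sum>s\<in>S. \<Sum>k<n. Const (a s * d s j k) * (X j * X k))" by (rule sum.swap)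
  also have "\<dots> = (\<Sum>j<n. \<Sum>k<n. \<Sum>s\<in>S. Const (a s * d s j k) * (X j * X k))"
    by (intro sum.cong refl sum.swap)
  also have "\<dots> = quadratic_form n (\<lambda>j k. \<Sum>s\<in>S. a s * d s j k)"
    unfolding quadratic_form_def by (simp add: Const.hom_sum sum_distrib_right)
  finally show ?thesis .
qed

lemma subst_quadratic_form:
  assumes \<sigma>: "\<And>j. j < n \<Longrightarrow> \<sigma> j = (\<Sum>l<n. Const (t j l) * X l)"
  shows "subst_mpoly \<sigma> (quadratic_form n d) = quadratic_form n (\<lambda>a b. \<Sum>j<n. \<Sum>k<n. d j k * (t j a * t k b))"
proof -
  have "subst_mpoly \<sigma> (quadratic_form n d) = (\<Sum>j<n. \<Sum>k<n. Const (d j k) * (\<sigma> j * \<sigma> k))"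
    unfolding subst_mpoly_eq_eval eval_hom_quadratic_form[OF Const.eval_hom] Const.eval_Const Const.eval_X ..
  also have "\<dots> = (\<Sum>j<n. \<Sum>k<n. Const (d j k) * quadratic_form n (\<lambda>a b. t j a * t k b))"
    by (intro sum.cong refl) (simp add: \<sigma> quadratic_form_product)
  also have "\<dots> = quadratic_form n (\<lambda>a b. \<Sum>j<n. \<Sum>k<n. d j k * (t j a * t k b))"
    unfolding quadratic_form_sum using quadratic_form_sum[where a="\<lambda>_. 1" and S="{..<n}"] by simp
  finally show ?thesis .
qed

lemma quadratic_form_cong:
  "(\<And>j k. j < n \<Longrightarrow> k < n \<Longrightarrow> d j k = d' j k) \<Longrightarrow> quadratic_form n d = quadratic_form n d'"
  unfolding quadratic_form_def by (intro sum.cong refl) simp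

lemma quadratic_form_add: "quadratic_form n (\<lambda>j k. d j k + e j k) = quadratic_form n d + quadratic_form n e"
  unfolding quadratic_form_def by (simp add: Const.hom_add distrib_right sum.distrib)

lemma quadratic_form_minus: "quadratic_form n (\<lambda>j k. d j k - e j k) = quadratic_form n d - quadratic_form n e"
  unfolding quadratic_form_def by (simp add: Const.hom_minus left_diff_distrib sum_subtractf)

lemma quadratic_form_scale: "quadratic_form n (\<lambda>j k. u * d j k) = Const u * quadratic_form n d"
  unfolding quadratic_form_def by (simp add: Const.hom_mult sum_distrib_left mult.assoc)

abbreviation delta :: "nat \<Rightarrow> nat \<Rightarrow> 'a::zero_neq_one"
  where "delta p a \<equiv> (if p = a then 1 else 0)"

lemma sum_Const_delta_X:
  assumes "p < n" shows "(\<Sum>k<n. Const (delta p k :: 'a::comm_ring_1) * X k) = X p"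
proof -
  have "(\<Sum>k<n. Const (delta p k :: 'a) * X k) = (\<Sum>k<n. if p = k then X k else 0)"
    by (intro sum.cong refl) simp
  then show ?thesis using assms by simp
qed

lemma quadratic_form_delta:
  assumes "p < n" "q < n"
  shows "quadratic_form n (\<lambda>j k. delta p j * delta q k) = (X p * X q :: 'a::comm_ring_1 mpoly)"
  unfolding quadratic_form_product[symmetric] sum_Const_delta_X[OF assms(1)] sum_Const_delta_X[OF assms(2)] ..

text \<open>Where 2 is invertible the polarization determines the polynomial, which is what the
  explicit components of cases 2 and 4 rely on.\<close>

lemma quadratic_form_half:
  fixes d :: "nat \<Rightarrow> nat \<Rightarrow> 'a::field"
  assumes "(2::'a) \<noteq> 0"
  shows "quadratic_form n d = quadratic_form n (\<lambda>j k. (d j k + d k j) / 2)"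
proof -
  have "quadratic_form n (\<lambda>j k. (d j k + d k j) / 2) =
      quadratic_form n (\<lambda>j k. d j k / 2) + quadratic_form n (\<lambda>j k. d k j / 2)"
    unfolding quadratic_form_def by (simp add: add_divide_distrib Const.hom_add distrib_right sum.distrib)
  also have "quadratic_form n (\<lambda>j k. d k j / 2) = quadratic_form n (\<lambda>j k. d j k / 2)"
    unfolding quadratic_form_def by (subst sum.swap) (simp add: mult.commute)
  also have "quadratic_form n (\<lambda>j k. d j k / 2) + quadratic_form n (\<lambda>j k. d j k / 2) = quadratic_form n d"
  proof -
    have "x / 2 + x / 2 = x" for x :: 'a
      using assms by (simp add: field_simps)
    then have "Const (x / 2) * p + Const (x / 2) * p = Const x * p" for x :: 'a and p
      by (simp flip: distrib_right Const.hom_add)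
    then show ?thesis unfolding quadratic_form_def by (simp only: sum.distrib[symmetric])
  qed
  finally show ?thesis ..
qed

section \<open>Invertible matrices with prescribed rows\<close>

text \<open>A trivial kernel, which for a square matrix is equivalent to independence of the rows
  and is easily checked after an exchange of rows.\<close>

definition rows_independent :: "nat \<Rightarrow> (nat \<Rightarrow> nat \<Rightarrow> 'a::field) \<Rightarrow> bool"
  where "rows_independent n P \<longleftrightarrow> (\<forall>v. (\<forall>i<n. (\<Sum>j<n. P i j * v j) = 0) \<longrightarrow> (\<forall>j<n. v j = 0))"

lemma rows_independent_inverse:
  assumes "rows_independent n P"
  obtains B where "B \<in> carrier_mat n n" "mat n n (\<lambda>(i, j). P i j) * B = 1\<^sub>m n" "B * mat n n (\<lambda>(i, j). P i j) = 1\<^sub>m n"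
proof -
  let ?A = "mat n n (\<lambda>(i, j). P i j)"
  have A: "?A \<in> carrier_mat n n" by simp
  have "det ?A \<noteq> 0"
  proof
    assume "det ?A = 0"
    then obtain v where v: "v \<in> carrier_vec n" "v \<noteq> 0\<^sub>v n" "?A *\<^sub>v v = 0\<^sub>v n"
      using det_0_iff_vec_prod_zero_field[OF A] by blast
    have "(\<Sum>j<n. P i j * v $ j) = 0" if "i < n" for i
    proof -
      have "(?A *\<^sub>v v) $ i = 0" using v(3) that by simp
      then show ?thesis using that v(1) by (simp add: scalar_prod_def atLeast0LessThan)
    qed
    then have "\<forall>j<n. v $ j = 0" using assms[unfolded rows_independent_def, rule_format, of "\<lambda>j. v $ j"] by blast
    then have "v = 0\<^sub>v n" using v(1) by (intro eq_vecI) auto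
    with v(2) show False ..
  qed
  from det_non_zero_imp_unit[OF A this]
  show thesis using that unfolding Units_def ring_mat_def by auto
qed

lemma rows_independent_GL:
  assumes "rows_independent n P"
  shows "mat n n (\<lambda>(i, j). P i j) \<in> GL n"
proof -
  obtain B where "B \<in> carrier_mat n n" "mat n n (\<lambda>(i, j). P i j) * B = 1\<^sub>m n" "B * mat n n (\<lambda>(i, j). P i j) = 1\<^sub>m n"
    using rows_independent_inverse[OF assms] .
  then show ?thesis unfolding GL_def invertible_mat_def inverts_mat_def by auto
qed

lemma transpose_GL: assumes "A \<in> GL n" shows "transpose_mat A \<in> GL n"
proof -
  from assms obtain B where A: "A \<in> carrier_mat n n" and B: "A * B = 1\<^sub>m n" "B * A = 1\<^sub>m (dim_row B)"
    unfolding GL_def invertible_mat_def inverts_mat_def by auto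
  have "dim_col B = n" using arg_cong[OF B(1), of dim_col] by simp
  moreover have "dim_row B = n" using arg_cong[OF B(2), of dim_col] A by simp
  ultimately have Bc: "B \<in> carrier_mat n n" by auto
  have "transpose_mat B * transpose_mat A = 1\<^sub>m n" "transpose_mat A * transpose_mat B = 1\<^sub>m n"
    unfolding transpose_mult[OF A Bc, symmetric] transpose_mult[OF Bc A, symmetric] B
    using Bc by simp_all
  then show ?thesis using A Bc unfolding GL_def invertible_mat_def inverts_mat_def by auto
qed

lemma rows_independent_span:
  assumes "rows_independent n P"
  shows "\<exists>a. \<forall>j<n. d j = (\<Sum>i<n. a i * P i j)"
proof -
  obtain B where B: "B \<in> carrier_mat n n" "mat n n (\<lambda>(i, j). P i j) * B = 1\<^sub>m n"
    "B * mat n n (\<lambda>(i, j). P i j) = 1\<^sub>m n"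
    using rows_independent_inverse[OF assms] .
  have BP: "(\<Sum>i<n. B $$ (l, i) * P i j) = (if l = j then 1 else 0)" if "l < n" "j < n" for l j
  proof -
    have "(B * mat n n (\<lambda>(i, j). P i j)) $$ (l, j) = 1\<^sub>m n $$ (l, j)" by (simp only: B(3))
    then show ?thesis using that B(1) by (simp add: scalar_prod_def atLeast0LessThan)
  qed
  have "d j = (\<Sum>i<n. (\<Sum>l<n. d l * B $$ (l, i)) * P i j)" if "j < n" for j
  proof -
    have "(\<Sum>i<n. (\<Sum>l<n. d l * B $$ (l, i)) * P i j) = (\<Sum>i<n. \<Sum>l<n. d l * (B $$ (l, i) * P i j))"
      by (simp add: sum_distrib_right mult.assoc)
    also have "\<dots> = (\<Sum>l<n. d l * (\<Sum>i<n. B $$ (l, i) * P i j))"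
      by (subst sum.swap) (simp add: sum_distrib_left)
    also have "\<dots> = (\<Sum>l<n. d l * (if l = j then 1 else 0))"
      using that by (intro sum.cong refl) (simp add: BP)
    also have "\<dots> = d j" using that by (simp add: sum_mult_delta)
    finally show ?thesis ..
  qed
  then show ?thesis by (intro exI[of _ "\<lambda>i. \<Sum>l<n. d l * B $$ (l, i)"] allI impI)
qed

text \<open>The instances of \<open>Z\<close> are the kernel of a matrix, the elements
  \<open>w\<close> whose form is zero, and the common kernel of linear forms. All see only the first
  n coordinates.\<close>

locale coordinate_subspace =
  fixes n :: nat and Z :: "(nat \<Rightarrow> 'a::field) \<Rightarrow> bool"
  assumes Z_add: "Z f \<Longrightarrow> Z g \<Longrightarrow> Z (\<lambda>j. f j + g j)"
    and Z_scale: "Z f \<Longrightarrow> Z (\<lambda>j. a * f j)"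
    and Z_coords: "Z f \<Longrightarrow> (\<And>j. j < n \<Longrightarrow> g j = f j) \<Longrightarrow> Z g"
    and Z_zero: "Z (\<lambda>_. 0)"
begin

definition covers :: "nat \<Rightarrow> (nat \<Rightarrow> nat \<Rightarrow> 'a) \<Rightarrow> bool"
  where "covers r d \<longleftrightarrow> (\<forall>f. \<exists>a. Z (\<lambda>j. f j - (\<Sum>i<r. a i * d i j)))"

definition independent :: "nat \<Rightarrow> (nat \<Rightarrow> nat \<Rightarrow> 'a) \<Rightarrow> bool"
  where "independent r d \<longleftrightarrow> (\<forall>a. Z (\<lambda>j. \<Sum>i<r. a i * d i j) \<longrightarrow> (\<forall>i<r. a i = 0))"

text \<open>Steinitz exchange starting from the unit vectors: \<open>d s\<close> enters at position
  \<open>s\<close>, and the old row \<open>s\<close> takes the place of row \<open>i0\<close>, which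
  occurs in \<open>d s\<close> and is not among the rows already prescribed.\<close>

lemma extend_rows:
  assumes "independent r d" "s \<le> r"
  shows "s \<le> n \<and> (\<exists>P. rows_independent n P \<and> (\<forall>i<s. \<forall>j<n. P i j = d i j))"
  using assms(2)
proof (induction s)
  case 0
  have "rows_independent n (\<lambda>i j. if i = j then 1 else 0 :: 'a)"
    unfolding rows_independent_def sum_mult_delta by presburger
  then have "\<exists>P. rows_independent n P \<and> (\<forall>i<0. \<forall>j<n. P i j = d i j)" by blast
  then show ?case by simp
next
  case (Suc s)
  have "s \<le> n \<and> (\<exists>P. rows_independent n P \<and> (\<forall>i<s. \<forall>j<n. P i j = d i j))"
    by (rule Suc.IH) (use Suc.prems in simp)
  then obtain P where sn: "s \<le> n" and P: "rows_independent n P" "\<And>i j. i < s \<Longrightarrow> j < n \<Longrightarrow> P i j = d i j"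
    by blast
  obtain a where a: "\<And>j. j < n \<Longrightarrow> d s j = (\<Sum>i<n. a i * P i j)"
    using rows_independent_span[OF P(1), of "d s"] by blast
  have "\<exists>i. s \<le> i \<and> i < n \<and> a i \<noteq> 0"
  proof (rule ccontr)
    assume "\<not> ?thesis"
    then have z: "\<And>i. i < n \<Longrightarrow> \<not> i < s \<Longrightarrow> a i = 0" by (auto simp: not_less)
    define b where "b i = (if i < s then a i else if i = s then -1 else 0)" for i
    have "(\<Sum>i<r. b i * d i j) = 0" if "j < n" for j
    proof -
      have "(\<Sum>i<r. b i * d i j) = (\<Sum>i<Suc s. b i * d i j)"
        by (rule sum.mono_neutral_right) (use Suc.prems in \<open>auto simp: b_def\<close>)
      also have "\<dots> = (\<Sum>i<s. b i * d i j) - d s j" by (simp add: b_def)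
      also have "(\<Sum>i<s. b i * d i j) = (\<Sum>i<s. a i * d i j)"
        by (intro sum.cong refl) (simp add: b_def)
      also have "d s j = (\<Sum>i<s. a i * P i j)"
        unfolding a[OF that] by (rule sum.mono_neutral_right) (use sn z in \<open>simp_all add: subset_iff\<close>)
      also have "\<dots> = (\<Sum>i<s. a i * d i j)" using P(2) that by simp
      finally show ?thesis by simp
    qed
    then have "Z (\<lambda>j. \<Sum>i<r. b i * d i j)" by (intro Z_coords[OF Z_zero]) simp
    then have "b s = 0" using assms(1)[unfolded independent_def, rule_format, of b s] Suc.prems by simp
    then show False by (simp add: b_def)
  qed
  then obtain i0 where i0: "s \<le> i0" "i0 < n" "a i0 \<noteq> 0" by blast
  define Q where "Q i = (if i = s then d s else if i = i0 then P s else P i)" for i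
  have "rows_independent n Q"
    unfolding rows_independent_def
  proof (intro allI impI)
    fix v j assume v: "\<forall>i<n. (\<Sum>j<n. Q i j * v j) = 0" and j: "j < n"
    have 1: "(\<Sum>j<n. P i j * v j) = 0" if "i < n" "i \<noteq> i0" for i
      using v[rule_format, of i0] v[rule_format, of i] that i0 by (cases "i = s") (auto simp: Q_def)
    have "(\<Sum>j<n. d s j * v j) = 0" using v[rule_format, of s] i0 by (simp add: Q_def)
    also have "(\<Sum>j<n. d s j * v j) = (\<Sum>j<n. \<Sum>i<n. a i * P i j * v j)"
      by (intro sum.cong refl) (simp add: a sum_distrib_right)
    also have "\<dots> = (\<Sum>i<n. a i * (\<Sum>j<n. P i j * v j))"
      by (subst sum.swap) (simp add: sum_distrib_left mult.assoc)
    also have "\<dots> = (\<Sum>i<n. if i = i0 then a i * (\<Sum>j<n. P i j * v j) else 0)"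
    proof (intro sum.cong refl)
      fix i assume "i \<in> {..<n}"
      then show "a i * (\<Sum>j<n. P i j * v j) = (if i = i0 then a i * (\<Sum>j<n. P i j * v j) else 0)"
        using 1[of i] by (cases "i = i0") auto
    qed
    also have "\<dots> = a i0 * (\<Sum>j<n. P i0 j * v j)" using i0(2) by (simp add: sum.delta')
    finally have 2: "(\<Sum>j<n. P i0 j * v j) = 0" using i0(3) by simp
    have 3: "(\<Sum>j<n. P i j * v j) = 0" if "i < n" for i
      by (cases "i = i0") (use 1[OF that] 2 in simp_all)
    show "v j = 0" by (rule P(1)[unfolded rows_independent_def, rule_format, of v j, OF 3 j])
  qed
  moreover have "Q i j = d i j" if "i < Suc s" "j < n" for i j
    using that i0 P(2) by (auto simp: Q_def less_Suc_eq)
  ultimately have "rows_independent n Q \<and> (\<forall>i<Suc s. \<forall>j<n. Q i j = d i j)" by blast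
  moreover have "Suc s \<le> n" using i0 by simp
  ultimately show ?case by blast
qed

lemma GL_adapted:
  assumes "independent r d" "covers r d"
  shows "r \<le> n" "\<exists>A\<in>GL n. (\<forall>i<r. \<forall>j<n. A $$ (i, j) = d i j) \<and> (\<forall>i<n. r \<le> i \<longrightarrow> Z (\<lambda>j. A $$ (i, j)))"
proof -
  obtain P where rn: "r \<le> n" and P: "rows_independent n P" "\<And>i j. i < r \<Longrightarrow> j < n \<Longrightarrow> P i j = d i j"
    using extend_rows[OF assms(1) order_refl] by auto
  show "r \<le> n" by (rule rn)
  have "\<exists>b. \<forall>i. Z (\<lambda>j. P i j - (\<Sum>k<r. b i k * d k j))"
    by (rule choice) (use assms(2) in \<open>auto simp: covers_def\<close>)
  then obtain b where b: "\<And>i. Z (\<lambda>j. P i j - (\<Sum>k<r. b i k * d k j))" by blast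
  \<comment> \<open>Subtracting combinations of the first \<open>r\<close> rows from the later ones
    moves these into \<open>Z\<close> and does not affect the kernel of the matrix.\<close>
  define Q where "Q i j = (if i < r then P i j else P i j - (\<Sum>k<r. b i k * d k j))" for i j
  have "rows_independent n Q"
    unfolding rows_independent_def
  proof (intro allI impI)
    fix v j assume v: "\<forall>i<n. (\<Sum>j<n. Q i j * v j) = 0" and j: "j < n"
    have 1: "(\<Sum>j<n. P i j * v j) = 0" if "i < r" for i
      using v[rule_format, of i] that rn by (simp add: Q_def)
    have 2: "(\<Sum>j<n. P i j * v j) = 0" if i: "i < n" "\<not> i < r" for i
    proof -
      have "(\<Sum>j<n. (\<Sum>k<r. b i k * d k j) * v j) = (\<Sum>j<n. \<Sum>k<r. b i k * (P k j * v j))"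
        using P(2) by (simp add: sum_distrib_right mult.assoc)
      also have "\<dots> = (\<Sum>k<r. b i k * (\<Sum>j<n. P k j * v j))"
        by (subst sum.swap) (simp add: sum_distrib_left)
      also have "\<dots> = 0" by (simp add: 1)
      finally show ?thesis
        using v[rule_format, of i] i by (simp add: Q_def left_diff_distrib sum_subtractf)
    qed
    have 3: "(\<Sum>j<n. P i j * v j) = 0" if "i < n" for i
      by (cases "i < r") (use 1 2[OF that] in simp_all)
    show "v j = 0" by (rule P(1)[unfolded rows_independent_def, rule_format, of v j, OF 3 j])
  qed
  then have "mat n n (\<lambda>(i, j). Q i j) \<in> GL n" by (rule rows_independent_GL)
  moreover have "Z (\<lambda>j. mat n n (\<lambda>(i, j). Q i j) $$ (i, j))" if "i < n" "r \<le> i" for i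
    by (rule Z_coords[OF b[of i]]) (use that in \<open>simp add: Q_def\<close>)
  ultimately show "\<exists>A\<in>GL n. (\<forall>i<r. \<forall>j<n. A $$ (i, j) = d i j) \<and> (\<forall>i<n. r \<le> i \<longrightarrow> Z (\<lambda>j. A $$ (i, j)))"
    using rn P(2) by (intro bexI[of _ "mat n n (\<lambda>(i, j). Q i j)"]) (auto simp: Q_def)
qed

text \<open>A family of minimal length that spans modulo \<open>Z\<close> is independent, as a
  dependent member could be eliminated; its length is at most \<open>r\<close>.\<close>

lemma GL_covers:
  assumes "covers r d"
  shows "\<exists>A\<in>GL n. \<forall>i<n. r \<le> i \<longrightarrow> Z (\<lambda>j. A $$ (i, j))"
proof -
  define s where "s = (LEAST s. \<exists>d. covers s d)"
  have "\<exists>d. covers s d" unfolding s_def by (rule LeastI) (use assms in blast)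
  then obtain d' where d': "covers s d'" by blast
  have sr: "s \<le> r" unfolding s_def by (rule Least_le) (use assms in blast)
  have "independent s d'"
    unfolding independent_def
  proof (intro allI impI, rule ccontr)
    fix a i assume Za: "Z (\<lambda>j. \<Sum>i<s. a i * d' i j)" and i: "i < s" "a i \<noteq> 0"
    obtain t where t: "s = Suc t" using i(1) by (cases s) auto
    define e where "e k = (if k < i then d' k else d' (Suc k))" for k
    have split: "(\<Sum>k<s. g k * d' k j) = g i * d' i j + (\<Sum>k<t. g (if k < i then k else Suc k) * e k j)" for g j
    proof -
      have "(\<Sum>k<s. g k * d' k j) = g i * d' i j + (\<Sum>k\<in>{..<s} - {i}. g k * d' k j)"
        using i(1) by (simp add: sum.remove)
      also have "(\<Sum>k\<in>{..<s} - {i}. g k * d' k j) = (\<Sum>k<t. g (if k < i then k else Suc k) * e k j)"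
        by (rule sum.reindex_bij_witness[where j="\<lambda>k. if k < i then k else k - 1" and i="\<lambda>k. if k < i then k else Suc k"])
           (use t i(1) in \<open>auto simp: e_def\<close>)
      finally show ?thesis .
    qed
    have "covers t e"
      unfolding covers_def
    proof
      fix f
      obtain b where b: "Z (\<lambda>j. f j - (\<Sum>k<s. b k * d' k j))" using d' unfolding covers_def by blast
      define c where "c k = b k - b i / a i * a k" for k
      have "Z (\<lambda>j. (f j - (\<Sum>k<s. b k * d' k j)) + b i / a i * (\<Sum>k<s. a k * d' k j))"
        by (intro Z_add b Z_scale Za)
      moreover have eq: "(f j - (\<Sum>k<s. b k * d' k j)) + b i / a i * (\<Sum>k<s. a k * d' k j)
          = f j - (\<Sum>k<s. c k * d' k j)" for j
        by (simp add: c_def left_diff_distrib sum_subtractf sum_distrib_left mult.assoc)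
      ultimately have "Z (\<lambda>j. f j - (\<Sum>k<s. c k * d' k j))" by (simp only:)
      moreover have "c i = 0" using i(2) by (simp add: c_def)
      ultimately have "Z (\<lambda>j. f j - (\<Sum>k<t. c (if k < i then k else Suc k) * e k j))"
        by (simp only: split mult_zero_left add_0_left)
      then show "\<exists>a. Z (\<lambda>j. f j - (\<Sum>k<t. a k * e k j))" by (rule exI[of _ "\<lambda>k. c (if k < i then k else Suc k)"])
    qed
    then have "s \<le> t" unfolding s_def by (intro Least_le) blast
    with t show False by simp
  qed
  from GL_adapted(2)[OF this d'] sr show ?thesis by (meson order_trans)
qed

end

section \<open>The tensor of a quadratic map\<close>

text \<open>The unit vectors at the chosen columns span modulo the kernel of \<open>A\<close>:
  subtracting from a vector the combination of them with coefficients given by \<open>h\<close>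
  leaves a kernel vector.\<close>

lemma GL_kernel:
  fixes A :: "'i \<Rightarrow> nat \<Rightarrow> 'a::field"
  assumes "rank_le r I {..<n} A"
  shows "\<exists>P\<in>GL n. \<forall>a<n. r \<le> a \<longrightarrow> (\<forall>i\<in>I. (\<Sum>j<n. A i j * P $$ (a, j)) = 0)"
proof -
  have "\<exists>s\<le>r. \<exists>b h. column_expansion I {..<n} A s b h"
    by (rule column_expansion_if_minors_zero) (rule minor_zero_if_rank_le[OF assms])
  then obtain s b h where s: "s \<le> r" and bh: "column_expansion I {..<n} A s b h" by blast
  have b: "\<forall>k<s. b k \<in> {..<n}" and h: "\<forall>i\<in>I. \<forall>j\<in>{..<n}. A i j = (\<Sum>k<s. A i (b k) * h k j)"
    using bh unfolding column_expansion_def by (rule conjunct1, rule conjunct2)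
  interpret coordinate_subspace n "\<lambda>f. \<forall>i\<in>I. (\<Sum>j<n. A i j * f j) = 0"
  proof
    fix f g :: "nat \<Rightarrow> 'a" and a
    assume f: "\<forall>i\<in>I. (\<Sum>j<n. A i j * f j) = 0"
    show "\<forall>i\<in>I. (\<Sum>j<n. A i j * (f j + g j)) = 0" if "\<forall>i\<in>I. (\<Sum>j<n. A i j * g j) = 0"
      using f that by (simp add: distrib_left sum.distrib)
    show "\<forall>i\<in>I. (\<Sum>j<n. A i j * (a * f j)) = 0"
      using f by (simp add: mult.left_commute[of _ a] sum_distrib_left[symmetric])
    show "\<forall>i\<in>I. (\<Sum>j<n. A i j * g j) = 0" if "\<And>j. j < n \<Longrightarrow> g j = f j"
      using f that by simp
  qed simp
  have "covers s (\<lambda>k j. delta (b k) j)"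
    unfolding covers_def
  proof
    fix f
    define a where "a k = (\<Sum>j<n. h k j * f j)" for k
    have "(\<Sum>j<n. A i j * (f j - (\<Sum>k<s. a k * delta (b k) j))) = 0" if i: "i \<in> I" for i
    proof -
      have 1: "(\<Sum>j<n. A i j * f j) = (\<Sum>k<s. A i (b k) * a k)"
      proof -
        have "(\<Sum>j<n. A i j * f j) = (\<Sum>j<n. \<Sum>k<s. A i (b k) * (h k j * f j))"
          by (intro sum.cong refl, subst h[rule_format, OF i]) (simp_all add: sum_distrib_right mult.assoc)
        also have "\<dots> = (\<Sum>k<s. A i (b k) * a k)"
          by (subst sum.swap) (simp add: a_def sum_distrib_left)
        finally show ?thesis .
      qed
      have "(\<Sum>j<n. A i j * (\<Sum>k<s. a k * delta (b k) j)) = (\<Sum>k<s. a k * (\<Sum>j<n. delta (b k) j * A i j))"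
        unfolding sum_distrib_left by (subst sum.swap) (simp only: ac_simps)
      also have "\<dots> = (\<Sum>k<s. A i (b k) * a k)"
        by (intro sum.cong refl) (use b in \<open>simp add: sum_mult_delta\<close>)
      finally show ?thesis by (simp add: right_diff_distrib sum_subtractf 1)
    qed
    then show "\<exists>a. \<forall>i\<in>I. (\<Sum>j<n. A i j * (f j - (\<Sum>k<s. a k * delta (b k) j))) = 0"
      by (intro exI[of _ a] ballI)
  qed
  from GL_covers[OF this] obtain P where P: "P \<in> GL n"
    "\<And>i. i < n \<Longrightarrow> s \<le> i \<Longrightarrow> \<forall>ia\<in>I. (\<Sum>j<n. A ia j * P $$ (i, j)) = 0"
    by (elim bexE) simp
  show ?thesis by (rule bexI[OF _ P(1)]) (use P(2) s in simp)
qed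

definition tens :: "nat \<Rightarrow> nat \<Rightarrow> (nat \<Rightarrow> nat \<Rightarrow> nat \<Rightarrow> 'a::comm_ring_1) \<Rightarrow> (nat \<Rightarrow> 'a) \<Rightarrow> (nat \<Rightarrow> 'a) \<Rightarrow> (nat \<Rightarrow> 'a) \<Rightarrow> 'a"
  where "tens m n c w x y = (\<Sum>i<m. \<Sum>j<n. \<Sum>k<n. w i * x j * y k * c i j k)"

abbreviation fscale :: "'a::times \<Rightarrow> (nat \<Rightarrow> 'a) \<Rightarrow> nat \<Rightarrow> 'a"
  where "fscale a f \<equiv> (\<lambda>i. a * f i)"

lemma tens_tensor:
  fixes c :: "nat \<Rightarrow> nat \<Rightarrow> nat \<Rightarrow> 'a::field"
  assumes "\<And>i j k. c i j k = c i k j"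
  shows "tensor fscale fscale (tens m n c)"
proof
  fix w w' x x' y :: "nat \<Rightarrow> 'a" and a
  show "tens m n c (w + w') x y = tens m n c w x y + tens m n c w' x y"
    by (simp add: tens_def distrib_right sum.distrib)
  show "tens m n c (fscale a w) x y = a * tens m n c w x y"
    by (simp add: tens_def sum_distrib_left mult.assoc)
  show "tens m n c w (x + x') y = tens m n c w x y + tens m n c w x' y"
    by (simp add: tens_def distrib_right distrib_left sum.distrib)
  show "tens m n c w (fscale a x) y = a * tens m n c w x y"
    by (simp add: tens_def sum_distrib_left ac_simps)
  have "(\<Sum>j<n. \<Sum>k<n. w i * x j * y k * c i j k) = (\<Sum>j<n. \<Sum>k<n. w i * y j * x k * c i j k)" for i
    by (subst sum.swap, subst assms) (simp only: ac_simps)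
  then show "tens m n c w x y = tens m n c w y x" by (simp only: tens_def)
qed

lemma tens_contract_w: "tens m n c w x y = (\<Sum>j<n. \<Sum>k<n. x j * y k * (\<Sum>i<m. c i j k * w i))"
proof -
  have "tens m n c w x y = (\<Sum>j<n. \<Sum>i<m. \<Sum>k<n. w i * x j * y k * c i j k)"
    unfolding tens_def by (rule sum.swap)
  also have "\<dots> = (\<Sum>j<n. \<Sum>k<n. \<Sum>i<m. w i * x j * y k * c i j k)"
    by (intro sum.cong refl sum.swap)
  finally show ?thesis by (simp add: sum_distrib_left ac_simps)
qed

lemma tens_contract_v: "tens m n c w x y = (\<Sum>i<m. \<Sum>k<n. w i * y k * (\<Sum>j<n. c i j k * x j))"
proof -
  have "tens m n c w x y = (\<Sum>i<m. \<Sum>k<n. \<Sum>j<n. w i * x j * y k * c i j k)"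
    unfolding tens_def by (intro sum.cong refl sum.swap)
  then show ?thesis by (simp add: sum_distrib_left ac_simps)
qed

lemma tens_delta:
  assumes "i < m" "j < n" "k < n"
  shows "tens m n c (delta i) (delta j) (delta k) = c i j k"
proof -
  have 1: "(\<Sum>i<m. c i j k * delta i0 i) = c i0 j k" if "i0 < m" for i0 j k
    using sum_mult_delta(2)[of i0 "\<lambda>i. c i j k" m] that by (simp only: mult.commute if_True)
  have "tens m n c (delta i) (delta j) (delta k) = (\<Sum>j'<n. delta j j' * (\<Sum>k'<n. delta k k' * c i j' k'))"
    unfolding tens_contract_w 1[OF assms(1)] by (simp only: sum_distrib_left mult.assoc)
  also have "\<dots> = c i j k" by (simp only: sum_mult_delta assms if_True)
  finally show ?thesis .
qed

lemma tens_eq_sum: "tens m n c w x y = (\<Sum>i<m. \<Sum>j<n. w i * (\<Sum>k<n. c i j k * y k) * x j)"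
  by (simp add: tens_def sum_distrib_left sum_distrib_right ac_simps)

text \<open>Rank does not grow under multiplication from both sides; here the outer factors have
  rows indexed by all vectors, so a bound in coordinates becomes one for every choice of
  \<open>w\<close> and \<open>y\<close>.\<close>

lemma rank_le_UNIV:
  assumes "rank_le r {..<m} {..<n} A"
  shows "rank_le r UNIV UNIV (\<lambda>w y. \<Sum>i<m. \<Sum>j<n. f w i * A i j * g y j)"
proof -
  obtain G H where GH: "\<And>i j. i < m \<Longrightarrow> j < n \<Longrightarrow> A i j = (\<Sum>k<r. G k i * H k j)"
    using assms unfolding rank_le_def by auto
  show ?thesis
  proof (rule rank_leI)
    fix w y
    have "(\<Sum>i<m. \<Sum>j<n. f w i * A i j * g y j) = (\<Sum>i<m. \<Sum>j<n. \<Sum>k<r. (f w i * G k i) * (H k j * g y j))"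
      by (intro sum.cong refl) (simp add: GH sum_distrib_left sum_distrib_right mult.assoc)
    also have "\<dots> = (\<Sum>i<m. \<Sum>k<r. \<Sum>j<n. (f w i * G k i) * (H k j * g y j))"
      by (intro sum.cong refl sum.swap)
    also have "\<dots> = (\<Sum>k<r. \<Sum>i<m. \<Sum>j<n. (f w i * G k i) * (H k j * g y j))"
      by (rule sum.swap)
    also have "\<dots> = (\<Sum>k<r. (\<Sum>i<m. f w i * G k i) * (\<Sum>j<n. H k j * g y j))"
      by (simp only: sum_product)
    finally show "(\<Sum>i<m. \<Sum>j<n. f w i * A i j * g y j) = (\<Sum>k<r. (\<Sum>i<m. f w i * G k i) * (\<Sum>j<n. H k j * g y j))" .
  qed
qed

lemma sum_pCons2: "(\<Sum>i\<in>S. [:f i, g i:]) = [:\<Sum>i\<in>S. f i, \<Sum>i\<in>S. g i:]"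
  by (induction S rule: infinite_finite_induct) simp_all

text \<open>The matrix of values at the generic point, whose coordinates are the variables; for a
  quadratic map this is its Jacobian matrix.\<close>

definition generic :: "nat \<Rightarrow> (nat \<Rightarrow> nat \<Rightarrow> nat \<Rightarrow> 'a::comm_ring_1) \<Rightarrow> nat \<Rightarrow> nat \<Rightarrow> 'a mpoly"
  where "generic n c i j = (\<Sum>k<n. Const (c i j k) * X k)"

lemma eval_generic:
  assumes "comm_ring_hom h"
  shows "eval_mpoly h x (generic n c i j) = (\<Sum>k<n. h (c i j k) * x k)"
proof -
  interpret mpoly_eval h using assms by (simp add: mpoly_eval_def)
  interpret e: comm_ring_hom "eval_mpoly h x" by (rule eval_hom)
  show ?thesis by (simp add: generic_def e.hom_sum e.hom_mult eval_Const eval_X)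
qed

text \<open>Vanishing of the minors of the generic matrix is a polynomial identity, so it survives
  the substitution of x + t z over an extension. Passing to fractions of polynomials in t turns it
  into a factorization, which extends to arbitrary \<open>w\<close> and \<open>y\<close>.\<close>

lemma rank_le_3_tensor_hom:
  fixes h :: "'a::field \<Rightarrow> 'e::field"
  assumes h: "comm_ring_hom h" and sym: "\<And>i j k. c i j k = c i k j"
    and rk: "rank_le 3 {..<m} {..<n} (\<lambda>i j. to_fract (generic n c i j))"
  shows "rank_le_3_tensor fscale fscale (tens m n (\<lambda>i j k. h (c i j k)))"
proof -
  interpret h: comm_ring_hom h by (rule h)
  interpret tensor fscale fscale "tens m n (\<lambda>i j k. h (c i j k))"
    by (rule tens_tensor) (rule arg_cong[where f=h], rule sym)
  show ?thesis
  proof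
    fix w1 w2 w3 w4 x y1 y2 y3 y4 z :: "nat \<Rightarrow> 'e"
    define hp where "hp = (\<lambda>a. [:h a:])"
    have hp: "comm_ring_hom hp" by unfold_locales (simp_all add: hp_def h.hom_add h.hom_mult)
    interpret hp: mpoly_eval hp using hp by (simp add: mpoly_eval_def)
    define \<phi> where "\<phi> = eval_mpoly hp (\<lambda>k. [:x k, z k:])"
    interpret \<phi>: comm_ring_hom \<phi> unfolding \<phi>_def by (rule hp.eval_hom)
    define M where "M i j = \<phi> (generic n c i j)" for i j
    have "minor (Suc 3) a b (\<lambda>i j. to_fract (M i j)) = 0"
      if "\<And>k. k \<le> 3 \<Longrightarrow> a k \<in> {..<m}" "\<And>k. k \<le> 3 \<Longrightarrow> b k \<in> {..<n}" for a b
    proof -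
      have "to_fract (minor (Suc 3) a b (generic n c)) = 0"
        using minor_zero_if_rank_le[OF rk that] unfolding to_fract.minor_hom .
      then have "minor (Suc 3) a b (generic n c) = 0" by simp
      then show ?thesis unfolding M_def to_fract.minor_hom \<phi>.minor_hom by simp
    qed
    then have "rank_le 3 {..<m} {..<n} (\<lambda>i j. to_fract (M i j))" by (rule rank_le_if_minors_zero)
    from rank_le_UNIV[OF this, where f="\<lambda>w i. to_fract [:w i:]" and g="\<lambda>y j. to_fract [:y j:]"]
    have "rank_le 3 UNIV UNIV (\<lambda>w y. to_fract (\<Sum>i<m. \<Sum>j<n. [:w i:] * M i j * [:y j:]))"
      by (simp only: to_fract.hom_sum to_fract.hom_mult)
    moreover have "(\<Sum>i<m. \<Sum>j<n. [:w i:] * M i j * [:y j:]) =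
        [:tens m n (\<lambda>i j k. h (c i j k)) w x y, tens m n (\<lambda>i j k. h (c i j k)) w z y:]" for w y
    proof -
      have M: "M i j = [:\<Sum>k<n. h (c i j k) * x k, \<Sum>k<n. h (c i j k) * z k:]" for i j
        unfolding M_def \<phi>_def eval_generic[OF hp] by (simp add: hp_def sum_pCons2 mult.commute)
      show ?thesis
        unfolding M local.sym[of w x y] local.sym[of w z y]
        unfolding tens_eq_sum
        by (simp add: sum_pCons2 ac_simps)
    qed
    ultimately have R: "rank_le 3 UNIV UNIV (\<lambda>w y. to_fract
        [:tens m n (\<lambda>i j k. h (c i j k)) w x y, tens m n (\<lambda>i j k. h (c i j k)) w z y:])" by (simp only:)
    have "to_fract (minor (Suc 3) ((!) [w1,w2,w3,w4]) ((!) [y1,y2,y3,y4])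
       (\<lambda>w y. [:tens m n (\<lambda>i j k. h (c i j k)) w x y, tens m n (\<lambda>i j k. h (c i j k)) w z y:])) = 0"
      using minor_zero_if_rank_le[OF R, of "(!) [w1,w2,w3,w4]" "(!) [y1,y2,y3,y4]"]
      unfolding to_fract.minor_hom by simp
    then show "det (mat 4 4 (\<lambda>(i, j). [:tens m n (\<lambda>i j k. h (c i j k)) ([w1, w2, w3, w4] ! i) x ([y1, y2, y3, y4] ! j),
        tens m n (\<lambda>i j k. h (c i j k)) ([w1, w2, w3, w4] ! i) z ([y1, y2, y3, y4] ! j):])) = 0"
      by (simp add: minor_def)
  qed
qed

lemma (in rank_le_3_tensor) frame_from_minor:
  assumes "minor 3 w y (\<lambda>w y. \<beta> w p y) \<noteq> 0"
  shows "\<exists>q1 q2 q3. framed_tensor vs ws \<beta> p (y 0) (y 1) (y 2) q1 q2 q3"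
  by (rule frame_exists[OF refl refl refl refl refl refl refl refl refl])
     (use assms in \<open>simp add: minor_def det3_explicit\<close>)

lemma transform_component:
  fixes H :: "'a::field mpoly vec"
  assumes H: "dim_vec H = m" "\<And>i. i < m \<Longrightarrow> H $ i = quadratic_form n (d i)"
    and S: "S \<in> carrier_mat m m" and A: "A \<in> carrier_mat n n" and i: "i < m"
  shows "linear_transform n S (transpose_mat A) H $ i =
    quadratic_form n (\<lambda>a b. \<Sum>s<m. S $$ (i, s) * (\<Sum>j<n. \<Sum>k<n. d s j k * (A $$ (a, j) * A $$ (b, k))))"
proof -
  define \<sigma> where "\<sigma> j = (map_mat Const (transpose_mat A) *\<^sub>v vec n X) $ j" for j
  have \<sigma>: "\<sigma> j = (\<Sum>l<n. Const (A $$ (l, j)) * X l)" if "j < n" for j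
    using that A by (simp add: \<sigma>_def scalar_prod_def atLeast0LessThan)
  have "linear_transform n S (transpose_mat A) H $ i = (\<Sum>s<m. Const (S $$ (i, s)) * subst_mpoly \<sigma> (H $ s))"
    using S i H(1) unfolding linear_transform_def \<sigma>_def[symmetric]
    by (simp add: scalar_prod_def atLeast0LessThan \<sigma>_def[abs_def])
  also have "\<dots> = (\<Sum>s<m. Const (S $$ (i, s)) *
      quadratic_form n (\<lambda>a b. \<Sum>j<n. \<Sum>k<n. d s j k * (A $$ (a, j) * A $$ (b, k))))"
    by (intro sum.cong refl) (simp add: H(2) subst_quadratic_form[where t="\<lambda>j l. A $$ (l, j)", OF \<sigma>])
  also have "\<dots> = quadratic_form n (\<lambda>a b. \<Sum>s<m. S $$ (i, s) * (\<Sum>j<n. \<Sum>k<n. d s j k * (A $$ (a, j) * A $$ (b, k))))"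
    by (rule quadratic_form_sum)
  finally show ?thesis .
qed

lemma transform_polarized:
  fixes d :: "nat \<Rightarrow> nat \<Rightarrow> nat \<Rightarrow> 'a::comm_ring_1"
  shows "(\<Sum>s<m. w s * (\<Sum>j<n. \<Sum>k<n. d s j k * (x j * y k))) + (\<Sum>s<m. w s * (\<Sum>j<n. \<Sum>k<n. d s j k * (y j * x k)))
    = tens m n (\<lambda>i j k. d i j k + d i k j) w x y"
proof -
  have 1: "(\<Sum>j<n. \<Sum>k<n. d s j k * (y j * x k)) = (\<Sum>j<n. \<Sum>k<n. d s k j * (x j * y k))" for s
    by (subst sum.swap) (simp only: mult.commute[of "y _"])
  have "(\<Sum>s<m. w s * (\<Sum>j<n. \<Sum>k<n. d s j k * (x j * y k))) + (\<Sum>s<m. w s * (\<Sum>j<n. \<Sum>k<n. d s k j * (x j * y k)))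
      = (\<Sum>s<m. w s * (\<Sum>j<n. \<Sum>k<n. (d s j k + d s k j) * (x j * y k)))"
    by (simp only: distrib_right sum.distrib distrib_left)
  also have "\<dots> = tens m n (\<lambda>i j k. d i j k + d i k j) w x y"
    unfolding tens_def by (simp only: sum_distrib_left ac_simps)
  finally show ?thesis by (simp only: 1)
qed

lemma rank_le_cong:
  assumes "\<And>i j. i \<in> I \<Longrightarrow> j \<in> J \<Longrightarrow> A i j = B i j"
  shows "rank_le r I J A \<longleftrightarrow> rank_le r I J B"
  unfolding rank_le_def using assms by simp

lemma minor_cong:
  assumes "\<And>k l. k < r \<Longrightarrow> l < r \<Longrightarrow> A (a k) (b l) = B (a' k) (b' l)"
  shows "minor r a b A = minor r a' b' B"
  unfolding minor_def by (intro arg_cong[where f=det] eq_matI) (simp_all add: assms)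

lemma nonzero_minor:
  fixes A :: "'i \<Rightarrow> 'j \<Rightarrow> 'a::field"
  assumes "\<not> rank_le r I J A"
  obtains a b where "\<And>k. k \<le> r \<Longrightarrow> a k \<in> I" "\<And>k. k \<le> r \<Longrightarrow> b k \<in> J" "minor (Suc r) a b A \<noteq> 0"
proof (rule ccontr)
  assume no: "\<not> thesis"
  have "rank_le r I J A"
  proof (rule rank_le_if_minors_zero, rule ccontr)
    fix a b assume "\<And>k. k \<le> r \<Longrightarrow> a k \<in> I" "\<And>k. k \<le> r \<Longrightarrow> b k \<in> J" "minor (Suc r) a b A \<noteq> 0"
    then have thesis by (rule that)
    with no show False ..
  qed
  with assms show False ..
qed

text \<open>Rank bounds are expressed by minors, which commute with the injective homomorphism
  \<open>h\<close>.\<close>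

lemma rank_le_descend:
  fixes h :: "'a::field \<Rightarrow> 'e::field"
  assumes h: "comm_ring_hom h" and "rank_le r I J (\<lambda>i j. h (A i j))"
  shows "rank_le r I J A"
proof (rule rank_le_if_minors_zero)
  interpret comm_ring_hom h by (rule h)
  fix a b assume ab: "\<And>k. k \<le> r \<Longrightarrow> a k \<in> I" "\<And>k. k \<le> r \<Longrightarrow> b k \<in> J"
  have 0: "h (minor (Suc r) a b A) = 0"
    using minor_zero_if_rank_le[OF assms(2) ab] unfolding minor_hom .
  have nz: "h x \<noteq> 0" if "x \<noteq> 0" for x
  proof
    assume "h x = 0"
    moreover have "h x * h (inverse x) = 1" using that by (simp flip: hom_mult)
    ultimately show False by simp
  qed
  show "minor (Suc r) a b A = 0"
  proof (rule ccontr)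
    assume "minor (Suc r) a b A \<noteq> 0"
    from nz[OF this] 0 show False by (rule notE)
  qed
qed

lemma CHAR_eq_2_iff: "CHAR('a::field) = 2 \<longleftrightarrow> (2::'a) = 0"
proof
  assume "CHAR('a) = 2"
  then show "(2::'a) = 0" using of_nat_eq_0_iff_char_dvd[of 2, where 'a='a] by simp
next
  assume "(2::'a) = 0"
  then have d: "CHAR('a) dvd 2" using of_nat_eq_0_iff_char_dvd[of 2, where 'a='a] by simp
  have "\<not> CHAR('a) dvd 1" using of_nat_eq_0_iff_char_dvd[of 1, where 'a='a] by simp
  then have "CHAR('a) \<noteq> 1" by (intro notI) simp
  moreover have "CHAR('a) \<le> 2" using d by (rule dvd_imp_le) simp
  moreover have "CHAR('a) \<noteq> 0" using d by (intro notI) simp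
  ultimately show "CHAR('a) = 2" by linarith
qed

text \<open>Vanishing on all \<open>K\<close>-points is propagated to the generic point one coordinate at a time:
  as a function of one coordinate a \<open>3 \<times> 3\<close> minor is a cubic polynomial whose leading coefficient
  is its value at a unit vector, and which vanishes at the three points 0, 1 and -1.\<close>

lemma minor3_linear:
  fixes A B :: "'i \<Rightarrow> 'j \<Rightarrow> 'a::comm_ring_1"
  shows "\<exists>u v. \<forall>s. minor 3 a b (\<lambda>i j. A i j + s * B i j) = minor 3 a b A + s * u + s^2 * v + s^3 * minor 3 a b B"
proof -
  have D: "\<exists>u v. \<forall>s. (a00 + s * b00) * ((a11 + s * b11) * (a22 + s * b22) - (a12 + s * b12) * (a21 + s * b21))
      - (a01 + s * b01) * ((a10 + s * b10) * (a22 + s * b22) - (a12 + s * b12) * (a20 + s * b20))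
      + (a02 + s * b02) * ((a10 + s * b10) * (a21 + s * b21) - (a11 + s * b11) * (a20 + s * b20))
    = (a00 * (a11 * a22 - a12 * a21) - a01 * (a10 * a22 - a12 * a20) + a02 * (a10 * a21 - a11 * a20)) + s * u + s^2 * v
      + s^3 * (b00 * (b11 * b22 - b12 * b21) - b01 * (b10 * b22 - b12 * b20) + b02 * (b10 * b21 - b11 * b20))"
    for a00 a01 a02 a10 a11 a12 a20 a21 a22 b00 b01 b02 b10 b11 b12 b20 b21 b22 :: 'a
    by (rule exI[of _ "b00 * (a11 * a22 - a12 * a21) - b01 * (a10 * a22 - a12 * a20) + b02 * (a10 * a21 - a11 * a20)
        + a00 * (b11 * a22 + a11 * b22 - b12 * a21 - a12 * b21) - a01 * (b10 * a22 + a10 * b22 - b12 * a20 - a12 * b20)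
        + a02 * (b10 * a21 + a10 * b21 - b11 * a20 - a11 * b20)"],
      rule exI[of _ "b00 * (b11 * a22 + a11 * b22 - b12 * a21 - a12 * b21) - b01 * (b10 * a22 + a10 * b22 - b12 * a20 - a12 * b20)
        + b02 * (b10 * a21 + a10 * b21 - b11 * a20 - a11 * b20)
        + a00 * (b11 * b22 - b12 * b21) - a01 * (b10 * b22 - b12 * b20) + a02 * (b10 * b21 - b11 * b20)"])
      (simp add: power2_eq_square power3_eq_cube algebra_simps)
  show ?thesis unfolding minor_def det3_explicit by (rule D)
qed

lemma minor3_point:
  fixes c :: "nat \<Rightarrow> nat \<Rightarrow> nat \<Rightarrow> 'a::field"
  assumes two: "(2::'a) \<noteq> 0" and nz: "minor 3 a b (generic n c) \<noteq> 0"
  shows "\<exists>p. minor 3 a b (\<lambda>i j. \<Sum>k<n. c i j k * p k) \<noteq> 0"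
proof (rule ccontr)
  assume "\<not> ?thesis"
  then have 0: "minor 3 a b (\<lambda>i j. \<Sum>k<n. c i j k * p k) = 0" for p by simp
  let ?M = "\<lambda>x i j. \<Sum>k<n. Const (c i j k) * x k"
  have two': "(2::'a mpoly) \<noteq> 0"
  proof -
    have e: "(2::'a mpoly) = Const 2" using Const.hom_add[of 1 1] by simp
    show ?thesis unfolding e Const_eq_0_iff by (rule two)
  qed
  \<comment> \<open>The coordinates from \<open>r\<close> on are constants and those below are
    arbitrary polynomials; for \<open>r = n\<close> nothing is specialized any more and the
    variables may be inserted.\<close>
  have "minor 3 a b (?M x) = 0" if "\<forall>i. r \<le> i \<longrightarrow> i < n \<longrightarrow> (\<exists>t. x i = Const t)" for r x
    using that
  proof (induction r arbitrary: x)
    case 0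
    define p where "p i = (SOME t. x i = Const t)" for i
    have p: "x i = Const (p i)" if "i < n" for i
    proof -
      have "\<exists>t. x i = Const t" using 0 that by simp
      then show ?thesis unfolding p_def by (rule someI_ex)
    qed
    have "minor 3 a b (?M x) = minor 3 a b (\<lambda>i j. Const (\<Sum>k<n. c i j k * p k))"
      by (rule minor_cong) (simp add: p Const.hom_sum Const.hom_mult)
    also have "\<dots> = 0" unfolding Const.minor_hom \<open>\<And>p. minor 3 a b (\<lambda>i j. \<Sum>k<n. c i j k * p k) = 0\<close> by simp
    finally show ?case .
  next
    case (Suc r)
    show ?case
    proof (cases "r < n")
      case False
      show ?thesis by (rule Suc.IH) (use False in simp)
    next
      case True
      define A where "A i j = ?M (x(r := 0)) i j" for i j
      define B where "B i j = Const (c i j r)" for i j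
      have split: "?M (x(r := s)) i j = A i j + s * B i j" for s i j
        using True unfolding A_def B_def by (simp add: sum.remove[of "{..<n}" r] mult.commute)
      obtain u v where uv: "\<forall>s. minor 3 a b (\<lambda>i j. A i j + s * B i j) = minor 3 a b A + s * u + s^2 * v + s^3 * minor 3 a b B"
        using minor3_linear[of a b A B] by (elim exE)
      have "minor 3 a b (\<lambda>i j. c i j r) = minor 3 a b (\<lambda>i j. \<Sum>k<n. c i j k * delta r k)"
      proof (rule minor_cong)
        fix k l
        show "c (a k) (b l) r = (\<Sum>k'<n. c (a k) (b l) k' * delta r k')"
          using sum_mult_delta(2)[of r "\<lambda>k'. c (a k) (b l) k'" n] True by (simp only: mult.commute if_True)
      qed
      then have B0: "minor 3 a b B = 0"
        unfolding B_def Const.minor_hom 0 by simp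
      have P: "minor 3 a b A + Const t * u + Const t ^ 2 * v = 0" for t
      proof -
        have "minor 3 a b (?M (x(r := Const t))) = 0"
        proof (rule Suc.IH, intro allI impI)
          fix i assume "r \<le> i" "i < n"
          then show "\<exists>s. (x(r := Const t)) i = Const s" using Suc.prems by (cases "i = r") auto
        qed
        then show ?thesis unfolding split using uv[rule_format, of "Const t"] B0 by simp
      qed
      have A0: "minor 3 a b A = 0" using P[of 0] by simp
      have e: "u + v = 0" "- u + v = 0" using P[of 1] P[of "-1"] A0 by (simp_all add: Const.hom_uminus)
      have "2 * v = (u + v) + (- u + v)" by simp
      then have v: "v = 0" using e two' by simp
      with e have "u = 0" by simp
      then have "minor 3 a b (\<lambda>i j. A i j + x r * B i j) = 0" using uv A0 B0 v by simp
      then show ?thesis unfolding split[symmetric] by simp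
    qed
  qed
  from this[of n X] have "minor 3 a b (?M X) = 0" by simp
  moreover have "?M X = generic n c" by (intro ext) (simp add: generic_def)
  ultimately show False using nz by simp
qed

lemma tens_w: "tens m n c w x y = (\<Sum>i<m. w i * (\<Sum>j<n. \<Sum>k<n. x j * y k * c i j k))"
  by (simp add: tens_def sum_distrib_left ac_simps)

lemma tens_coords_v:
  assumes "\<And>k. k < n \<Longrightarrow> y k = y' k" shows "tens m n c w x y = tens m n c w x y'"
  unfolding tens_def by (intro sum.cong refl) (simp add: assms)

lemma tens_delta_point:
  assumes "\<And>i j k. c i j k = c i k j" "i < m" "j < n"
  shows "tens m n c (delta i) p (delta j) = (\<Sum>k<n. c i j k * p k)"
proof -
  have "tens m n c (delta i) p (delta j) = (\<Sum>i'<m. delta i i' * (\<Sum>j'<n. \<Sum>k<n. p j' * delta j k * c i' j' k))"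
    by (rule tens_w)
  also have "\<dots> = (\<Sum>j'<n. \<Sum>k<n. p j' * delta j k * c i j' k)"
    by (simp only: sum_mult_delta assms if_True)
  also have "\<dots> = (\<Sum>j'<n. p j' * (\<Sum>k<n. delta j k * c i j' k))"
    by (simp only: sum_distrib_left mult.assoc)
  also have "\<dots> = (\<Sum>j'<n. p j' * c i j' j)"
    by (simp only: sum_mult_delta assms(3) if_True)
  also have "\<dots> = (\<Sum>k<n. c i j k * p k)"
    by (intro sum.cong refl) (subst assms(1), rule mult.commute)
  finally show ?thesis .
qed

lemma choice_obtain:
  assumes "\<forall>i. \<exists>u. P i u" obtains U where "\<And>i. P i (U i)"
proof -
  have "P i (SOME u. P i u)" for i by (rule someI_ex) (rule assms[rule_format])
  then show thesis by (rule that)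
qed

text \<open>The flattening with pairs (j, k) as rows turns spanning by three forms into a rank
  bound. In this shape the property can be descended from an extension field.\<close>

lemma rank_le_if_spanned3:
  fixes c :: "nat \<Rightarrow> nat \<Rightarrow> nat \<Rightarrow> 'a::field"
  assumes sym: "\<And>i j k. c i j k = c i k j" and sp: "tensor.spanned3 (tens m n c)"
  shows "rank_le 3 ({..<n} \<times> {..<n}) {..<m} (\<lambda>(j, k) i. c i j k)"
proof -
  obtain w1 w2 w3 where w: "\<forall>w. \<exists>a b d. \<forall>x y. tens m n c w x y = a * tens m n c w1 x y + b * tens m n c w2 x y + d * tens m n c w3 x y"
    using sp unfolding tensor.spanned3_def[OF tens_tensor[OF sym]] by blast
  define W where "W k = [w1, w2, w3] ! k" for k
  have "\<exists>u. \<forall>x y. tens m n c (delta i) x y = (\<Sum>k<3. tens m n c (W k) x y * u k)" for i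
  proof -
    obtain a b d where abd: "\<forall>x y. tens m n c (delta i) x y = a * tens m n c w1 x y + b * tens m n c w2 x y + d * tens m n c w3 x y"
      using w by blast
    have "tens m n c (delta i) x y = (\<Sum>k<3. tens m n c (W k) x y * ([a, b, d] ! k))" for x y
      unfolding abd[rule_format, of x y] by (simp add: W_def eval_nat_numeral mult.commute)
    then show ?thesis by (intro exI[of _ "(!) [a, b, d]"] allI)
  qed
  then have "\<forall>i. \<exists>u. \<forall>x y. tens m n c (delta i) x y = (\<Sum>k<3. tens m n c (W k) x y * u k)" by (rule allI)
  then obtain U where U: "\<And>i. \<forall>x y. tens m n c (delta i) x y = (\<Sum>k<3. tens m n c (W k) x y * U i k)"
    by (rule choice_obtain) (rule that)
  show ?thesis
  proof (rule rank_leI[where g="\<lambda>k (p, q). tens m n c (W k) (delta p) (delta q)" and h="\<lambda>k i. U i k"])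
    fix p i assume "p \<in> {..<n} \<times> {..<n}" "i \<in> {..<m}"
    then show "(case p of (j, k) \<Rightarrow> \<lambda>i. c i j k) i =
        (\<Sum>k<3. (case p of (p, q) \<Rightarrow> tens m n c (W k) (delta p) (delta q)) * U i k)"
      using U[of i, rule_format, of "delta (fst p)" "delta (snd p)"] tens_delta[of i m "fst p" n "snd p" c]
      by (cases p) simp
  qed
qed

lemma rank_le_if_corank:
  fixes c :: "nat \<Rightarrow> nat \<Rightarrow> nat \<Rightarrow> 'a::field"
  assumes "\<forall>v. \<exists>u. \<forall>w x. tens m n c w x v = (\<Sum>l<r. tens m n c w x (V l) * u l)"
  shows "rank_le r ({..<m} \<times> {..<n}) {..<n} (\<lambda>(i, k) j. c i k j)"
proof -
  have "\<exists>u. \<forall>w x. tens m n c w x (delta j) = (\<Sum>l<r. tens m n c w x (V l) * u l)" for j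
    using assms by (rule spec)
  then have "\<forall>j. \<exists>u. \<forall>w x. tens m n c w x (delta j) = (\<Sum>l<r. tens m n c w x (V l) * u l)" by (rule allI)
  then obtain U where U: "\<And>j. \<forall>w x. tens m n c w x (delta j) = (\<Sum>l<r. tens m n c w x (V l) * U j l)"
    by (rule choice_obtain) (rule that)
  show ?thesis
  proof (rule rank_leI[where g="\<lambda>l (i, k). tens m n c (delta i) (delta k) (V l)" and h="\<lambda>l j. U j l"])
    fix p j assume "p \<in> {..<m} \<times> {..<n}" "j \<in> {..<n}"
    then show "(case p of (i, k) \<Rightarrow> \<lambda>j. c i k j) j =
        (\<Sum>l<r. (case p of (i, k) \<Rightarrow> tens m n c (delta i) (delta k) (V l)) * U j l)"
      using U[of j, rule_format, of "delta (fst p)" "delta (snd p)"] tens_delta[of "fst p" m "snd p" n j c]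
      by (cases p) simp
  qed
qed

lemma rank_le_if_corank3:
  fixes c :: "nat \<Rightarrow> nat \<Rightarrow> nat \<Rightarrow> 'a::field"
  assumes sym: "\<And>i j k. c i j k = c i k j" and "tensor.corank3 (tens m n c)"
  shows "rank_le 3 ({..<m} \<times> {..<n}) {..<n} (\<lambda>(i, k) j. c i k j)"
proof -
  obtain v1 v2 v3 where v: "\<forall>v. \<exists>a b d. \<forall>w x. tens m n c w x v = a * tens m n c w x v1 + b * tens m n c w x v2 + d * tens m n c w x v3"
    using assms(2) unfolding tensor.corank3_def[OF tens_tensor[OF sym]] by blast
  show ?thesis
  proof (rule rank_le_if_corank[where V="(!) [v1, v2, v3]"], rule allI)
    fix v
    obtain a b d where abd: "\<forall>w x. tens m n c w x v = a * tens m n c w x v1 + b * tens m n c w x v2 + d * tens m n c w x v3"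
      using v by blast
    have "tens m n c w x v = (\<Sum>l<3. tens m n c w x ([v1, v2, v3] ! l) * ([a, b, d] ! l))" for w x
      unfolding abd[rule_format, of w x] by (simp add: eval_nat_numeral mult.commute)
    then show "\<exists>u. \<forall>w x. tens m n c w x v = (\<Sum>l<3. tens m n c w x ([v1, v2, v3] ! l) * u l)"
      by (intro exI[of _ "(!) [a, b, d]"] allI)
  qed
qed

lemma rank_le_if_corank4:
  fixes c :: "nat \<Rightarrow> nat \<Rightarrow> nat \<Rightarrow> 'a::field"
  assumes sym: "\<And>i j k. c i j k = c i k j" and "tensor.corank4 (tens m n c)"
  shows "rank_le 4 ({..<m} \<times> {..<n}) {..<n} (\<lambda>(i, k) j. c i k j)"
proof -
  obtain v1 v2 v3 v4 where v: "\<forall>v. \<exists>a b d e. \<forall>w x. tens m n c w x v = a * tens m n c w x v1 + b * tens m n c w x v2 + d * tens m n c w x v3 + e * tens m n c w x v4"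
    using assms(2) unfolding tensor.corank4_def[OF tens_tensor[OF sym]] by blast
  show ?thesis
  proof (rule rank_le_if_corank[where V="(!) [v1, v2, v3, v4]"], rule allI)
    fix v
    obtain a b d e where abd: "\<forall>w x. tens m n c w x v = a * tens m n c w x v1 + b * tens m n c w x v2 + d * tens m n c w x v3 + e * tens m n c w x v4"
      using v by blast
    have "tens m n c w x v = (\<Sum>l<4. tens m n c w x ([v1, v2, v3, v4] ! l) * ([a, b, d, e] ! l))" for w x
      unfolding abd[rule_format, of w x] by (simp add: eval_nat_numeral mult.commute)
    then show "\<exists>u. \<forall>w x. tens m n c w x v = (\<Sum>l<4. tens m n c w x ([v1, v2, v3, v4] ! l) * u l)"
      by (intro exI[of _ "(!) [a, b, d, e]"] allI)
  qed
qed

lemma GL_basis4: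
  fixes c :: "nat \<Rightarrow> nat \<Rightarrow> nat \<Rightarrow> 'a::field"
  assumes sym: "\<And>i j k. c i j k = c i k j" and b: "tensor.basis4 (tens m n c) w1 w2 w3 w4"
  shows "4 \<le> m \<and> (\<exists>S\<in>GL m. (\<forall>s<4. \<forall>i<m. S $$ (s, i) = ([w1, w2, w3, w4] ! s) i) \<and>
    (\<forall>s<m. 4 \<le> s \<longrightarrow> (\<forall>x y. tens m n c (\<lambda>i. S $$ (s, i)) x y = 0)))"
proof -
  let ?t = "tens m n c"
  note T = tens_tensor[OF sym, of m n]
  interpret coordinate_subspace m "\<lambda>w. \<forall>x y. ?t w x y = 0"
  proof
    fix f g :: "nat \<Rightarrow> 'a" and a
    assume f: "\<forall>x y. ?t f x y = 0"
    show "\<forall>x y. ?t (\<lambda>j. f j + g j) x y = 0" if "\<forall>x y. ?t g x y = 0"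
      using f that by (simp add: tens_w distrib_right sum.distrib)
    show "\<forall>x y. ?t (\<lambda>j. a * f j) x y = 0"
      using f by (simp add: tens_w mult.assoc sum_distrib_left[symmetric])
    show "\<forall>x y. ?t g x y = 0" if "\<And>j. j < m \<Longrightarrow> g j = f j"
      using f that by (simp add: tens_w)
  qed (simp add: tens_w)
  define d where "d = (!) [w1, w2, w3, w4]"
  have comb: "?t (\<lambda>j. \<Sum>i<4. a i * d i j) x y = a 0 * ?t w1 x y + a 1 * ?t w2 x y + a 2 * ?t w3 x y + a 3 * ?t w4 x y" for a x y
    by (simp add: d_def tens_w eval_nat_numeral distrib_right sum.distrib sum_distrib_left mult.assoc)
  have ind: "independent 4 d"
    unfolding independent_def comb
  proof (intro allI impI)
    fix a :: "nat \<Rightarrow> 'a" and i :: nat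
    assume *: "\<forall>x y. a 0 * ?t w1 x y + a 1 * ?t w2 x y + a 2 * ?t w3 x y + a 3 * ?t w4 x y = 0" and "i < 4"
    have "a 0 = 0 \<and> a 1 = 0 \<and> a 2 = 0 \<and> a 3 = 0"
      using conjunct2[OF b[unfolded tensor.basis4_def[OF T]], rule_format, of "a 0" "a 1" "a 2" "a 3"] * by blast
    moreover have "i = 0 \<or> i = 1 \<or> i = 2 \<or> i = 3" using \<open>i < 4\<close> by auto
    ultimately show "a i = 0" by auto
  qed
  have cov: "covers 4 d"
    unfolding covers_def
  proof
    fix f
    have "tensor.spanning4 ?t w1 w2 w3 w4" using b unfolding tensor.basis4_def[OF T] by (rule conjunct1)
    then obtain a1 a2 a3 a4 where a: "\<forall>x y. ?t f x y = a1 * ?t w1 x y + a2 * ?t w2 x y + a3 * ?t w3 x y + a4 * ?t w4 x y"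
      unfolding tensor.spanning4_def[OF T] by blast
    have "?t (\<lambda>j. f j - (\<Sum>i<4. ([a1, a2, a3, a4] ! i) * d i j)) x y = 0" for x y
    proof -
      have "?t (\<lambda>j. f j - (\<Sum>i<4. ([a1, a2, a3, a4] ! i) * d i j)) x y =
          ?t f x y - ?t (\<lambda>j. \<Sum>i<4. ([a1, a2, a3, a4] ! i) * d i j) x y"
        by (simp only: tens_w left_diff_distrib sum_subtractf)
      then show ?thesis unfolding comb a[rule_format, of x y] by simp
    qed
    then show "\<exists>a. \<forall>x y. ?t (\<lambda>j. f j - (\<Sum>i<4. a i * d i j)) x y = 0"
      by (intro exI[of _ "(!) [a1, a2, a3, a4]"] allI)
  qed
  show ?thesis using GL_adapted[OF ind cov] unfolding d_def by (intro conjI)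
qed

text \<open>The \<open>U\<close> form a basis modulo the common kernel of the \<open>F\<close>, and
  the remaining rows of \<open>A\<close> are chosen in that kernel. In the new coordinates
  \<open>F i\<close> is the coordinate \<open>X i\<close>.\<close>

lemma GL_dual:
  fixes c :: "nat \<Rightarrow> nat \<Rightarrow> nat \<Rightarrow> 'a::field"
  assumes sym: "\<And>i j k. c i j k = c i k j"
    and F: "\<And>i. i < r \<Longrightarrow> tensor.linform fscale (tens m n c) (F i)"
    and U: "\<And>i k. i < r \<Longrightarrow> k < r \<Longrightarrow> F i (U k) = delta i k"
  shows "r \<le> n \<and> (\<exists>A\<in>GL n. \<forall>a<n. \<forall>i<r. F i (\<lambda>j. A $$ (a, j)) = delta i a)"
proof -
  note T = tens_tensor[OF sym, of m n]
  note L = F[unfolded tensor.linform_def[OF T] tensor.rad_def[OF T]]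
  have add: "F i (\<lambda>j. f j + g j) = F i f + F i g" if "i < r" for i f g
    using L[OF that] unfolding plus_fun_def by blast
  have scale: "F i (\<lambda>j. a * f j) = a * F i f" if "i < r" for i a f
    using L[OF that] by blast
  have zero: "F i (\<lambda>_. 0) = 0" if "i < r" for i using scale[OF that, of 0 "\<lambda>_. 0"] by simp
  have coords: "F i g = F i f" if "i < r" "\<And>j. j < n \<Longrightarrow> g j = f j" for i f g
  proof -
    have "tens m n c w x (\<lambda>j. g j + (-1) * f j) = 0" for w x
      by (subst tens_coords_v[where y'="\<lambda>_. 0"]) (simp_all add: that(2) tens_def)
    then have "F i (\<lambda>j. g j + (-1) * f j) = 0" using L[OF that(1)] by blast
    then have "F i g + (-1) * F i f = 0" unfolding add[OF that(1)] scale[OF that(1)] .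
    then show ?thesis by simp
  qed
  have sum: "F i (\<lambda>j. \<Sum>k<s. a k * U k j) = (\<Sum>k<s. a k * F i (U k))" if "i < r" for i a s
    by (induction s) (simp_all add: zero[OF that] add[OF that] scale[OF that])
  have comb: "F i (\<lambda>j. \<Sum>k<r. a k * U k j) = a i" if "i < r" for i a
  proof -
    have "(\<Sum>k<r. a k * F i (U k)) = (\<Sum>k<r. delta i k * a k)"
      by (intro sum.cong refl) (simp add: U[OF that])
    then show ?thesis unfolding sum[OF that] by (simp only: sum_mult_delta that if_True)
  qed
  interpret coordinate_subspace n "\<lambda>x. \<forall>i<r. F i x = 0"
  proof
    fix f g :: "nat \<Rightarrow> 'a" and a
    assume f: "\<forall>i<r. F i f = 0"
    show "\<forall>i<r. F i (\<lambda>j. f j + g j) = 0" if "\<forall>i<r. F i g = 0"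
      using f that by (simp add: add)
    show "\<forall>i<r. F i (\<lambda>j. a * f j) = 0"
      using f by (simp add: scale)
    show "\<forall>i<r. F i g = 0" if "\<And>j. j < n \<Longrightarrow> g j = f j"
    proof (intro allI impI)
      fix i assume i: "i < r"
      have "F i g = F i f" by (rule coords[OF i that])
      then show "F i g = 0" using f i by simp
    qed
  qed (simp add: zero)
  have ind: "independent r U"
    unfolding independent_def by (simp add: comb)
  have cov: "covers r U"
    unfolding covers_def
  proof
    fix f
    have "F i (\<lambda>j. f j - (\<Sum>k<r. F k f * U k j)) = 0" if "i < r" for i
    proof -
      have "F i (\<lambda>j. f j + (-1) * (\<Sum>k<r. F k f * U k j)) = 0"
        unfolding add[OF that] scale[OF that] comb[OF that] by simp
      then show ?thesis by simp
    qed
    then show "\<exists>a. \<forall>i<r. F i (\<lambda>j. f j - (\<Sum>k<r. a k * U k j)) = 0"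
      by (intro exI[of _ "\<lambda>k. F k f"] allI impI)
  qed
  obtain A where A: "A \<in> GL n" "\<forall>i<r. \<forall>j<n. A $$ (i, j) = U i j"
     "\<forall>i<n. r \<le> i \<longrightarrow> (\<forall>k<r. F k (\<lambda>j. A $$ (i, j)) = 0)"
    using GL_adapted(2)[OF ind cov] by blast
  have "F i (\<lambda>j. A $$ (a, j)) = delta i a" if "a < n" "i < r" for a i
  proof (cases "a < r")
    case True
    have "F i (\<lambda>j. A $$ (a, j)) = F i (U a)" by (rule coords[OF that(2)]) (use A(2) True in simp)
    then show ?thesis using U[OF that(2) True] by simp
  next
    case False
    then show ?thesis using A(3) that by simp
  qed
  then show ?thesis using GL_adapted(1)[OF ind cov] A(1) by blast
qed

lemma tens_alternating:
  fixes d :: "nat \<Rightarrow> nat \<Rightarrow> nat \<Rightarrow> 'a::field"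
  assumes "(2::'a) = 0"
  shows "tens m n (\<lambda>i j k. d i j k + d i k j) w x x = 0"
proof -
  have "tens m n (\<lambda>i j k. d i j k + d i k j) w x x = 2 * (\<Sum>s<m. w s * (\<Sum>j<n. \<Sum>k<n. d s j k * (x j * x k)))"
    unfolding transform_polarized[symmetric] by (simp only: mult_2)
  then show ?thesis by (simp add: assms)
qed

text \<open>\<open>S\<close> models the points over a smaller field: all have rank at most 2, but no
  nonzero linear form vanishes on all of them. If f, g, h vanish at \<open>z\<close> but \<beta> w1
  does not, some \<open>p\<close> in \<open>S\<close> has both \<open>f p\<close> and \<beta> w1 p z
  nonzero; then \<open>w2\<close>, \<open>w3\<close>, \<open>w1\<close> on \<open>v\<close>,
  \<open>w\<close>, \<open>z\<close> give the nonzero minor f(p)^2 \<beta> w1 p z.\<close>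

lemma (in tensor) ternary_alternating_degenerate:
  assumes ta: ternary_alternating
    and minor: "\<And>p w y. S p \<Longrightarrow> minor 3 w y (\<lambda>w y. \<beta> w p y) = 0"
    and S_add: "\<And>p q. S p \<Longrightarrow> S q \<Longrightarrow> S (p + q)"
    and S_span: "\<And>l x. linform l \<Longrightarrow> l x \<noteq> 0 \<Longrightarrow> \<exists>p. S p \<and> l p \<noteq> 0"
  shows corank4
proof -
  obtain w1 w2 w3 w4 f g h u v w where b: "basis4 w1 w2 w3 w4" and lf: "linform f" and lg: "linform g" and lh: "linform h"
    and dual: "f u = 1" "f v = 0" "f w = 0" "g u = 0" "g v = 1" "g w = 0" "h u = 0" "h v = 0" "h w = 1"
    and w2: "\<forall>x y. \<beta> w2 x y = f x * g y + g x * f y" and w3: "\<forall>x y. \<beta> w3 x y = f x * h y + h x * f y"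
    and w4: "\<forall>x y. \<beta> w4 x y = g x * h y + h x * g y"
    using ta unfolding ternary_alternating_def by (elim exE conjE) (rule that)
  have z0: "\<beta> w1 x z = 0" if z: "f z = 0" "g z = 0" "h z = 0" for x z
  proof (rule ccontr)
    assume nz: "\<beta> w1 x z \<noteq> 0"
    define l where "l x = \<beta> w1 x z" for x
    have ll: "linform l" by (auto simp: linform_def l_def lin rad_def sym[of w1 _ z])
    obtain p1 where p1: "S p1" "f p1 \<noteq> 0" using S_span[OF lf, of u] dual by auto
    obtain p2 where p2: "S p2" "l p2 \<noteq> 0" using S_span[OF ll, of x] nz by (auto simp: l_def)
    have fa: "f (x + y) = f x + f y" and la: "l (x + y) = l x + l y" for x y
      using lf ll by (simp_all add: linform_def)
    have "\<exists>p. S p \<and> f p \<noteq> 0 \<and> l p \<noteq> 0"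
    proof (cases "l p1 = 0")
      case False
      then show ?thesis using p1 by blast
    next
      case l1: True
      show ?thesis
      proof (cases "f p2 = 0")
        case False
        then show ?thesis using p2 by blast
      next
        case True
        then show ?thesis using p1 p2 l1 S_add[OF p1(1) p2(1)]
          by (intro exI[of _ "p1 + p2"]) (simp add: fa la)
      qed
    qed
    then obtain p where p: "S p" "f p \<noteq> 0" "l p \<noteq> 0" by blast
    have "minor 3 ((!) [w2, w3, w1]) ((!) [v, w, z]) (\<lambda>w y. \<beta> w p y) = f p * (f p * l p)"
      using dual z w2 w3 unfolding minor_def det3_explicit by (simp add: l_def numeral_2_eq_2)
    with minor[OF p(1)] p show False by simp
  qed
  have zr: "rad z" if z: "f z = 0" "g z = 0" "h z = 0" for z
    unfolding rad_def
  proof (intro allI)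
    fix w' x
    have "spanning4 w1 w2 w3 w4" using b unfolding basis4_def by (rule conjunct1)
    then obtain a1 a2 a3 a4 where "\<forall>x y. \<beta> w' x y = a1 * \<beta> w1 x y + a2 * \<beta> w2 x y + a3 * \<beta> w3 x y + a4 * \<beta> w4 x y"
      unfolding spanning4_def by blast
    from this[rule_format, of x z] show "\<beta> w' x z = 0"
      by (simp only: z0[OF z] w2[rule_format] w3[rule_format] w4[rule_format] z mult_zero_right mult_zero_left add_0_right)
  qed
  \<comment> \<open>The radical has codimension at most three; the zero summand only fills the
    fourth place of \<open>corank4\<close>.\<close>
  have "\<beta> w' x y = f y * \<beta> w' x u + g y * \<beta> w' x v + h y * \<beta> w' x w + 0 * \<beta> w' x w" for w' x y
  proof -
    define z where "z = y - (vs (f y) u + vs (g y) v + vs (h y) w)"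
    have L: "k z = k y - (f y * k u + g y * k v + h y * k w)" if "linform k" for k
    proof -
      have add: "k (a + b) = k a + k b" and sc: "k (vs c a) = c * k a" for a b c
        using that by (simp_all add: linform_def)
      have "k (a - b) = k a - k b" for a b using add[of "a - b" b] by simp
      then show ?thesis by (simp add: z_def add sc)
    qed
    have "rad z" by (rule zr) (simp_all add: L lf lg lh dual)
    then have "\<beta> w' x z = 0" unfolding rad_def by blast
    then have "\<beta> w' x y - (f y * \<beta> w' x u + g y * \<beta> w' x v + h y * \<beta> w' x w) = 0"
      unfolding z_def lin .
    then show ?thesis by (simp only: right_minus_eq mult_zero_left add_0_right)
  qed
  then show ?thesis unfolding corank4_def by blast
qed

section \<open>Normal forms of quadratic maps\<close>

locale quadratic_map =
  fixes m n :: nat and H :: "'a::field mpoly vec" and d :: "nat \<Rightarrow> nat \<Rightarrow> nat \<Rightarrow> 'a"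
  assumes dim_H: "dim_vec H = m" and H: "i < m \<Longrightarrow> H $ i = quadratic_form n (d i)"
begin

text \<open>The second partial derivatives of the components; in characteristic 2 those with
  \<open>j = k\<close> vanish.\<close>

definition "c i j k = d i j k + d i k j"

lemma c_sym: "c i j k = c i k j" by (simp add: c_def add.commute)

lemma pderiv_H: "i < m \<Longrightarrow> j < n \<Longrightarrow> pderiv_mpoly j (H $ i) = generic n c i j"
  by (simp add: H pderiv_quadratic_form generic_def c_def)

lemma jacobian_rank_le_iff:
  "jacobian_rank n H \<le> r \<longleftrightarrow> rank_le r {..<m} {..<n} (\<lambda>i j. to_fract (generic n c i j))"
proof -
  have "jacobian_rank n H \<le> r \<longleftrightarrow> rank_le r {..<m} {..<n} (\<lambda>i j. map_mat to_fract (jacobian n H) $$ (i, j))"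
    unfolding jacobian_rank_def dim_H
    by (rule rank_le_mat_iff) (simp add: jacobian_def dim_H)
  also have "\<dots> \<longleftrightarrow> rank_le r {..<m} {..<n} (\<lambda>i j. to_fract (generic n c i j))"
    by (rule rank_le_cong) (simp add: jacobian_def dim_H pderiv_H)
  finally show ?thesis .
qed

lemma frame_at_point:
  fixes h :: "'a \<Rightarrow> 'e::field"
  assumes h: "comm_ring_hom h" and rk: "jacobian_rank n H \<le> 3"
    and ab: "\<And>k. k \<le> 2 \<Longrightarrow> a k \<in> {..<m}" "\<And>k. k \<le> 2 \<Longrightarrow> b k \<in> {..<n}"
    and nz: "minor 3 a b (\<lambda>i j. \<Sum>k<n. h (c i j k) * p k) \<noteq> 0"
  shows "\<exists>e1 e2 e3 q1 q2 q3. framed_tensor fscale fscale (tens m n (\<lambda>i j k. h (c i j k))) p e1 e2 e3 q1 q2 q3"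
proof -
  interpret rank_le_3_tensor fscale fscale "tens m n (\<lambda>i j k. h (c i j k))"
    by (rule rank_le_3_tensor_hom[OF h]) (use c_sym rk jacobian_rank_le_iff in auto)
  have "minor 3 (\<lambda>k. delta (a k)) (\<lambda>k. delta (b k)) (\<lambda>w y. tens m n (\<lambda>i j k. h (c i j k)) w p y) =
      minor 3 a b (\<lambda>i j. \<Sum>k<n. h (c i j k) * p k)"
  proof (rule minor_cong)
    fix k l :: nat assume "k < 3" "l < 3"
    then have "a k < m" "b l < n" using ab[of k] ab[of l] by auto
    then show "tens m n (\<lambda>i j k. h (c i j k)) (delta (a k)) p (delta (b l)) = (\<Sum>k'<n. h (c (a k) (b l) k') * p k')"
      by (intro tens_delta_point) (rule arg_cong[where f=h], rule c_sym)
  qed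
  with nz have "minor 3 (\<lambda>k. delta (a k)) (\<lambda>k. delta (b k)) (\<lambda>w y. tens m n (\<lambda>i j k. h (c i j k)) w p y) \<noteq> 0"
    by (simp only: not_False_eq_True)
  from frame_from_minor[OF this] show ?thesis by blast
qed

text \<open>\<open>A\<close> is the transpose of the matrix of the substitution, so its rows are the
  images of the unit vectors and can be prescribed as vectors.\<close>

definition "tr S A = linear_transform n S (transpose_mat A) H"
definition "T S A i a b = tens m n c (\<lambda>s. S $$ (i, s)) (\<lambda>j. A $$ (a, j)) (\<lambda>k. A $$ (b, k))"

context
  fixes S A :: "'a mat" assumes S: "S \<in> GL m" and A: "A \<in> GL n"
begin

lemma dim_tr: "dim_vec (tr S A) = m"
  using S by (auto simp: tr_def linear_transform_def GL_def)

text \<open>The symmetrization \<open>T\<close> need not determine the polynomial, so an unspecified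
  array \<open>e\<close> is carried along; derivatives depend on \<open>T\<close> alone.\<close>

lemma tr_quadratic:
  assumes "i < m"
  shows "\<exists>e. tr S A $ i = quadratic_form n e \<and> (\<forall>a b. e a b + e b a = T S A i a b)"
proof (intro exI conjI allI)
  show "tr S A $ i = quadratic_form n (\<lambda>a b. \<Sum>s<m. S $$ (i, s) * (\<Sum>j<n. \<Sum>k<n. d s j k * (A $$ (a, j) * A $$ (b, k))))"
    unfolding tr_def by (rule transform_component[OF dim_H H _ _ assms]) (use S A in \<open>simp_all add: GL_def\<close>)
  show "(\<Sum>s<m. S $$ (i, s) * (\<Sum>j<n. \<Sum>k<n. d s j k * (A $$ (a, j) * A $$ (b, k)))) +
    (\<Sum>s<m. S $$ (i, s) * (\<Sum>j<n. \<Sum>k<n. d s j k * (A $$ (b, j) * A $$ (a, k)))) = T S A i a b" for a b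
    unfolding T_def c_def[abs_def] by (rule transform_polarized)
qed

lemma pderiv_tr:
  assumes "i < m" "a < n"
  shows "pderiv_mpoly a (tr S A $ i) = (\<Sum>b<n. Const (T S A i a b) * X b)"
proof -
  obtain e where e: "tr S A $ i = quadratic_form n e" "\<forall>a b. e a b + e b a = T S A i a b"
    using tr_quadratic[OF assms(1)] by blast
  show ?thesis unfolding e(1) pderiv_quadratic_form[OF assms(2)] e(2)[rule_format] ..
qed

lemma tr_half:
  assumes "(2::'a) \<noteq> 0" "i < m"
  shows "tr S A $ i = quadratic_form n (\<lambda>a b. T S A i a b / 2)"
proof -
  obtain e where e: "tr S A $ i = quadratic_form n e" "\<forall>a b. e a b + e b a = T S A i a b"
    using tr_quadratic[OF assms(2)] by blast
  show ?thesis unfolding e(1) quadratic_form_half[OF assms(1), of n e] e(2)[rule_format] ..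
qed

lemma only_first_rows_tr:
  assumes "\<And>i x y. i < m \<Longrightarrow> r \<le> i \<Longrightarrow> tens m n c (\<lambda>s. S $$ (i, s)) x y = 0"
  shows "only_first_rows r (jacobian n (tr S A))"
  unfolding only_first_rows_def
proof (intro allI impI)
  fix i assume "i < dim_row (jacobian n (tr S A))" and r: "r \<le> i"
  then have i: "i < m" by (simp add: jacobian_def dim_tr)
  show "row (jacobian n (tr S A)) i = 0\<^sub>v (dim_col (jacobian n (tr S A)))"
    by (rule eq_vecI) (use i r in \<open>simp_all add: jacobian_def dim_tr pderiv_tr T_def assms\<close>)
qed

lemma only_first_cols_tr:
  assumes "\<And>a w y. a < n \<Longrightarrow> r \<le> a \<Longrightarrow> tens m n c w (\<lambda>j. A $$ (a, j)) y = 0"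
  shows "only_first_cols r (jacobian n (tr S A))"
  unfolding only_first_cols_def
proof (intro allI impI)
  fix a assume "a < dim_col (jacobian n (tr S A))" and r: "r \<le> a"
  then have a: "a < n" by (simp add: jacobian_def)
  show "col (jacobian n (tr S A)) a = 0\<^sub>v (dim_row (jacobian n (tr S A)))"
    by (rule eq_vecI) (use a r in \<open>simp_all add: jacobian_def dim_tr pderiv_tr T_def assms\<close>)
qed

end

lemma one_GL: "1\<^sub>m k \<in> GL k"
  unfolding GL_def invertible_mat_def inverts_mat_def by (auto intro!: exI[of _ "1\<^sub>m k"])

lemma case1_exists:
  assumes "rank_le 3 ({..<n} \<times> {..<n}) {..<m} (\<lambda>(j, k) i. c i j k)"
  shows "\<exists>S\<in>GL m. \<exists>A\<in>GL n. case1 n (tr S A)"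
proof -
  obtain S where S: "S \<in> GL m"
    and Z: "\<forall>s<m. 3 \<le> s \<longrightarrow> (\<forall>p\<in>{..<n} \<times> {..<n}. (\<Sum>i<m. (case p of (j, k) \<Rightarrow> \<lambda>i. c i j k) i * S $$ (s, i)) = 0)"
    using GL_kernel[OF assms] by (rule bexE)
  have "only_first_rows 3 (jacobian n (tr S (1\<^sub>m n)))"
  proof (rule only_first_rows_tr[OF S one_GL])
    fix i x y assume i: "i < m" "3 \<le> i"
    have "(\<Sum>s<m. c s j k * S $$ (i, s)) = 0" if "j < n" "k < n" for j k
      using Z[rule_format, OF i, of "(j, k)"] that by simp
    then show "tens m n c (\<lambda>s. S $$ (i, s)) x y = 0" unfolding tens_contract_w by (intro sum.neutral ballI) simp
  qed
  then show ?thesis unfolding case1_def using S one_GL by blast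
qed

lemma cols_exist:
  assumes "rank_le r ({..<m} \<times> {..<n}) {..<n} (\<lambda>(i, k) j. c i k j)"
  shows "\<exists>S\<in>GL m. \<exists>A\<in>GL n. only_first_cols r (jacobian n (tr S A))"
proof -
  obtain A where A: "A \<in> GL n"
    and Z: "\<forall>a<n. r \<le> a \<longrightarrow> (\<forall>p\<in>{..<m} \<times> {..<n}. (\<Sum>j<n. (case p of (i, k) \<Rightarrow> \<lambda>j. c i k j) j * A $$ (a, j)) = 0)"
    using GL_kernel[OF assms] by (rule bexE)
  have "only_first_cols r (jacobian n (tr (1\<^sub>m m) A))"
  proof (rule only_first_cols_tr[OF one_GL A])
    fix a w y assume a: "a < n" "r \<le> a"
    have "(\<Sum>j<n. c i j k * A $$ (a, j)) = 0" if "i < m" "k < n" for i k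
      using Z[rule_format, OF a, of "(i, k)"] that by (simp add: c_sym[of i _ k])
    then show "tens m n c w (\<lambda>j. A $$ (a, j)) y = 0" unfolding tens_contract_v by (intro sum.neutral ballI) simp
  qed
  then show ?thesis using A one_GL by blast
qed

sublocale K: tensor fscale fscale "tens m n c"
  by (rule tens_tensor) (rule c_sym)

text \<open>The common part of cases 2, 3 and 4: \<open>S\<close> starts with the four basis forms
  and continues with elements whose form is zero, and the rows of \<open>A\<close> turn the given
  functionals into coordinates.\<close>

lemma adapted_bases:
  assumes b: "K.basis4 w1 w2 w3 w4"
    and F: "\<And>i. i < r \<Longrightarrow> K.linform (F i)" "\<And>i k. i < r \<Longrightarrow> k < r \<Longrightarrow> F i (U k) = delta i k"
  obtains S A where "4 \<le> m" "r \<le> n" "S \<in> GL m" "A \<in> GL n" "only_first_rows 4 (jacobian n (tr S A))"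
    "\<And>i a. a < n \<Longrightarrow> i < r \<Longrightarrow> F i (\<lambda>j. A $$ (a, j)) = delta i a"
    "\<And>i a b. i < 4 \<Longrightarrow> T S A i a b = tens m n c ([w1, w2, w3, w4] ! i) (\<lambda>j. A $$ (a, j)) (\<lambda>j. A $$ (b, j))"
proof -
  have m: "4 \<le> m" and "\<exists>S\<in>GL m. (\<forall>s<4. \<forall>i<m. S $$ (s, i) = ([w1, w2, w3, w4] ! s) i) \<and>
      (\<forall>s<m. 4 \<le> s \<longrightarrow> (\<forall>x y. tens m n c (\<lambda>i. S $$ (s, i)) x y = 0))"
    using GL_basis4[OF c_sym b] by blast+
  then obtain S where S: "S \<in> GL m" "\<forall>s<4. \<forall>i<m. S $$ (s, i) = ([w1, w2, w3, w4] ! s) i"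
    "\<forall>s<m. 4 \<le> s \<longrightarrow> (\<forall>x y. tens m n c (\<lambda>i. S $$ (s, i)) x y = 0)" by blast
  have r: "r \<le> n" and "\<exists>A\<in>GL n. \<forall>a<n. \<forall>i<r. F i (\<lambda>j. A $$ (a, j)) = delta i a"
    using GL_dual[OF c_sym F] by blast+
  then obtain A where A: "A \<in> GL n" "\<forall>a<n. \<forall>i<r. F i (\<lambda>j. A $$ (a, j)) = delta i a" by blast
  have "only_first_rows 4 (jacobian n (tr S A))"
    by (rule only_first_rows_tr[OF S(1) A(1)]) (use S(3) in simp)
  moreover have "T S A i a b = tens m n c ([w1, w2, w3, w4] ! i) (\<lambda>j. A $$ (a, j)) (\<lambda>j. A $$ (b, j))" if "i < 4" for i a b
    unfolding T_def tens_w by (intro sum.cong refl) (use S(2) that in simp)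
  ultimately show thesis using that[OF m r S(1) A(1)] A(2) by blast
qed

lemma case2_exists:
  assumes two: "(2::'a) \<noteq> 0" and K.binary_squares
  shows "\<exists>S\<in>GL m. \<exists>A\<in>GL n. case2 n (tr S A)"
proof -
  obtain w1 w2 w3 w4 f g u v where b: "K.basis4 w1 w2 w3 w4" and l: "K.linform f" "K.linform g"
    and dual: "f u = 1" "f v = 0" "g u = 0" "g v = 1"
    and w2: "\<forall>x y. tens m n c w2 x y = f x * f y" and w3: "\<forall>x y. tens m n c w3 x y = f x * g y + g x * f y"
    and w4: "\<forall>x y. tens m n c w4 x y = g x * g y"
    using assms(2) unfolding K.binary_squares_def by (elim exE conjE) (rule that)
  have 2: "i = 0 \<or> i = 1" if "i < 2" for i :: nat using that by auto
  obtain S A where m: "4 \<le> m" "2 \<le> n" and SA: "S \<in> GL m" "A \<in> GL n" and R: "only_first_rows 4 (jacobian n (tr S A))"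
    and D: "\<And>i a. a < n \<Longrightarrow> i < 2 \<Longrightarrow> ([f, g] ! i) (\<lambda>j. A $$ (a, j)) = delta i a"
    and T: "\<And>i a b. i < 4 \<Longrightarrow> T S A i a b = tens m n c ([w1, w2, w3, w4] ! i) (\<lambda>j. A $$ (a, j)) (\<lambda>j. A $$ (b, j))"
  proof (rule adapted_bases[OF b, where r=2 and F="(!) [f, g]" and U="(!) [u, v]"])
    fix i k :: nat assume i: "i < 2"
    show "K.linform ([f, g] ! i)" using 2[OF i] l by (elim disjE) simp_all
    assume k: "k < 2"
    show "([f, g] ! i) ([u, v] ! k) = delta i k"
      using 2[OF i] 2[OF k] dual by (elim disjE) simp_all
  qed (rule that)
  have fg: "f (\<lambda>j. A $$ (a, j)) = delta 0 a" "g (\<lambda>j. A $$ (a, j)) = delta 1 a" if "a < n" for a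
    using D[OF that, of 0] D[OF that, of 1] by simp_all
  note th = tr_half[OF SA two]
  have half: "Const (1/2) + Const (1/2) = (1 :: 'a mpoly)"
    using two by (simp flip: Const.hom_add)
  have "tr S A $ 1 = quadratic_form n (\<lambda>a b. (1/2) * (delta 0 a * delta 0 b))"
    by (subst th) (use m in \<open>auto simp: T w2[rule_format] fg intro!: quadratic_form_cong\<close>)
  also have "\<dots> = Const (1/2) * X 0 ^ 2"
    using m by (simp only: quadratic_form_scale quadratic_form_delta power2_eq_square)
  finally have t1: "tr S A $ 1 = Const (1/2) * X 0 ^ 2" .
  have "tr S A $ 2 = quadratic_form n (\<lambda>a b. (1/2) * (delta 0 a * delta 1 b) + (1/2) * (delta 1 a * delta 0 b))"
    by (subst th) (use m in \<open>auto simp: T w3[rule_format] fg intro!: quadratic_form_cong\<close>)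
  also have "\<dots> = (Const (1/2) + Const (1/2)) * (X 0 * X 1)"
    using m by (simp only: quadratic_form_add quadratic_form_scale quadratic_form_delta distrib_right mult.commute[of "X 1"])
  finally have t2: "tr S A $ 2 = X 0 * X 1" unfolding half by simp
  have "tr S A $ 3 = quadratic_form n (\<lambda>a b. (1/2) * (delta 1 a * delta 1 b))"
    by (subst th) (use m in \<open>auto simp: T w4[rule_format] fg intro!: quadratic_form_cong\<close>)
  also have "\<dots> = Const (1/2) * X 1 ^ 2"
    using m by (simp only: quadratic_form_scale quadratic_form_delta power2_eq_square)
  finally have t3: "tr S A $ 3 = Const (1/2) * X 1 ^ 2" .
  have "case2 n (tr S A)"
    unfolding case2_def dim_tr[OF SA] t1 t2 t3 CHAR_eq_2_iff using m two R by blast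
  then show ?thesis using SA by blast
qed

lemma case4_exists:
  assumes two: "(2::'a) \<noteq> 0" and K.norm_product
  shows "\<exists>S\<in>GL m. \<exists>A\<in>GL n. case4 n (tr S A)"
proof -
  obtain e w1 w2 w3 w4 f1 f2 f3 f4 u1 u2 u3 u4 where e: "e \<noteq> 0" and b: "K.basis4 w1 w2 w3 w4"
    and w1: "\<forall>x y. tens m n c w1 x y = f1 x * f3 y + f3 x * f1 y + e * (f2 x * f4 y + f4 x * f2 y)"
    and w2: "\<forall>x y. tens m n c w2 x y = f2 x * f3 y + f3 x * f2 y - (f1 x * f4 y + f4 x * f1 y)"
    and w3: "\<forall>x y. tens m n c w3 x y = f3 x * f3 y + e * (f4 x * f4 y)"
    and w4: "\<forall>x y. tens m n c w4 x y = f1 x * f1 y + e * (f2 x * f2 y)"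
    and l: "K.linform f1" "K.linform f2" "K.linform f3" "K.linform f4"
    and dual: "f1 u1 = 1" "f1 u2 = 0" "f1 u3 = 0" "f1 u4 = 0" "f2 u1 = 0" "f2 u2 = 1" "f2 u3 = 0" "f2 u4 = 0"
      "f3 u1 = 0" "f3 u2 = 0" "f3 u3 = 1" "f3 u4 = 0" "f4 u1 = 0" "f4 u2 = 0" "f4 u3 = 0" "f4 u4 = 1"
    using assms(2) unfolding K.norm_product_def by (elim exE conjE) (rule that)
  have 4: "i = 0 \<or> i = 1 \<or> i = 2 \<or> i = 3" if "i < 4" for i :: nat using that by auto
  obtain S A where m: "4 \<le> m" "4 \<le> n" and SA: "S \<in> GL m" "A \<in> GL n" and R: "only_first_rows 4 (jacobian n (tr S A))"
    and D: "\<And>i a. a < n \<Longrightarrow> i < 4 \<Longrightarrow> ([f1, f2, f3, f4] ! i) (\<lambda>j. A $$ (a, j)) = delta i a"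
    and T: "\<And>i a b. i < 4 \<Longrightarrow> T S A i a b = tens m n c ([w1, w2, w3, w4] ! i) (\<lambda>j. A $$ (a, j)) (\<lambda>j. A $$ (b, j))"
  proof (rule adapted_bases[OF b, where r=4 and F="(!) [f1, f2, f3, f4]" and U="(!) [u1, u2, u3, u4]"])
    fix i k :: nat assume i: "i < 4"
    show "K.linform ([f1, f2, f3, f4] ! i)" using 4[OF i] l by (elim disjE) (simp_all add: numeral_2_eq_2 numeral_3_eq_3)
    assume k: "k < 4"
    show "([f1, f2, f3, f4] ! i) ([u1, u2, u3, u4] ! k) = delta i k"
      using 4[OF i] 4[OF k] dual by (elim disjE) (simp_all add: numeral_2_eq_2 numeral_3_eq_3)
  qed (rule that)
  have f: "f1 (\<lambda>j. A $$ (a, j)) = delta 0 a" "f2 (\<lambda>j. A $$ (a, j)) = delta 1 a"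
      "f3 (\<lambda>j. A $$ (a, j)) = delta 2 a" "f4 (\<lambda>j. A $$ (a, j)) = delta 3 a" if "a < n" for a
    using D[OF that, of 0] D[OF that, of 1] D[OF that, of 2] D[OF that, of 3] by (simp_all add: numeral_2_eq_2 numeral_3_eq_3)
  note th = tr_half[OF SA two]
  have half: "Const (1/2) + Const (1/2) = (1 :: 'a mpoly)" "Const (e/2) + Const (e/2) = (Const e :: 'a mpoly)"
    using two by (simp_all flip: Const.hom_add)
  have n: "0 < n" "1 < n" "2 < n" "3 < n" and m': "0 < m" "1 < m" "2 < m" "3 < m" using m by simp_all
  note Q = quadratic_form_add quadratic_form_minus quadratic_form_scale
    quadratic_form_delta[OF n(1) n(1)] quadratic_form_delta[OF n(2) n(2)] quadratic_form_delta[OF n(3) n(3)] quadratic_form_delta[OF n(4) n(4)]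
    quadratic_form_delta[OF n(1) n(3)] quadratic_form_delta[OF n(3) n(1)] quadratic_form_delta[OF n(2) n(4)] quadratic_form_delta[OF n(4) n(2)]
    quadratic_form_delta[OF n(2) n(3)] quadratic_form_delta[OF n(3) n(2)] quadratic_form_delta[OF n(1) n(4)] quadratic_form_delta[OF n(4) n(1)]
  have "tr S A $ 0 = quadratic_form n (\<lambda>a b. (1/2) * (delta 0 a * delta 2 b) + (1/2) * (delta 2 a * delta 0 b) +
      ((e/2) * (delta 1 a * delta 3 b) + (e/2) * (delta 3 a * delta 1 b)))"
    unfolding th[OF m'(1)]
    by (rule quadratic_form_cong) (simp only: T f w1[rule_format] nth_Cons_0 zero_less_numeral times_divide_eq_left mult_1_left add_divide_distrib distrib_left)
  also have "\<dots> = (Const (1/2) + Const (1/2)) * (X 0 * X 2) + (Const (e/2) + Const (e/2)) * (X 1 * X 3)"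
    by (simp only: Q distrib_right mult.commute[of "X 2" "X 0"] mult.commute[of "X 3" "X 1"])
  finally have t0: "tr S A $ 0 = X 0 * X 2 + Const e * X 1 * X 3" unfolding half by (simp add: mult.assoc)
  have "tr S A $ 1 = quadratic_form n (\<lambda>a b. (1/2) * (delta 1 a * delta 2 b) + (1/2) * (delta 2 a * delta 1 b) -
      ((1/2) * (delta 0 a * delta 3 b) + (1/2) * (delta 3 a * delta 0 b)))"
    unfolding th[OF m'(2)]
    by (rule quadratic_form_cong) (simp add: T f w2[rule_format] add_divide_distrib diff_divide_distrib)
  also have "\<dots> = (Const (1/2) + Const (1/2)) * (X 1 * X 2) - (Const (1/2) + Const (1/2)) * (X 0 * X 3)"
    by (simp only: Q distrib_right mult.commute[of "X 2" "X 1"] mult.commute[of "X 3" "X 0"])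
  finally have t1: "tr S A $ 1 = X 1 * X 2 - X 0 * X 3" unfolding half by simp
  have "tr S A $ 2 = quadratic_form n (\<lambda>a b. (1/2) * (delta 2 a * delta 2 b) + (e/2) * (delta 3 a * delta 3 b))"
    unfolding th[OF m'(3)]
    by (rule quadratic_form_cong) (simp add: T f w3[rule_format] add_divide_distrib)
  also have "\<dots> = Const (1/2) * X 2 ^ 2 + Const (e/2) * X 3 ^ 2"
    by (simp only: Q power2_eq_square)
  finally have t2: "tr S A $ 2 = Const (1/2) * X 2 ^ 2 + Const (e/2) * X 3 ^ 2" .
  have "tr S A $ 3 = quadratic_form n (\<lambda>a b. (1/2) * (delta 0 a * delta 0 b) + (e/2) * (delta 1 a * delta 1 b))"
    unfolding th[OF m'(4)]
    by (rule quadratic_form_cong) (simp add: T f w4[rule_format] add_divide_distrib)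
  also have "\<dots> = Const (1/2) * X 0 ^ 2 + Const (e/2) * X 1 ^ 2"
    by (simp only: Q power2_eq_square)
  finally have t3: "tr S A $ 3 = Const (1/2) * X 0 ^ 2 + Const (e/2) * X 1 ^ 2" .
  have "case4 n (tr S A)"
    unfolding case4_def dim_tr[OF SA] CHAR_eq_2_iff
    by (intro conjI m two R exI[of _ e] e) (simp only: t0 t1 t2 t3)
  then show ?thesis using SA by blast
qed

lemma case3_exists:
  assumes two: "(2::'a) = 0" and K.ternary_alternating
  shows "\<exists>S\<in>GL m. \<exists>A\<in>GL n. case3 n (tr S A)"
proof -
  obtain w1 w2 w3 w4 f1 f2 f3 u1 u2 u3 where b: "K.basis4 w1 w2 w3 w4"
    and l: "K.linform f1" "K.linform f2" "K.linform f3"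
    and dual: "f1 u1 = 1" "f1 u2 = 0" "f1 u3 = 0" "f2 u1 = 0" "f2 u2 = 1" "f2 u3 = 0" "f3 u1 = 0" "f3 u2 = 0" "f3 u3 = 1"
    and w2: "\<forall>x y. tens m n c w2 x y = f1 x * f2 y + f2 x * f1 y"
    and w3: "\<forall>x y. tens m n c w3 x y = f1 x * f3 y + f3 x * f1 y"
    and w4: "\<forall>x y. tens m n c w4 x y = f2 x * f3 y + f3 x * f2 y"
    using assms(2) unfolding K.ternary_alternating_def by (elim exE conjE) (rule that)
  have 3: "i = 0 \<or> i = 1 \<or> i = 2" if "i < 3" for i :: nat using that by auto
  obtain S A where m: "4 \<le> m" "3 \<le> n" and SA: "S \<in> GL m" "A \<in> GL n" and R: "only_first_rows 4 (jacobian n (tr S A))"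
    and D: "\<And>i a. a < n \<Longrightarrow> i < 3 \<Longrightarrow> ([f1, f2, f3] ! i) (\<lambda>j. A $$ (a, j)) = delta i a"
    and T: "\<And>i a b. i < 4 \<Longrightarrow> T S A i a b = tens m n c ([w1, w2, w3, w4] ! i) (\<lambda>j. A $$ (a, j)) (\<lambda>j. A $$ (b, j))"
  proof (rule adapted_bases[OF b, where r=3 and F="(!) [f1, f2, f3]" and U="(!) [u1, u2, u3]"])
    fix i k :: nat assume i: "i < 3"
    show "K.linform ([f1, f2, f3] ! i)" using 3[OF i] l by (elim disjE) (simp_all add: numeral_2_eq_2)
    assume k: "k < 3"
    show "([f1, f2, f3] ! i) ([u1, u2, u3] ! k) = delta i k"
      using 3[OF i] 3[OF k] dual by (elim disjE) (simp_all add: numeral_2_eq_2)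
  qed (rule that)
  have f: "f1 (\<lambda>j. A $$ (a, j)) = delta 0 a" "f2 (\<lambda>j. A $$ (a, j)) = delta 1 a" "f3 (\<lambda>j. A $$ (a, j)) = delta 2 a" if "a < n" for a
    using D[OF that, of 0] D[OF that, of 1] D[OF that, of 2] by (simp_all add: numeral_2_eq_2)
  have n: "0 < n" "1 < n" "2 < n" and m': "1 < m" "2 < m" "3 < m" using m by simp_all
  \<comment> \<open>Squares in the transformed components leave no trace in \<open>T\<close>, so
    only partial derivatives are compared.\<close>
  have S2: "(\<Sum>b<n. Const (delta p a * delta q b + delta q a * delta p b) * X b) = pderiv_mpoly a (X p * X q :: 'a mpoly)"
    if "p < n" "q < n" for p q a
  proof -
    have "(\<Sum>b<n. Const (delta p a * delta q b + delta q a * delta p b) * X b) =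
        Const (delta p a) * (\<Sum>b<n. Const (delta q b) * X b) + Const (delta q a) * (\<Sum>b<n. Const (delta p b :: 'a) * X b)"
      by (simp only: Const.hom_add Const.hom_mult distrib_right sum.distrib sum_distrib_left mult.assoc)
    then show ?thesis unfolding sum_Const_delta_X[OF that(1)] sum_Const_delta_X[OF that(2)] pderiv_mpoly_X_mult_X
      by simp
  qed
  note pt = pderiv_tr[OF SA]
  have t: "pderiv_mpoly a (tr S A $ 1) = pderiv_mpoly a (X 0 * X 1)" "pderiv_mpoly a (tr S A $ 2) = pderiv_mpoly a (X 0 * X 2)"
     "pderiv_mpoly a (tr S A $ 3) = pderiv_mpoly a (X 1 * X 2)" if a: "a < n" for a
  proof -
    have s: "T S A 1 a b = delta 0 a * delta 1 b + delta 1 a * delta 0 b"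
      "T S A 2 a b = delta 0 a * delta 2 b + delta 2 a * delta 0 b"
      "T S A 3 a b = delta 1 a * delta 2 b + delta 2 a * delta 1 b" if b: "b < n" for b
      using T[of 1 a b] T[of 2 a b] T[of 3 a b] w2 w3 w4 f[OF a] f[OF b] by simp_all
    show "pderiv_mpoly a (tr S A $ 1) = pderiv_mpoly a (X 0 * X 1)"
      unfolding pt[OF m'(1) a] S2[OF n(1) n(2), symmetric] by (intro sum.cong refl) (simp only: s lessThan_iff)
    show "pderiv_mpoly a (tr S A $ 2) = pderiv_mpoly a (X 0 * X 2)"
      unfolding pt[OF m'(2) a] S2[OF n(1) n(3), symmetric] by (intro sum.cong refl) (simp only: s lessThan_iff)
    show "pderiv_mpoly a (tr S A $ 3) = pderiv_mpoly a (X 1 * X 2)"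
      unfolding pt[OF m'(3) a] S2[OF n(2) n(3), symmetric] by (intro sum.cong refl) (simp only: s lessThan_iff)
  qed
  have J: "jacobian n (vec_of_list [tr S A $ 0, tr S A $ 1, tr S A $ 2, tr S A $ 3]) =
      jacobian n (vec_of_list [tr S A $ 0, X 0 * X 1, X 0 * X 2, X 1 * X 2])"
  proof (rule eq_matI)
    fix i j assume "i < dim_row (jacobian n (vec_of_list [tr S A $ 0, X 0 * X 1, X 0 * X 2, X 1 * X 2]))"
      and "j < dim_col (jacobian n (vec_of_list [tr S A $ 0, X 0 * X 1, X 0 * X 2, X 1 * X 2]))"
    then have i: "i < 4" and j: "j < n" by (simp_all add: jacobian_def)
    from i consider "i = 0" | "i = 1" | "i = 2" | "i = 3" by linarith
    then show "jacobian n (vec_of_list [tr S A $ 0, tr S A $ 1, tr S A $ 2, tr S A $ 3]) $$ (i, j) =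
      jacobian n (vec_of_list [tr S A $ 0, X 0 * X 1, X 0 * X 2, X 1 * X 2]) $$ (i, j)"
      by cases (use j t[OF j] in \<open>simp_all add: jacobian_def vec_of_list_index numeral_2_eq_2 numeral_3_eq_3\<close>)
  qed (simp_all add: jacobian_def)
  have "case3 n (tr S A)"
    unfolding case3_def dim_tr[OF SA] CHAR_eq_2_iff using m two R J by blast
  then show ?thesis using SA by blast
qed

end

lemma add_self_zero:
  fixes p :: "'a::comm_ring_1 mpoly"
  assumes "(2::'a) = 0"
  shows "p + p = 0"
proof -
  have "(2 :: 'a mpoly) = Const 2" using Const.hom_add[of "1::'a" 1] by (simp only: one_add_one Const.hom_one)
  then show ?thesis unfolding mult_2[symmetric] assms Const.hom_zero by (simp only: mult_zero_left)
qed

context quadratic_map begin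

section \<open>Existence of the normal forms\<close>

lemma forward_odd:
  assumes two: "(2::'a) \<noteq> 0" and rk: "jacobian_rank n H \<le> 3"
    and ab: "\<And>k. k \<le> 2 \<Longrightarrow> a k \<in> {..<m}" "\<And>k. k \<le> 2 \<Longrightarrow> b k \<in> {..<n}" and nz: "minor 3 a b (generic n c) \<noteq> 0"
  shows "\<exists>S\<in>GL m. \<exists>A\<in>GL n. case1 n (tr S A) \<or> case2 n (tr S A) \<or> case4 n (tr S A) \<or> case5 n (tr S A)"
proof -
  obtain p where p: "minor 3 a b (\<lambda>i j. \<Sum>k<n. c i j k * p k) \<noteq> 0"
    using minor3_point[OF two nz] by (rule exE)
  have id: "comm_ring_hom (\<lambda>x::'a. x)" by unfold_locales simp_all
  obtain e1 e2 e3 q1 q2 q3 where "framed_tensor fscale fscale (tens m n c) p e1 e2 e3 q1 q2 q3"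
    using frame_at_point[OF id rk ab p] by blast
  then interpret F: framed_tensor fscale fscale "tens m n c" p e1 e2 e3 q1 q2 q3 .
  from F.rank_3_cases_odd[OF two] consider "K.spanned3" | "K.corank3" | "K.binary_squares" | "K.norm_product" by blast
  then show ?thesis
  proof cases
    case 1
    show ?thesis using case1_exists[OF rank_le_if_spanned3[OF c_sym 1]] by blast
  next
    case 2
    show ?thesis using cols_exist[OF rank_le_if_corank3[OF c_sym 2]] two unfolding case5_def CHAR_eq_2_iff by blast
  next
    case 3
    show ?thesis using case2_exists[OF two 3] by blast
  next
    case 4
    show ?thesis using case4_exists[OF two 4] by blast
  qed
qed

lemma forward_even_point:
  assumes two: "(2::'a) = 0" and rk: "jacobian_rank n H \<le> 3"
    and ab: "\<And>k. k \<le> 2 \<Longrightarrow> a k \<in> {..<m}" "\<And>k. k \<le> 2 \<Longrightarrow> b k \<in> {..<n}"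
    and p: "minor 3 a b (\<lambda>i j. \<Sum>k<n. c i j k * p k) \<noteq> 0"
  shows "\<exists>S\<in>GL m. \<exists>A\<in>GL n. case1 n (tr S A) \<or> case3 n (tr S A) \<or> case6 n (tr S A)"
proof -
  have id: "comm_ring_hom (\<lambda>x::'a. x)" by unfold_locales simp_all
  obtain e1 e2 e3 q1 q2 q3 where "framed_tensor fscale fscale (tens m n c) p e1 e2 e3 q1 q2 q3"
    using frame_at_point[OF id rk ab p] by blast
  then interpret F: framed_tensor fscale fscale "tens m n c" p e1 e2 e3 q1 q2 q3 .
  have alt: "tens m n c w x x = 0" for w x
    using tens_alternating[OF two, of m n d w x] by (simp only: c_def[abs_def])
  from F.rank_3_cases_even[OF alt two] consider "K.spanned3" | "K.corank4" | "K.ternary_alternating" by blast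
  then show ?thesis
  proof cases
    case 1
    show ?thesis using case1_exists[OF rank_le_if_spanned3[OF c_sym 1]] by blast
  next
    case 2
    show ?thesis using cols_exist[OF rank_le_if_corank4[OF c_sym 2]] two unfolding case6_def CHAR_eq_2_iff by blast
  next
    case 3
    show ?thesis using case3_exists[OF two 3] by blast
  qed
qed

text \<open>Over small fields there may be no \<open>K\<close>-point of rank 3; the generic point is then used instead,
  over the field of rational functions. The third outcome cannot occur there, because it would
  yield a \<open>K\<close>-point of rank 3.\<close>

lemma forward_even_no_point:
  assumes two: "(2::'a) = 0" and rk: "jacobian_rank n H \<le> 3"
    and ab: "\<And>k. k \<le> 2 \<Longrightarrow> a k \<in> {..<m}" "\<And>k. k \<le> 2 \<Longrightarrow> b k \<in> {..<n}" and nz: "minor 3 a b (generic n c) \<noteq> 0"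
    and no: "\<And>a b p. (\<And>k. k \<le> 2 \<Longrightarrow> a k \<in> {..<m}) \<Longrightarrow> (\<And>k. k \<le> 2 \<Longrightarrow> b k \<in> {..<n}) \<Longrightarrow>
      minor 3 a b (\<lambda>i j. \<Sum>k<n. c i j k * p k) = 0"
  shows "\<exists>S\<in>GL m. \<exists>A\<in>GL n. case1 n (tr S A) \<or> case6 n (tr S A)"
proof -
  define h :: "'a \<Rightarrow> 'a mpoly fract" where "h x = to_fract (Const x)" for x
  have h: "comm_ring_hom h"
    by unfold_locales (simp_all add: h_def Const.hom_add Const.hom_mult)
  interpret h: comm_ring_hom h by (rule h)
  define ch where "ch i j k = h (c i j k)" for i j k
  have ch_sym: "ch i j k = ch i k j" for i j k unfolding ch_def c_sym[of i j k] ..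
  define p where "p k = to_fract (X k :: 'a mpoly)" for k
  \<comment> \<open>At the generic point the matrix of values is the Jacobian matrix, which has a
    nonzero 3 by 3 minor by assumption.\<close>
  have "(\<lambda>i j. \<Sum>k<n. h (c i j k) * p k) = (\<lambda>i j. to_fract (generic n c i j))"
    by (simp add: generic_def h_def p_def to_fract.hom_sum to_fract.hom_mult)
  then have "minor 3 a b (\<lambda>i j. \<Sum>k<n. h (c i j k) * p k) \<noteq> 0"
    using nz by (simp add: to_fract.minor_hom)
  from frame_at_point[OF h rk ab this] obtain e1 e2 e3 q1 q2 q3
    where "framed_tensor fscale fscale (tens m n ch) p e1 e2 e3 q1 q2 q3"
    unfolding ch_def[abs_def] by blast
  then interpret F: framed_tensor fscale fscale "tens m n ch" p e1 e2 e3 q1 q2 q3 .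
  have three: "Suc 2 = 3" by simp
  have two_h: "(2 :: 'a mpoly fract) = 0"
  proof -
    have "(2 :: 'a mpoly fract) = h 2" using h.hom_add[of 1 1] by simp
    then show ?thesis by (simp add: two)
  qed
  have alt: "tens m n ch w x x = 0" for w x
    using tens_alternating[OF two_h, of m n "\<lambda>i j k. h (d i j k)" w x]
    unfolding ch_def[abs_def] c_def[abs_def] h.hom_add .
  \<comment> \<open>\<open>S\<close> is the set of points with coordinates in the base field. It
    contains the unit vectors, and a nonzero linear form is nonzero at one of them.\<close>
  have deg: "F.corank4" if ta: "F.ternary_alternating"
  proof (rule F.ternary_alternating_degenerate[OF ta, where S="\<lambda>P. \<exists>q :: nat \<Rightarrow> 'a. P = (\<lambda>k. h (q k))"])
    fix P :: "nat \<Rightarrow> 'a mpoly fract" and w y :: "nat \<Rightarrow> nat \<Rightarrow> 'a mpoly fract" assume "\<exists>q :: nat \<Rightarrow> 'a. P = (\<lambda>k. h (q k))"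
    then obtain q :: "nat \<Rightarrow> 'a" where P: "P = (\<lambda>k. h (q k))" by (rule exE)
    have "rank_le 2 {..<m} {..<n} (\<lambda>i j. h (\<Sum>k<n. c i j k * q k))"
    proof (rule rank_le_if_minors_zero)
      fix a b :: "nat \<Rightarrow> nat" assume ab: "\<And>k. k \<le> 2 \<Longrightarrow> a k \<in> {..<m}" "\<And>k. k \<le> 2 \<Longrightarrow> b k \<in> {..<n}"
      have "minor (Suc 2) a b (\<lambda>i j. \<Sum>k<n. c i j k * q k) = 0"
        using no[of a b q, OF ab] by (simp only: three)
      then show "minor (Suc 2) a b (\<lambda>i j. h (\<Sum>k<n. c i j k * q k)) = 0"
        unfolding h.minor_hom by simp
    qed
    from rank_le_UNIV[OF this, where f="\<lambda>w i. w i" and g="\<lambda>y j. y j"]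
    have "rank_le 2 UNIV UNIV (\<lambda>w y. \<Sum>i<m. \<Sum>j<n. w i * h (\<Sum>k<n. c i j k * q k) * y j)" .
    moreover have "tens m n ch w P y = (\<Sum>i<m. \<Sum>j<n. w i * h (\<Sum>k<n. c i j k * q k) * y j)" for w y
      unfolding F.sym[of w P y] unfolding tens_eq_sum P ch_def h.hom_sum h.hom_mult ..
    ultimately have "rank_le 2 UNIV UNIV (\<lambda>w y. tens m n ch w P y)" by (simp only:)
    then show "minor 3 w y (\<lambda>w y. tens m n ch w P y) = 0"
      by (rule minor_zero_if_rank_le[where r=2, unfolded three]) (rule UNIV_I)+
  next
    fix P Q :: "nat \<Rightarrow> 'a mpoly fract"
    assume "\<exists>q :: nat \<Rightarrow> 'a. P = (\<lambda>k. h (q k))" "\<exists>q :: nat \<Rightarrow> 'a. Q = (\<lambda>k. h (q k))"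
    then obtain q r :: "nat \<Rightarrow> 'a" where PQ: "P = (\<lambda>k. h (q k))" "Q = (\<lambda>k. h (r k))" by blast
    show "\<exists>q :: nat \<Rightarrow> 'a. P + Q = (\<lambda>k. h (q k))"
      by (rule exI[of _ "\<lambda>k. q k + r k"]) (simp add: PQ plus_fun_def h.hom_add)
  next
    fix l :: "(nat \<Rightarrow> 'a mpoly fract) \<Rightarrow> 'a mpoly fract" and x assume l: "F.linform l" and lx: "l x \<noteq> 0"
    have add: "l (\<lambda>j. f j + g j) = l f + l g" for f g using l unfolding F.linform_def plus_fun_def by blast
    have sc: "l (\<lambda>j. a * f j) = a * l f" for f a using l unfolding F.linform_def by blast
    have zero: "l (\<lambda>_. 0) = 0" using sc[of 0 "\<lambda>_. 0"] by simp
    have sum: "l (\<lambda>j. \<Sum>k<s. x k * delta k j) = (\<Sum>k<s. x k * l (delta k))" for s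
      by (induction s) (simp_all add: zero add sc)
    have "l x = l (\<lambda>j. \<Sum>k<n. x k * delta k j)"
    proof -
      have e: "(\<Sum>k<n. x k * delta k j) = x j" if "j < n" for j
        using sum_mult_delta(1)[of x j n] that by (simp only: if_True)
      have "tens m n ch w y (\<lambda>j. x j + (-1) * (\<Sum>k<n. x k * delta k j)) = 0" for w y
        by (subst tens_coords_v[where y'="\<lambda>_. 0"]) (simp_all only: e tens_def, simp_all)
      then have "l (\<lambda>j. x j + (-1) * (\<Sum>k<n. x k * delta k j)) = 0"
        using l unfolding F.linform_def F.rad_def by blast
      then have "l x + (-1) * l (\<lambda>j. \<Sum>k<n. x k * delta k j) = 0" unfolding add sc .
      then show ?thesis by simp
    qed
    then have "(\<Sum>k<n. x k * l (delta k)) \<noteq> 0" using lx by (simp only: sum not_False_eq_True)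
    then obtain k where nz: "l (delta k) \<noteq> 0" by (metis (no_types, lifting) mult_zero_right sum.neutral)
    show "\<exists>P. (\<exists>q :: nat \<Rightarrow> 'a. P = (\<lambda>k. h (q k))) \<and> l P \<noteq> 0"
    proof (intro exI conjI)
      show "delta k = (\<lambda>j. h (delta k j))" by (rule ext) simp
    qed (rule nz)
  qed
  from F.rank_3_cases_even[OF alt two_h] deg consider "F.spanned3" | "F.corank4" by blast
  then show ?thesis
  proof cases
    case 1
    have "rank_le 3 ({..<n} \<times> {..<n}) {..<m} (\<lambda>(j, k) i. ch i j k)"
      by (rule rank_le_if_spanned3[OF ch_sym 1])
    then have "rank_le 3 ({..<n} \<times> {..<n}) {..<m} (\<lambda>p i. h ((case p of (j, k) \<Rightarrow> \<lambda>i. c i j k) i))"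
      by (rule rank_le_cong[THEN iffD1, rotated]) (auto simp: ch_def)
    from case1_exists[OF rank_le_descend[OF h this]] show ?thesis by blast
  next
    case 2
    have "rank_le 4 ({..<m} \<times> {..<n}) {..<n} (\<lambda>(i, k) j. ch i k j)"
      by (rule rank_le_if_corank4[OF ch_sym 2])
    then have "rank_le 4 ({..<m} \<times> {..<n}) {..<n} (\<lambda>p j. h ((case p of (i, k) \<Rightarrow> \<lambda>j. c i k j) j))"
      by (rule rank_le_cong[THEN iffD1, rotated]) (auto simp: ch_def)
    from cols_exist[OF rank_le_descend[OF h this]] show ?thesis
      using two unfolding case6_def CHAR_eq_2_iff by blast
  qed
qed

theorem forward:
  assumes "jacobian_rank n H = 3"
  shows "\<exists>S\<in>GL m. \<exists>A\<in>GL n. case1 n (tr S A) \<or> case2 n (tr S A) \<or> case3 n (tr S A) \<or>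
    case4 n (tr S A) \<or> case5 n (tr S A) \<or> case6 n (tr S A)"
proof -
  have rk: "jacobian_rank n H \<le> 3" and "\<not> jacobian_rank n H \<le> 2" using assms by simp_all
  then have "\<not> rank_le 2 {..<m} {..<n} (\<lambda>i j. to_fract (generic n c i j))"
    by (simp only: jacobian_rank_le_iff not_False_eq_True)
  then obtain a b where ab: "\<And>k. k \<le> 2 \<Longrightarrow> a k \<in> {..<m}" "\<And>k. k \<le> 2 \<Longrightarrow> b k \<in> {..<n}"
    and "minor (Suc 2) a b (\<lambda>i j. to_fract (generic n c i j)) \<noteq> 0"
    by (rule nonzero_minor) (rule that)
  then have nz: "minor 3 a b (generic n c) \<noteq> 0"
    unfolding to_fract.minor_hom by (simp add: eval_nat_numeral)
  show ?thesis
  proof (cases "(2::'a) = 0")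
    case False
    from forward_odd[OF False rk ab nz] show ?thesis by blast
  next
    case two: True
    show ?thesis
    proof (cases "\<exists>a b p. (\<forall>k\<le>2. a k \<in> {..<m}) \<and> (\<forall>k\<le>2. b k \<in> {..<n}) \<and>
        minor 3 a b (\<lambda>i j. \<Sum>k<n. c i j k * p k) \<noteq> 0")
      case True
      then obtain a b p where a: "\<forall>k\<le>2. a k \<in> {..<m}" and b: "\<forall>k\<le>2. b k \<in> {..<n}"
        and p: "minor 3 a b (\<lambda>i j. \<Sum>k<n. c i j k * p k) \<noteq> 0"
        by (elim exE conjE) (rule that)
      from forward_even_point[OF two rk _ _ p] a b show ?thesis by blast
    next
      case False
      have "minor 3 a b (\<lambda>i j. \<Sum>k<n. c i j k * p k) = 0"
        if "\<And>k. k \<le> 2 \<Longrightarrow> a k \<in> {..<m}" "\<And>k. k \<le> 2 \<Longrightarrow> b k \<in> {..<n}" for a b p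
      proof (rule ccontr)
        assume "minor 3 a b (\<lambda>i j. \<Sum>k<n. c i j k * p k) \<noteq> 0"
        with that have "\<exists>a b p. (\<forall>k\<le>2. a k \<in> {..<m}) \<and> (\<forall>k\<le>2. b k \<in> {..<n}) \<and>
          minor 3 a b (\<lambda>i j. \<Sum>k<n. c i j k * p k) \<noteq> 0"
          by (intro exI[of _ a] exI[of _ b] exI[of _ p] conjI allI impI)
        with False show False by (rule notE)
      qed
      from forward_even_no_point[OF two rk ab nz this] show ?thesis by blast
    qed
  qed
qed

section \<open>The rank bound in each case\<close>

lemma rows_entry:
  assumes "only_first_rows r (jacobian n H)" "i < m" "r \<le> i" "j < n"
  shows "generic n c i j = 0"
proof -
  have "row (jacobian n H) i $ j = 0" using assms by (simp add: only_first_rows_def jacobian_def dim_H)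
  then show ?thesis using assms by (simp add: jacobian_def dim_H pderiv_H)
qed

lemma cols_entry:
  assumes "only_first_cols r (jacobian n H)" "i < m" "r \<le> j" "j < n"
  shows "generic n c i j = 0"
proof -
  have "col (jacobian n H) j $ i = 0" using assms by (simp add: only_first_cols_def jacobian_def dim_H)
  then show ?thesis using assms by (simp add: jacobian_def dim_H pderiv_H)
qed

lemma rank_le_3_if_cols:
  assumes "\<And>i j. i < m \<Longrightarrow> 3 \<le> j \<Longrightarrow> j < n \<Longrightarrow> generic n c i j = 0"
  shows "jacobian_rank n H \<le> 3"
proof -
  have "rank_le 3 {..<n} {..<m} (\<lambda>j i. to_fract (generic n c i j))"
    by (rule rank_le_rows) (simp add: assms)
  from rank_le_transpose[OF this] show ?thesis unfolding jacobian_rank_le_iff .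
qed

lemma rank_le_3_if_relation:
  assumes m: "4 \<le> m" and R: "only_first_rows 4 (jacobian n H)" and f3: "f3 \<noteq> 0"
    and rel: "\<And>j. j < n \<Longrightarrow> f0 * pderiv_mpoly j (H $ 0) + f1 * pderiv_mpoly j (H $ 1) +
      f2 * pderiv_mpoly j (H $ 2) + f3 * pderiv_mpoly j (H $ 3) = 0"
  shows "jacobian_rank n H \<le> 3"
  unfolding jacobian_rank_le_iff
proof (rule rank_le_relation[where f="\<lambda>i. to_fract ([f0, f1, f2, f3] ! i)"])
  fix i j assume "i < m" "3 < i" "j \<in> {..<n}"
  then show "to_fract (generic n c i j) = 0" using rows_entry[OF R, of i j] by simp
next
  fix j assume "j \<in> {..<n}"
  then have j: "j < n" by simp
  have "(\<Sum>i<Suc 3. [f0, f1, f2, f3] ! i * generic n c i j) = 0"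
    using rel[OF j] m j by (simp add: pderiv_H eval_nat_numeral)
  then have "to_fract (\<Sum>i<Suc 3. [f0, f1, f2, f3] ! i * generic n c i j) = 0" by (simp only: to_fract_0)
  then show "(\<Sum>i<Suc 3. to_fract ([f0, f1, f2, f3] ! i) * to_fract (generic n c i j)) = 0"
    by (simp only: to_fract.hom_sum to_fract.hom_mult)
qed (use f3 in \<open>simp add: numeral_3_eq_3\<close>)

lemma euler_even:
  assumes "(2::'a) = 0"
  shows "(\<Sum>j<n. X j * generic n c i j) = 0"
proof -
  have "(\<Sum>j<n. X j * generic n c i j) = (\<Sum>j<n. \<Sum>k<n. Const (d i j k) * (X j * X k)) + (\<Sum>j<n. \<Sum>k<n. Const (d i k j) * (X j * X k))"
    unfolding generic_def c_def Const.hom_add distrib_right sum.distrib sum_distrib_left distrib_left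
    by (simp only: mult.left_commute)
  also have "(\<Sum>j<n. \<Sum>k<n. Const (d i k j) * (X j * X k)) = (\<Sum>j<n. \<Sum>k<n. Const (d i j k) * (X j * X k))"
    by (subst sum.swap) (simp only: mult.commute[of "X _" "X _"])
  finally show ?thesis by (simp only: add_self_zero[OF assms])
qed

lemma X_nonzero: "(X i :: 'a mpoly) \<noteq> 0"
proof
  interpret id: mpoly_eval "\<lambda>x::'a. x" by unfold_locales simp_all
  assume "(X i :: 'a mpoly) = 0"
  then have "eval_mpoly (\<lambda>x. x) (\<lambda>_. 1) (X i :: 'a mpoly) = (0 :: 'a)" by (simp only: id.eval_zero)
  then show False unfolding id.eval_X by (simp only: one_neq_zero)
qed

theorem backward:
  assumes "case1 n H \<or> case2 n H \<or> case3 n H \<or> case4 n H \<or> case5 n H \<or> case6 n H"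
  shows "jacobian_rank n H \<le> 3"
proof -
  have vec4: "a1 = b1 \<and> a2 = b2 \<and> a3 = b3"
    if "vec_of_list [a0, a1, a2, a3] = vec_of_list [b0, b1, b2, b3]" for a0 a1 a2 a3 b0 b1 b2 b3 :: "'a mpoly"
  proof -
    have "[a0, a1, a2, a3] = [b0, b1, b2, b3]" using arg_cong[OF that, of list_of_vec] by (simp only: list_vec)
    then show ?thesis by simp
  qed
  have half: "Const (1/2) * (p + p) = p" "Const (e/2) * (p + p) = Const e * p" if "(2::'a) \<noteq> 0" for p :: "'a mpoly" and e
  proof -
    have "Const (e/2) * (p + p) = Const (e/2 + e/2) * p" for e by (simp only: Const.hom_add distrib_left distrib_right)
    moreover have "e/2 + e/2 = e" for e :: 'a using that by (simp add: field_simps)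
    ultimately show "Const (e/2) * (p + p) = Const e * p" for e by (simp only:)
    from this[of 1] show "Const (1/2) * (p + p) = p" by simp
  qed
  from assms consider (1) "case1 n H" | (2) "case2 n H" | (3) "case3 n H" | (4) "case4 n H" | (5) "case5 n H" | (6) "case6 n H"
    by blast
  then show ?thesis
  proof cases
    case 1
    have "rank_le 3 {..<m} {..<n} (\<lambda>i j. to_fract (generic n c i j))"
      by (rule rank_le_rows) (use 1 rows_entry in \<open>simp add: case1_def\<close>)
    then show ?thesis unfolding jacobian_rank_le_iff .
  next
    case 2
    then have m: "4 \<le> m" and two: "(2::'a) \<noteq> 0" and R: "only_first_rows 4 (jacobian n H)"
      and v: "vec_of_list [H $ 0, H $ 1, H $ 2, H $ 3] =
        vec_of_list [H $ 0, Const (1/2) * X 0 ^ 2, X 0 * X 1, Const (1/2) * X 1 ^ 2]"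
      unfolding case2_def CHAR_eq_2_iff dim_H by blast+
    have Hs: "H $ 1 = Const (1/2) * (X 0 * X 0)" "H $ 2 = X 0 * X 1" "H $ 3 = Const (1/2) * (X 1 * X 1)"
      using vec4[OF v] by (simp_all add: power2_eq_square)
    have P: "pderiv_mpoly j (Const (1/2) * (X i * X i :: 'a mpoly)) = (if i = j then X i else 0)" for i j
      unfolding pderiv_mpoly_Const_mult pderiv_mpoly_X_mult_X half(1)[OF two] ..
    show ?thesis
    proof (rule rank_le_3_if_relation[OF m R])
      show "(X 0 * X 0 :: 'a mpoly) \<noteq> 0" using X_nonzero by simp
      \<comment> \<open>Half the differential of
        \<open>(H $ 2)^2 = 4 * H $ 1 * H $ 3\<close>.\<close>
      show "0 * pderiv_mpoly j (H $ 0) + (X 1 * X 1) * pderiv_mpoly j (H $ 1) + (- (X 0 * X 1)) * pderiv_mpoly j (H $ 2) +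
          (X 0 * X 0) * pderiv_mpoly j (H $ 3) = 0" for j
        unfolding Hs P pderiv_mpoly_X_mult_X by (cases "j = 0"; cases "j = 1") simp_all
    qed
  next
    case 3
    then have m: "4 \<le> m" and two: "(2::'a) = 0" and R: "only_first_rows 4 (jacobian n H)"
      and J: "jacobian n (vec_of_list [H $ 0, H $ 1, H $ 2, H $ 3]) =
        jacobian n (vec_of_list [H $ 0, X 0 * X 1, X 0 * X 2, X 1 * X 2])"
      unfolding case3_def CHAR_eq_2_iff dim_H by blast+
    note dbl = add_self_zero[OF two]
    have two': "(2 :: 'a mpoly) = 0" using dbl[of 1] by (simp only: one_add_one)
    have D: "pderiv_mpoly j (H $ 1) = pderiv_mpoly j (X 0 * X 1)" "pderiv_mpoly j (H $ 2) = pderiv_mpoly j (X 0 * X 2)"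
       "pderiv_mpoly j (H $ 3) = pderiv_mpoly j (X 1 * X 2)" if j: "j < n" for j
      using arg_cong[OF J, of "\<lambda>A. A $$ (1, j)"] arg_cong[OF J, of "\<lambda>A. A $$ (2, j)"] arg_cong[OF J, of "\<lambda>A. A $$ (3, j)"] j
      by (simp_all add: jacobian_def vec_of_list_index numeral_2_eq_2 numeral_3_eq_3)
    show ?thesis
    proof (rule rank_le_3_if_relation[OF m R])
      show "(X 0 :: 'a mpoly) \<noteq> 0" by (rule X_nonzero)
      fix j assume j: "j < n"
      \<comment> \<open>With x, y, z for the three variables, z d(xy) + y d(xz) + x d(yz) = 2
        d(xyz), which is zero here.\<close>
      have "X 2 * ((if 0 = j then X 1 else 0) + (if 1 = j then X 0 else 0)) +
          X 1 * ((if 0 = j then X 2 else 0) + (if 2 = j then X 0 else 0)) +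
          X 0 * ((if 1 = j then X 2 else 0) + (if 2 = j then X 1 else 0)) = (0 :: 'a mpoly)"
        by (cases "j = 0"; cases "j = 1"; cases "j = 2") (simp_all add: mult.commute[of "X 2"] mult.commute[of "X 1" "X 0"] dbl two')
      then show "0 * pderiv_mpoly j (H $ 0) + X 2 * pderiv_mpoly j (H $ 1) + X 1 * pderiv_mpoly j (H $ 2) +
          X 0 * pderiv_mpoly j (H $ 3) = 0"
        unfolding D[OF j] pderiv_mpoly_X_mult_X by (simp only: mult_zero_left add_0_left)
    qed
  next
    case 4
    then have m: "4 \<le> m" and two: "(2::'a) \<noteq> 0" and R: "only_first_rows 4 (jacobian n H)"
      and "\<exists>e. e \<noteq> 0 \<and> vec_of_list [H $ 0, H $ 1, H $ 2, H $ 3] =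
        vec_of_list [X 0 * X 2 + Const e * X 1 * X 3, X 1 * X 2 - X 0 * X 3,
          Const (1/2) * X 2 ^ 2 + Const (e/2) * X 3 ^ 2, Const (1/2) * X 0 ^ 2 + Const (e/2) * X 1 ^ 2]"
      unfolding case4_def CHAR_eq_2_iff dim_H by blast+
    then obtain e where v: "vec_of_list [H $ 0, H $ 1, H $ 2, H $ 3] =
        vec_of_list [X 0 * X 2 + Const e * X 1 * X 3, X 1 * X 2 - X 0 * X 3,
          Const (1/2) * X 2 ^ 2 + Const (e/2) * X 3 ^ 2, Const (1/2) * X 0 ^ 2 + Const (e/2) * X 1 ^ 2]" by blast
    have H0: "H $ 0 = X 0 * X 2 + Const e * X 1 * X 3" using arg_cong[OF v, of "\<lambda>v. v $ 0"] by simp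
    have Hs: "H $ 0 = X 0 * X 2 + Const e * (X 1 * X 3)" "H $ 1 = X 1 * X 2 - X 0 * X 3"
      "H $ 2 = Const (1/2) * (X 2 * X 2) + Const (e/2) * (X 3 * X 3)"
      "H $ 3 = Const (1/2) * (X 0 * X 0) + Const (e/2) * (X 1 * X 1)"
      using vec4[OF v] H0 by (simp_all only: power2_eq_square mult.assoc)
    have P: "pderiv_mpoly j (Const (1/2) * (X i * X i :: 'a mpoly)) = (if i = j then X i else 0)"
      "pderiv_mpoly j (Const (e/2) * (X i * X i :: 'a mpoly)) = Const e * (if i = j then X i else 0)" for i j
      unfolding pderiv_mpoly_Const_mult pderiv_mpoly_X_mult_X half[OF two] by simp_all
    have D: "pderiv_mpoly j (H $ 0) = ((if 0 = j then X 2 else 0) + (if 2 = j then X 0 else 0)) + Const e * ((if 1 = j then X 3 else 0) + (if 3 = j then X 1 else 0))"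
      "pderiv_mpoly j (H $ 1) = ((if 1 = j then X 2 else 0) + (if 2 = j then X 1 else 0)) - ((if 0 = j then X 3 else 0) + (if 3 = j then X 0 else 0))"
      "pderiv_mpoly j (H $ 2) = (if 2 = j then X 2 else 0) + Const e * (if 3 = j then X 3 else 0)"
      "pderiv_mpoly j (H $ 3) = (if 0 = j then X 0 else 0) + Const e * (if 1 = j then X 1 else 0)" for j
      unfolding Hs pderiv_mpoly_add pderiv_mpoly_minus P unfolding pderiv_mpoly_Const_mult pderiv_mpoly_X_mult_X by (rule refl)+
    \<comment> \<open>Multiplicativity of the norm reads
      \<open>(H $ 0)^2 + Const e * (H $ 1)^2 = ?P * ?Q\<close>, where \<open>H $ 2\<close> and
      \<open>H $ 3\<close> are half of \<open>?P\<close> and \<open>?Q\<close>; half of its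
      differential is the relation below.\<close>
    let ?P = "X 2 * X 2 + Const e * (X 3 * X 3) :: 'a mpoly" and ?Q = "X 0 * X 0 + Const e * (X 1 * X 1) :: 'a mpoly"
    show ?thesis
    proof (rule rank_le_3_if_relation[OF m R])
      \<comment> \<open>The value of \<open>?P\<close> at the third unit vector is 1, so it is a
        nonzero polynomial.\<close>
      have nz: "delta 2 2 * delta 2 2 + e * (delta 2 3 * delta 2 3) \<noteq> (0::'a)" by simp
      show "- ?P \<noteq> 0"
      proof
        interpret id: mpoly_eval "\<lambda>x::'a. x" by unfold_locales simp_all
        assume "- ?P = 0"
        then have "?P = 0" by (simp only: neg_equal_0_iff_equal)
        then have "eval_mpoly (\<lambda>x. x) (delta 2) ?P = (0::'a)" by (simp only: id.eval_zero)
        from nz this[unfolded id.eval_add id.eval_mult id.eval_X id.eval_Const] show False by (rule notE)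
      qed
      show "(X 0 * X 2 + Const e * (X 1 * X 3)) * pderiv_mpoly j (H $ 0) + (Const e * (X 1 * X 2 - X 0 * X 3)) * pderiv_mpoly j (H $ 1) +
          (- ?Q) * pderiv_mpoly j (H $ 2) + (- ?P) * pderiv_mpoly j (H $ 3) = 0" for j
      proof -
        consider "j = 0" | "j = 1" | "j = 2" | "j = 3" | "j \<noteq> 0" "j \<noteq> 1" "j \<noteq> 2" "j \<noteq> 3" by blast
        then show ?thesis unfolding D by cases (simp_all add: algebra_simps)
      qed
    qed
  next
    case 5
    then have C: "only_first_cols 3 (jacobian n H)" unfolding case5_def by (rule conjunct2)
    show ?thesis by (rule rank_le_3_if_cols) (rule cols_entry[OF C])
  next
    case 6
    then have two: "(2::'a) = 0" and C: "only_first_cols 4 (jacobian n H)"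
      unfolding case6_def CHAR_eq_2_iff by blast+
    show ?thesis
    proof (cases "4 \<le> n")
      case False
      then show ?thesis by (intro rank_le_3_if_cols) simp
    next
      case True
      have "rank_le 3 {..<n} {..<m} (\<lambda>j i. to_fract (generic n c i j))"
      proof (rule rank_le_relation[where f="\<lambda>j. to_fract (X j)"])
        fix j i assume "j < n" "3 < j" "i \<in> {..<m}"
        then show "to_fract (generic n c i j) = 0" using cols_entry[OF C, of i j] by simp
      next
        fix i assume i: "i \<in> {..<m}"
        \<comment> \<open>Columns from index 4 on vanish, which cuts Euler's sum down to four terms;
          it is solved for the column of \<open>X 3\<close>.\<close>
        have "(\<Sum>j<Suc 3. X j * generic n c i j) = (\<Sum>j<n. X j * generic n c i j)"
          by (rule sum.mono_neutral_left) (use True i cols_entry[OF C, of i] in auto)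
        also have "\<dots> = 0" by (rule euler_even[OF two])
        finally have "to_fract (\<Sum>j<Suc 3. X j * generic n c i j) = 0" by (simp only: to_fract_0)
        then show "(\<Sum>j<Suc 3. to_fract (X j) * to_fract (generic n c i j)) = 0"
          by (simp only: to_fract.hom_sum to_fract.hom_mult)
      qed (simp add: X_nonzero)
      from rank_le_transpose[OF this] show ?thesis unfolding jacobian_rank_le_iff .
    qed
  qed
qed

end

lemma quadratic_map_exists:
  assumes "quadratic_homogeneous_map m n H"
  shows "\<exists>d. quadratic_map m n H d"
proof -
  have "\<forall>i. \<exists>e. i < m \<longrightarrow> H $ i = quadratic_form n e"
    using assms quadratic_homogeneous_eq unfolding quadratic_homogeneous_map_def by blast
  then obtain d where "\<And>i. i < m \<longrightarrow> H $ i = quadratic_form n (d i)"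
    by (rule choice_obtain) (rule that)
  moreover have "dim_vec H = m" using assms by (auto simp: quadratic_homogeneous_map_def)
  ultimately have "quadratic_map m n H d" by unfold_locales simp_all
  then show ?thesis by blast
qed

theorem theorem3p1:
  fixes m n :: nat
  shows "(\<forall>H :: 'a::field mpoly vec.
           quadratic_homogeneous_map m n H \<and> jacobian_rank n H = 3 \<longrightarrow>
           (\<exists>S \<in> GL m. \<exists>T \<in> GL n.
             let H' = linear_transform n S T H in
             case1 n H' \<or> case2 n H' \<or> case3 n H' \<or> case4 n H' \<or> case5 n H' \<or> case6 n H'))
       \<and> (\<forall>H' :: 'a mpoly vec.
           quadratic_homogeneous_map m n H' \<and>
           (case1 n H' \<or> case2 n H' \<or> case3 n H' \<or> case4 n H' \<or> case5 n H' \<or> case6 n H') \<longrightarrow>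
           jacobian_rank n H' \<le> 3)"
proof (intro conjI allI impI; elim conjE)
  fix H :: "'a mpoly vec"
  assume q: "quadratic_homogeneous_map m n H" and r: "jacobian_rank n H = 3"
  obtain d where "quadratic_map m n H d" using quadratic_map_exists[OF q] ..
  then interpret quadratic_map m n H d .
  obtain S A where S: "S \<in> GL m" and A: "A \<in> GL n" and C: "case1 n (tr S A) \<or> case2 n (tr S A) \<or> case3 n (tr S A) \<or>
      case4 n (tr S A) \<or> case5 n (tr S A) \<or> case6 n (tr S A)"
    using forward[OF r] by blast
  show "\<exists>S \<in> GL m. \<exists>T \<in> GL n. let H' = linear_transform n S T H in
      case1 n H' \<or> case2 n H' \<or> case3 n H' \<or> case4 n H' \<or> case5 n H' \<or> case6 n H'"
    unfolding Let_def by (rule bexI[OF _ S], rule bexI[OF _ transpose_GL[OF A]], rule C[unfolded tr_def])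
next
  fix H :: "'a mpoly vec"
  assume q: "quadratic_homogeneous_map m n H"
    and C: "case1 n H \<or> case2 n H \<or> case3 n H \<or> case4 n H \<or> case5 n H \<or> case6 n H"
  obtain d where "quadratic_map m n H d" using quadratic_map_exists[OF q] ..
  then interpret quadratic_map m n H d .
  show "jacobian_rank n H \<le> 3" by (rule backward[OF C])
qed

end
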